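(* The candidate surface branched covers of degree $d$ inducing a candidate 2-orbifold cover $S(2,2,2,2)\dashrightarrow S(2,3,6)$ are the following, with $\widetilde\Sigma=\Sigma=S$ and $k\geq 1$: \begin{enumerate} \item $d=6k$, partitions $(2^{3k-2},1,1,1,1),(3^{2k}),(6^k)$; \item $d=6k+3$, partitions $(2^{3k},1,1,1),(3^{2k+1}),(6^k,3)$; \item $d=6k+6$, partitions $(2^{3k+2},1,1),(3^{2k+2}),(6^k,3,3)$; \item $d=6k+9$, partitions $(2^{3k+4},1),(3^{2k+3}),(6^k,3,3,3)$; \item $d=6k+12$, partitions $(2^{3k+6}),(3^{2k+4}),(6^k,3,3,3,3)$. \end{enumerate} Those of types 1, 2 and 3 are always realizable, those of type 4 are never realizable, and one of type 5 is realizable if and only if $d$ is a multiple of $12$.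
   Context: $S$ is the 2-sphere. A partition of $d$ is a finite unordered list (multiset) of positive integers with sum $d$; $\ell(\Pi)$ is the number of entries of $\Pi$; $(a^m,b,\ldots)$ means that $a$ is repeated $m$ times. For closed connected orientable surfaces $\widetilde\Sigma,\Sigma$, a branched cover $f:\widetilde\Sigma\to\Sigma$ is a map locally modelled on $(\mathbb{C},0)\to(\mathbb{C},0)$, $z\mapsto z^k$ with $k\geq 1$; $k$ is the local degree at the source point, and a point of $\Sigma$ having a preimage with local degree $>1$ is a branching point. The degree $d$ of $f$ is the degree of the genuine cover obtained by removing the branching points and their preimages; the local degrees at the preimages of a branching point form a partition of $d$. A candidate surface branched cover consists of closed connected orientable surfaces $\widetilde\Sigma,\Sigma$ (up to homeomorphism), integers $d\geq 2$ and $n\geq 1$, and an unordered collection (repetitions allowed) $\Pi_1,\ldots,\Pi_n$ of partitions of $d$, each with at least one entry $>1$, satisfying the Riemann-Hurwitz condition $\chi(\widetilde\Sigma)-\sum_i\ell(\Pi_i)=d\,(\chi(\Sigma)-n)$. It is realizable if there is a degree-$d$ branched cover $f:\widetilde\Sigma\to\Sigma$ with $n$ branching points whose associated partitions of local degrees are $\Pi_1,\ldots,\Pi_n$. A 2-orbifold $\Sigma(p_1,\ldots,p_n)$ is a closed connected orientable surface $\Sigma$ with $n$ cone points of orders $p_i\geq 2$. With $\Pi_i=(d_{ij})_j$, set $p_i=\mathrm{lcm}_j\, d_{ij}$ and $p_{ij}=p_i/d_{ij}$. The induced candidate 2-orbifold cover is $\widetilde X\dashrightarrow X$ with $X=\Sigma(p_1,\ldots,p_n)$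 and $\widetilde X=\widetilde\Sigma((p_{ij})_{i,j})$, where orders equal to $1$ are dropped. *)

theory Defs
  imports "HOL-Analysis.Analysis" "HOL-Homology.Homology" "HOL-Library.Multiset"
begin

definition chart :: "'a topology \<Rightarrow> 'a set \<Rightarrow> ('a \<Rightarrow> complex) \<Rightarrow> bool" where
  "chart X U \<phi> \<longleftrightarrow> openin X U \<and> open (\<phi> ` U) \<and>
     homeomorphic_map (subtopology X U) (top_of_set (\<phi> ` U)) \<phi>"

text \<open>
  An orientation is a choice of generators of the local homology groups
  \<open>H\<^sub>2(X, X - {x})\<close> that near every point is induced by a single class.
\<close>

definition orientable :: "'a topology \<Rightarrow> bool" where
  "orientable X \<longleftrightarrow> (\<exists>\<mu>.
     (\<forall>x\<in>topspace X.
        \<mu> x \<in> carrier (relative_homology_group 2 X (topspace X - {x})) \<and>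
        generate (relative_homology_group 2 X (topspace X - {x})) {\<mu> x} =
          carrier (relative_homology_group 2 X (topspace X - {x}))) \<and>
     (\<forall>x\<in>topspace X. \<exists>U. openin X U \<and> x \<in> U \<and>
        (\<exists>m \<in> carrier (relative_homology_group 2 X (topspace X - U)).
           \<forall>y\<in>U. hom_induced 2 X (topspace X - U) X (topspace X - {y}) id m = \<mu> y)))"

text \<open>Connectedness in the library does not exclude the empty space.\<close>

definition closed_surface :: "'a topology \<Rightarrow> bool" where
  "closed_surface X \<longleftrightarrow>
     topspace X \<noteq> {} \<and> connected_space X \<and> compact_space X \<and>
     Hausdorff_space X \<and> second_countable X \<and>
     (\<forall>x\<in>topspace X. \<exists>U \<phi>. chart X U \<phi> \<and> x \<in> U) \<and>
     orientable X"

definition independent_set :: "('g, 'm) monoid_scheme \<Rightarrow> 'g set \<Rightarrow> bool" where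
  "independent_set G B \<longleftrightarrow> finite B \<and> B \<subseteq> carrier G \<and>
     (\<forall>c :: 'g \<Rightarrow> int. finprod G (\<lambda>b. b [^]\<^bsub>G\<^esub> c b) B = \<one>\<^bsub>G\<^esub> \<longrightarrow> (\<forall>b\<in>B. c b = 0))"

text \<open>
  Rank of an abelian group; only meaningful when it is finite, as it is for the
  homology groups of closed surfaces.
\<close>

definition abelian_rank :: "('g, 'm) monoid_scheme \<Rightarrow> nat" where
  "abelian_rank G = Sup {card B | B. independent_set G B}"

text \<open>The homology of a surface vanishes above degree 2.\<close>

definition euler_char :: "'a topology \<Rightarrow> int" where
  "euler_char X = (\<Sum>p\<le>2. (-1) ^ p * int (abelian_rank (homology_group (int p) X)))"

definition locally_power ::
  "'a topology \<Rightarrow> 'b topology \<Rightarrow> ('a \<Rightarrow> 'b) \<Rightarrow> 'a \<Rightarrow> nat \<Rightarrow> bool" where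
  "locally_power X Y f x k \<longleftrightarrow> k \<ge> 1 \<and>
     (\<exists>U \<phi> V \<psi>. chart X U \<phi> \<and> x \<in> U \<and> \<phi> x = 0 \<and>
        chart Y V \<psi> \<and> f x \<in> V \<and> \<psi> (f x) = 0 \<and>
        f ` U \<subseteq> V \<and> (\<forall>z\<in>U. \<psi> (f z) = \<phi> z ^ k))"

definition branched_cover :: "'a topology \<Rightarrow> 'b topology \<Rightarrow> ('a \<Rightarrow> 'b) \<Rightarrow> bool" where
  "branched_cover X Y f \<longleftrightarrow> continuous_map X Y f \<and>
     (\<forall>x\<in>topspace X. \<exists>k. locally_power X Y f x k)"

definition local_degree :: "'a topology \<Rightarrow> 'b topology \<Rightarrow> ('a \<Rightarrow> 'b) \<Rightarrow> 'a \<Rightarrow> nat" where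
  "local_degree X Y f x = (THE k. locally_power X Y f x k)"

definition fibre :: "'a topology \<Rightarrow> ('a \<Rightarrow> 'b) \<Rightarrow> 'b \<Rightarrow> 'a set" where
  "fibre X f y = {x \<in> topspace X. f x = y}"

definition branching_points :: "'a topology \<Rightarrow> 'b topology \<Rightarrow> ('a \<Rightarrow> 'b) \<Rightarrow> 'b set" where
  "branching_points X Y f =
     {y \<in> topspace Y. \<exists>x \<in> fibre X f y. local_degree X Y f x > 1}"

text \<open>
  The genuine cover over the complement of the branching points has degree \<open>d\<close>.
\<close>

definition has_degree :: "'a topology \<Rightarrow> 'b topology \<Rightarrow> ('a \<Rightarrow> 'b) \<Rightarrow> nat \<Rightarrow> bool" where
  "has_degree X Y f d \<longleftrightarrow>
     (\<forall>y \<in> topspace Y - branching_points X Y f. finite (fibre X f y) \<and> card (fibre X f y) = d)"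

definition local_degrees ::
  "'a topology \<Rightarrow> 'b topology \<Rightarrow> ('a \<Rightarrow> 'b) \<Rightarrow> 'b \<Rightarrow> nat multiset" where
  "local_degrees X Y f y = image_mset (local_degree X Y f) (mset_set (fibre X f y))"

definition is_partition :: "nat \<Rightarrow> nat multiset \<Rightarrow> bool" where
  "is_partition d \<pi> \<longleftrightarrow> (\<forall>a \<in># \<pi>. a \<ge> 1) \<and> sum_mset \<pi> = d"

text \<open>
  The cover goes from \<open>X\<close> to \<open>Y\<close>; the number \<open>n\<close> of partitions is \<open>size P\<close>, and the
  number of entries of a partition is its size.
\<close>

definition candidate_cover ::
  "'a topology \<Rightarrow> 'b topology \<Rightarrow> nat \<Rightarrow> nat multiset multiset \<Rightarrow> bool" where
  "candidate_cover X Y d P \<longleftrightarrow>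
     closed_surface X \<and> closed_surface Y \<and> d \<ge> 2 \<and> size P \<ge> 1 \<and>
     (\<forall>\<pi> \<in># P. is_partition d \<pi> \<and> (\<exists>a \<in># \<pi>. a > 1)) \<and>
     euler_char X - (\<Sum>\<pi>\<in>#P. int (size \<pi>)) = int d * (euler_char Y - int (size P))"

definition realizable ::
  "'a topology \<Rightarrow> 'b topology \<Rightarrow> nat \<Rightarrow> nat multiset multiset \<Rightarrow> bool" where
  "realizable X Y d P \<longleftrightarrow> (\<exists>f. branched_cover X Y f \<and> has_degree X Y f d \<and>
     finite (branching_points X Y f) \<and>
     image_mset (local_degrees X Y f) (mset_set (branching_points X Y f)) = P)"

text \<open>
  A 2-orbifold is given by its underlying surface and the multiset of its cone orders.
  The positions of the cone points are immaterial up to isomorphism, because the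
  homeomorphism group of a connected surface acts transitively on \<open>n\<close>-tuples of
  distinct points.
\<close>

type_synonym 'a orbifold = "'a topology \<times> nat multiset"

definition orbifold_iso :: "'a orbifold \<Rightarrow> 'b orbifold \<Rightarrow> bool" where
  "orbifold_iso A B \<longleftrightarrow> fst A homeomorphic_space fst B \<and> snd A = snd B"

definition lcm_entries :: "nat multiset \<Rightarrow> nat" where
  "lcm_entries \<pi> = Lcm (set_mset \<pi>)"

definition induced_target :: "'b topology \<Rightarrow> nat multiset multiset \<Rightarrow> 'b orbifold" where
  "induced_target Y P = (Y, image_mset lcm_entries P)"

definition induced_source :: "'a topology \<Rightarrow> nat multiset multiset \<Rightarrow> 'a orbifold" where
  "induced_source X P =
     (X, filter_mset (\<lambda>p. p \<noteq> 1)
           (\<Sum>\<pi>\<in>#P. image_mset (\<lambda>a. lcm_entries \<pi> div a) \<pi>))"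

definition induces_orbifold_cover ::
  "'a topology \<Rightarrow> 'b topology \<Rightarrow> nat multiset multiset \<Rightarrow> 'c orbifold \<Rightarrow> 'd orbifold \<Rightarrow> bool"
where
  "induces_orbifold_cover X Y P A B \<longleftrightarrow>
     orbifold_iso (induced_source X P) A \<and> orbifold_iso (induced_target Y P) B"

abbreviation S2 :: "(nat \<Rightarrow> real) topology" where
  "S2 \<equiv> nsphere 2"

definition partitions_1 :: "nat \<Rightarrow> nat multiset multiset" where
  "partitions_1 k =
     {# replicate_mset (3*k - 2) 2 + {#1, 1, 1, 1#},
        replicate_mset (2*k) 3,
        replicate_mset k 6 #}"

definition partitions_2 :: "nat \<Rightarrow> nat multiset multiset" where
  "partitions_2 k =
     {# replicate_mset (3*k) 2 + {#1, 1, 1#},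
        replicate_mset (2*k + 1) 3,
        replicate_mset k 6 + {#3#} #}"

definition partitions_3 :: "nat \<Rightarrow> nat multiset multiset" where
  "partitions_3 k =
     {# replicate_mset (3*k + 2) 2 + {#1, 1#},
        replicate_mset (2*k + 2) 3,
        replicate_mset k 6 + {#3, 3#} #}"

definition partitions_4 :: "nat \<Rightarrow> nat multiset multiset" where
  "partitions_4 k =
     {# replicate_mset (3*k + 4) 2 + {#1#},
        replicate_mset (2*k + 3) 3,
        replicate_mset k 6 + {#3, 3, 3#} #}"

definition partitions_5 :: "nat \<Rightarrow> nat multiset multiset" where
  "partitions_5 k =
     {# replicate_mset (3*k + 6) 2,
        replicate_mset (2*k + 4) 3,
        replicate_mset k 6 + {#3, 3, 3, 3#} #}"

end

theory Submission
  imports Defs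
begin

text \<open>
Realizations come from lattices. Let \<open>L\<close> be the Eisenstein lattice, \<open>L'\<close> a sublattice spanned by \<open>m\<close> and
\<open>n \<omega>\<close>, and \<open>c\<close> an integer or half-integer. Dividing the plane by \<open>L\<close> and the sixth roots of unity gives
\<open>S(2,3,6)\<close>, dividing it by \<open>L'\<close> and the point reflection in \<open>c\<close> gives \<open>S(2,2,2,2)\<close>. Both quotients are
round spheres: three cosines map the second onto the compact piece of Cayley's cubic surface
\<open>1 + 2abc = a\<^sup>2 + b\<^sup>2 + c\<^sup>2\<close>, which is star-shaped, and for \<open>L' = L\<close> the remaining threefold symmetry is divided out
by tripling the angle about the axis of the sphere. The induced map between the quotients has degree \<open>3mn\<close>, and
its local degrees are the quotients of the orders of the stabilizers. Types 1, 2, 3, 5 correspond to 0, 1, 2, 4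
cone points of the source lying in \<open>L\<close>.

For the obstructions, put the branching points of orders 2, 3, 6 at \<open>1\<close>, \<open>\<infinity>\<close>, \<open>0\<close>. All local degrees
over \<open>\<infinity>\<close> and \<open>0\<close> are divisible by 3 and the source is simply connected, so \<open>f = g\<^sup>3\<close> with \<open>g\<close> of degree
\<open>d/3\<close>, and the fibre of \<open>f\<close> over \<open>1\<close> is the union of those of \<open>g\<close> over the three cube roots of unity. In type 4
the degree \<open>d/3\<close> is odd, so each of them contains a point of local degree 1, but there is only one such point.
In type 5 all local degrees over the roots of unity are 2, so \<open>(g - 1)/(g - \<omega>)\<close> is a square \<open>s\<^sup>2\<close>; the fibres
of \<open>s\<close> have weight \<open>d/6\<close>, and the one over a square root of the value at \<open>g = \<omega>\<^sup>2\<close> has only points of local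
degree 2, so that 4 divides \<open>d/3\<close>.
\<close>

section \<open>The partitions\<close>

text \<open>The spaces are only assumed homeomorphic to the sphere. There is no complex structure on
  the source, so a branched cover cannot be handled as a rational function, and continuity stands in
  for algebra: a local degree is the number of preimages of a nearby value, a degree is the weight
  of a fibre, and this weight is locally constant for proper maps. Roots such as \<open>g\<close>
  and \<open>s\<close> are continuous functions off a finite set of punctures. Divisibility of the
  local degrees removes the winding at a puncture, and a root keeps the points and local degrees of
  the original map and changes only the target; this is why weights of fibres of a map and of its
  root can be compared. In the construction, cosines of s, t and s - t take the place of elliptic
  functions: two of them would allow independent changes of sign of s and t, and the third one
  couples the signs. A half-integral \<open>c\<close> is what makes type 1 possible, since for an
  integral \<open>c\<close> the centre of reflection is itself a cone point of the source lying in
  the lattice.\<close>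

lemma mset_two_values:
  assumes "set_mset M \<subseteq> {a, b}" "a \<noteq> b"
  shows "M = replicate_mset (count M a) a + replicate_mset (count M b) b"
proof (rule multiset_eqI)
  fix x
  show "count M x = count (replicate_mset (count M a) a + replicate_mset (count M b) b) x"
  proof (cases "x \<in># M")
    case True
    then have "x = a \<or> x = b" using assms(1) by blast
    then show ?thesis using assms(2) by auto
  next
    case False
    then show ?thesis by (auto simp: not_in_iff)
  qed
qed

lemma set_mset_sum_mset: "set_mset (\<Sum>x\<in>#M. f x) = (\<Union>x\<in>set_mset M. set_mset (f x))"
  by (induction M) auto

lemma dvd_lcm_entries: "a \<in># \<pi> \<Longrightarrow> a dvd lcm_entries \<pi>"
  by (auto simp: lcm_entries_def)

lemma dvd_6_cases: "(a::nat) dvd 6 \<longleftrightarrow> a = 1 \<or> a = 2 \<or> a = 3 \<or> a = 6"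
proof
  assume "a dvd 6"
  then have "a \<le> 6" "a dvd 6" by (auto dest: dvd_imp_le)
  then have "a \<in> {0,1,2,3,4,5,6}" by auto
  with \<open>a dvd 6\<close> show "a = 1 \<or> a = 2 \<or> a = 3 \<or> a = 6" by auto
qed auto

lemma lcm_entries_dvd_three:
  assumes "\<And>a. a \<in># \<pi> \<Longrightarrow> a dvd 3"
  shows "lcm_entries \<pi> dvd 3"
  unfolding lcm_entries_def using assms by (simp add: Lcm_least)

text \<open>The cone orders of \<open>induced_source\<close>, separated from the space so that they
  can be computed by adding one partition at a time.\<close>

definition cone_orders :: "nat multiset multiset \<Rightarrow> nat multiset" where
  "cone_orders P = filter_mset (\<lambda>p. p \<noteq> 1) (\<Sum>\<pi>\<in>#P. image_mset (\<lambda>a. lcm_entries \<pi> div a) \<pi>)"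

lemma cone_orders_empty [simp]: "cone_orders {#} = {#}"
  by (simp add: cone_orders_def)

lemma cone_orders_add [simp]:
  "cone_orders (add_mset \<pi> P) =
     filter_mset (\<lambda>p. p \<noteq> 1) (image_mset (\<lambda>a. lcm_entries \<pi> div a) \<pi>) + cone_orders P"
  by (simp add: cone_orders_def)

lemma filter_replicate_mset:
  "filter_mset Q (replicate_mset n a) = (if Q a then replicate_mset n a else {#})"
  by (induction n) auto

text \<open>Every cone order is 2, so each quotient \<open>lcm_entries \<pi> div a\<close> is 1 or
  2. This leaves the entries 1, 2 for lcm 2, only 3 for lcm 3, and 3, 6 for lcm 6. The four cone
  points are shared between the ones of the first and the threes of the last partition, in five
  possible ways.\<close>

lemma partitions_if_orbifold_data:
  assumes part: "\<And>\<pi>. \<pi> \<in># P \<Longrightarrow> is_partition d \<pi>"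
    and lc: "image_mset lcm_entries P = {#2, 3, 6#}"
    and cones: "cone_orders P = {#2, 2, 2, 2#}"
  shows "\<exists>k\<ge>1. d = 6*k \<and> P = partitions_1 k \<or> d = 6*k + 3 \<and> P = partitions_2 k \<or>
           d = 6*k + 6 \<and> P = partitions_3 k \<or> d = 6*k + 9 \<and> P = partitions_4 k \<or>
           d = 6*k + 12 \<and> P = partitions_5 k"
proof -
  obtain A Q where A: "P = add_mset A Q" "lcm_entries A = 2" "image_mset lcm_entries Q = {#3, 6#}"
    using msed_map_invR[OF lc] by blast
  obtain B R where B: "Q = add_mset B R" "lcm_entries B = 3" "image_mset lcm_entries R = {#6#}"
    using msed_map_invR[OF A(3)] by blast
  obtain C T where C: "R = add_mset C T" "lcm_entries C = 6" "image_mset lcm_entries T = {#}"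
    using msed_map_invR[OF B(3)] by blast
  have P: "P = {#A, B, C#}" using A B C by simp
  have cone2: "lcm_entries \<pi> div a = 1 \<or> lcm_entries \<pi> div a = 2" if "\<pi> \<in># P" "a \<in># \<pi>" for \<pi> a
  proof (rule ccontr)
    assume *: "\<not> ?thesis"
    have "lcm_entries \<pi> div a \<in># cone_orders P"
      using that * unfolding cone_orders_def by (auto simp: set_mset_sum_mset)
    then show False using * unfolding cones by auto
  qed
  have "set_mset A \<subseteq> {1, 2}"
  proof
    fix a assume a: "a \<in># A"
    have "a dvd 2" using dvd_lcm_entries[OF a] A by simp
    then have "a dvd 6" by (rule dvd_trans) simp
    then show "a \<in> {1,2}" using \<open>a dvd 2\<close> by (auto simp: dvd_6_cases)
  qed
  then have Aeq: "A = replicate_mset (count A 1) 1 + replicate_mset (count A 2) 2"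
    using mset_two_values[of A 1 2] by simp
  have "set_mset B \<subseteq> {3, 1}"
  proof
    fix a assume a: "a \<in># B"
    have "a dvd 3" using dvd_lcm_entries[OF a] B by simp
    then have "a dvd 6" by (rule dvd_trans) simp
    then have "a = 1 \<or> a = 3" using \<open>a dvd 3\<close> by (auto simp: dvd_6_cases)
    then show "a \<in> {3,1}" by auto
  qed
  moreover have "1 \<notin># B" using cone2[of B 1] P B by auto
  ultimately have Bs: "set_mset B \<subseteq> {3, 1}" "count B 1 = 0" by (auto simp: not_in_iff)
  then have Beq: "B = replicate_mset (count B 3) 3"
    using mset_two_values[of B 3 1] by simp
  have "set_mset C \<subseteq> {3, 6}"
  proof
    fix a assume a: "a \<in># C"
    have "a dvd 6" using dvd_lcm_entries[OF a] C by simp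
    then consider "a = 1" | "a = 2" | "a = 3 \<or> a = 6" by (auto simp: dvd_6_cases)
    then show "a \<in> {3,6}"
      using cone2[of C a] a P C by cases auto
  qed
  then have Ceq: "C = replicate_mset (count C 3) 3 + replicate_mset (count C 6) 6"
    using mset_two_values[of C 3 6] by simp
  define a1 a2 b c3 c6 where defs: "a1 = count A 1" "a2 = count A 2" "b = count B 3" "c3 = count C 3" "c6 = count C 6"
  note eqs = Aeq[folded defs] Beq[folded defs] Ceq[folded defs]
  have cone: "cone_orders P =
      filter_mset (\<lambda>p. p \<noteq> 1) (image_mset (\<lambda>a. 2 div a) A) +
      (filter_mset (\<lambda>p. p \<noteq> 1) (image_mset (\<lambda>a. 3 div a) B) +
      filter_mset (\<lambda>p. p \<noteq> 1) (image_mset (\<lambda>a. 6 div a) C))"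
    unfolding P using A(2) B(2) C(2) by simp
  have "filter_mset (\<lambda>p. p \<noteq> 1) (image_mset (\<lambda>a. 2 div a) A) = replicate_mset a1 2"
    by (subst eqs(1)) (simp add: filter_replicate_mset)
  moreover have "filter_mset (\<lambda>p. p \<noteq> 1) (image_mset (\<lambda>a. 3 div a) B) = {#}"
    by (subst eqs(2)) (simp add: filter_replicate_mset)
  moreover have "filter_mset (\<lambda>p. p \<noteq> 1) (image_mset (\<lambda>a. 6 div a) C) = replicate_mset c3 2"
    by (subst eqs(3)) (simp add: filter_replicate_mset)
  ultimately have "size (cone_orders P) = a1 + c3"
    unfolding cone by simp
  then have s: "a1 + c3 = 4" unfolding cones by simp
  have "sum_mset A = d" "sum_mset B = d" "sum_mset C = d"
    using part P by (auto simp: is_partition_def)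
  moreover have "sum_mset A = a1 + 2 * a2" "sum_mset B = 3 * b" "sum_mset C = 3 * c3 + 6 * c6"
    using eqs by (metis sum_mset.union sum_mset_replicate_mset mult.right_neutral mult.commute of_nat_id)+
  ultimately have d: "a1 + 2 * a2 = d" "3 * b = d" "3 * c3 + 6 * c6 = d"
    by auto
  \<comment> \<open>Without an entry 6 the lcm of the third partition would divide 3; this is the
    origin of k \<ge> 1.\<close>
  have "c6 \<ge> 1"
  proof (rule ccontr)
    assume "\<not> c6 \<ge> 1"
    then have "C = replicate_mset c3 3" using eqs(3) by simp
    then have "lcm_entries C dvd 3" by (intro lcm_entries_dvd_three) (auto split: if_splits)
    then show False using C by simp
  qed
  have reps: "replicate_mset 2 x = {#x, x#}" "replicate_mset 3 x = {#x, x, x#}"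
    "replicate_mset 4 x = {#x, x, x, x#}" for x :: nat
    by (simp_all add: numeral_eq_Suc)
  have "c3 = 0 \<or> c3 = 1 \<or> c3 = 2 \<or> c3 = 3 \<or> c3 = 4" using s by auto
  then have "d = 6 * c6 \<and> P = partitions_1 c6 \<or> d = 6 * c6 + 3 \<and> P = partitions_2 c6 \<or>
           d = 6 * c6 + 6 \<and> P = partitions_3 c6 \<or> d = 6 * c6 + 9 \<and> P = partitions_4 c6 \<or>
           d = 6 * c6 + 12 \<and> P = partitions_5 c6"
  proof (elim disjE)
    assume c: "c3 = 0"
    then have "a1 = 4" "a2 = 3 * c6 - 2" "b = 2 * c6" "d = 6 * c6" using s d by auto
    then show ?thesis unfolding P partitions_1_def using eqs reps by (simp add: c)
  next
    assume c: "c3 = 1"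
    then have "a1 = 3" "a2 = 3 * c6" "b = 2 * c6 + 1" "d = 6 * c6 + 3" using s d by auto
    then show ?thesis unfolding P partitions_2_def using eqs reps by (simp add: c)
  next
    assume c: "c3 = 2"
    then have "a1 = 2" "a2 = 3 * c6 + 2" "b = 2 * c6 + 2" "d = 6 * c6 + 6" using s d by auto
    then show ?thesis unfolding P partitions_3_def using eqs reps by (simp add: c)
  next
    assume c: "c3 = 3"
    then have "a1 = 1" "a2 = 3 * c6 + 4" "b = 2 * c6 + 3" "d = 6 * c6 + 9" using s d by auto
    then show ?thesis unfolding P partitions_4_def using eqs reps by (simp add: c)
  next
    assume c: "c3 = 4"
    then have "a1 = 0" "a2 = 3 * c6 + 6" "b = 2 * c6 + 4" "d = 6 * c6 + 12" using s d by auto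
    then show ?thesis unfolding P partitions_5_def using eqs reps by (simp add: c)
  qed
  then show ?thesis using \<open>c6 \<ge> 1\<close> by blast
qed

lemma lcm_entries_insert: "lcm_entries (add_mset a \<pi>) = lcm a (lcm_entries \<pi>)"
  by (simp add: lcm_entries_def)

lemma lcm_entries_union: "lcm_entries (\<pi> + \<rho>) = lcm (lcm_entries \<pi>) (lcm_entries \<rho>)"
  by (induction \<pi>) (auto simp: lcm_entries_insert lcm.assoc lcm_entries_def)

lemma lcm_entries_replicate: "n \<ge> 1 \<Longrightarrow> lcm_entries (replicate_mset n a) = a"
  by (simp add: lcm_entries_def)

lemma lcm_entries_empty: "lcm_entries {#} = 1"
  by (simp add: lcm_entries_def)

lemmas lcm_entries_simps = lcm_entries_insert lcm_entries_union lcm_entries_replicate lcm_entries_empty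

lemma orbifold_data_of_partitions:
  assumes "k \<ge> 1"
    and "d = 6*k \<and> P = partitions_1 k \<or> d = 6*k + 3 \<and> P = partitions_2 k \<or>
           d = 6*k + 6 \<and> P = partitions_3 k \<or> d = 6*k + 9 \<and> P = partitions_4 k \<or>
           d = 6*k + 12 \<and> P = partitions_5 k"
  shows "d \<ge> 2" "size P = 3" "\<forall>\<pi>\<in>#P. is_partition d \<pi> \<and> (\<exists>a\<in>#\<pi>. a > 1)"
    and "(\<Sum>\<pi>\<in>#P. int (size \<pi>)) = int d + 2"
    and "image_mset lcm_entries P = {#2, 3, 6#}" "cone_orders P = {#2, 2, 2, 2#}"
proof -
  note ps = partitions_1_def partitions_2_def partitions_3_def partitions_4_def partitions_5_def
  have k2: "\<exists>j. k = Suc j" using assms(1) by (cases k) auto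
  have l: "lcm (2::nat) 1 = 2" "lcm (6::nat) 3 = 6" by (auto simp: lcm_nat_def)
  show "d \<ge> 2" using assms by auto
  show "size P = 3" using assms by (auto simp: ps)
  show "\<forall>\<pi>\<in>#P. is_partition d \<pi> \<and> (\<exists>a\<in>#\<pi>. a > 1)"
    using assms by (auto simp: ps is_partition_def split: if_splits)
  \<comment> \<open>For two spheres and three partitions, Riemann-Hurwitz reads 2 - (d + 2) = d * (2
    - 3).\<close>
  show "(\<Sum>\<pi>\<in>#P. int (size \<pi>)) = int d + 2"
    using assms by (auto simp: ps)
  show "image_mset lcm_entries P = {#2, 3, 6#}"
    using assms by (auto simp: ps lcm_entries_simps l)
  show "cone_orders P = {#2, 2, 2, 2#}"
    using assms by (auto simp: ps lcm_entries_simps l filter_replicate_mset)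
qed


section \<open>The sphere as a closed surface\<close>

lemma abelian_rank_trivial:
  assumes "comm_group G" "trivial_group G"
  shows "abelian_rank G = 0"
proof -
  interpret comm_group G by fact
  have c: "carrier G = {\<one>\<^bsub>G\<^esub>}" using assms(2) by (simp add: trivial_group_def)
  have "card B = 0" if "independent_set G B" for B
  proof (rule ccontr)
    assume "card B \<noteq> 0"
    then have "B \<noteq> {}" by auto
    have sub: "B \<subseteq> {\<one>\<^bsub>G\<^esub>}" using that c by (simp add: independent_set_def)
    with \<open>B \<noteq> {}\<close> have B: "B = {\<one>\<^bsub>G\<^esub>}" by blast
    have "finprod G (\<lambda>b. b [^]\<^bsub>G\<^esub> (1::int)) B \<in> carrier G"
      by (rule finprod_closed) (auto simp: B)
    then have "finprod G (\<lambda>b. b [^]\<^bsub>G\<^esub> (1::int)) B = \<one>\<^bsub>G\<^esub>" using c by simp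
    moreover have "\<forall>cc :: _ \<Rightarrow> int. finprod G (\<lambda>b. b [^]\<^bsub>G\<^esub> cc b) B = \<one>\<^bsub>G\<^esub> \<longrightarrow> (\<forall>b\<in>B. cc b = 0)"
      using that by (simp add: independent_set_def)
    ultimately have "\<forall>b\<in>B. (1::int) = 0" by (elim allE[of _ "\<lambda>_. 1"]) simp
    then show False using B by simp
  qed
  moreover have "independent_set G {}" by (simp add: independent_set_def)
  ultimately have "{card B |B. independent_set G B} = {0}" by force
  then show ?thesis by (simp add: abelian_rank_def)
qed

lemma abelian_rank_infinite_cyclic:
  assumes "comm_group G" "G \<cong> integer_group"
  shows "abelian_rank G = 1"
proof -
  interpret comm_group G by fact
  have "integer_group \<cong> G" using assms(2) group.iso_sym[OF group_axioms] by blast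
  then obtain h where h: "h \<in> iso integer_group G" by (auto simp: is_iso_def)
  then have hom: "h \<in> hom integer_group G" and bij: "bij_betw h UNIV (carrier G)"
    by (auto simp: iso_def)
  interpret h: group_hom integer_group G h
    using hom by (simp add: group_hom_def group_hom_axioms_def)
  have hc: "h n \<in> carrier G" for n using h.hom_closed by simp
  have hadd: "h (m + n) = h m \<otimes>\<^bsub>G\<^esub> h n" for m n
    using h.hom_mult[of m n] by simp
  have hpow: "h m [^]\<^bsub>G\<^esub> (n::int) = h (n * m)" for m n
    using h.hom_int_pow[of m n] by simp
  have h1: "h n = \<one>\<^bsub>G\<^esub> \<longleftrightarrow> n = 0" for n
    using h.hom_one bij by (metis bij_betw_def injD one_integer_group)
  have "card B \<le> 1" if B: "independent_set G B" for B
  proof (rule ccontr)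
    assume "\<not> card B \<le> 1"
    then have "card B \<ge> 2" by simp
    then obtain b1 b2 where b: "b1 \<in> B" "b2 \<in> B" "b1 \<noteq> b2"
      by (metis card_le_Suc0_iff_eq B independent_set_def One_nat_def \<open>\<not> card B \<le> 1\<close>)
    have fin: "finite B" and sub: "B \<subseteq> carrier G" using B by (auto simp: independent_set_def)
    obtain m1 m2 where m: "b1 = h m1" "b2 = h m2"
      using b sub bij by (metis bij_betw_imp_surj_on imageE subsetD)
    \<comment> \<open>The relation m2 * m1 - m1 * m2 = 0 between the images of m1 and m2.
      Independence makes both coefficients 0, which contradicts b1 \<noteq> b2.\<close>
    define c where "c = (\<lambda>b. if b = b1 then m2 else if b = b2 then - m1 else (0::int))"
    let ?f = "\<lambda>b. b [^]\<^bsub>G\<^esub> c b"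
    have f: "?f \<in> B \<rightarrow> carrier G" using sub by auto
    have "finprod G ?f B = finprod G ?f {b1, b2}"
      using fin b sub by (intro finprod_mono_neutral_cong_right) (auto simp: c_def)
    also have "\<dots> = ?f b1 \<otimes>\<^bsub>G\<^esub> ?f b2"
      using b sub by (subst finprod_insert) (auto simp: subsetD)
    also have "\<dots> = h (m2 * m1 + (- m1) * m2)"
      using b(3) by (simp only: hadd c_def m hpow if_True simp_thms(6) if_False refl) (auto simp: hpow)
    also have "\<dots> = \<one>\<^bsub>G\<^esub>" using h1 by simp
    finally have "\<forall>b\<in>B. c b = 0" using B by (auto simp: independent_set_def)
    then have "m2 = 0" "m1 = 0" using b by (auto simp: c_def split: if_splits)
    then show False using m b by simp
  qed
  moreover have "independent_set G {h 1}"
    using hc h1 by (auto simp: independent_set_def hpow)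
  ultimately have "Sup {card B |B. independent_set G B} = 1"
    by (intro cSup_eq_maximum) (auto intro!: exI[of _ "{h 1}"])
  then show ?thesis by (simp add: abelian_rank_def)
qed

text \<open>Space is written as complex times real so that rotations about the vertical axis are
  multiplications of the first component.\<close>

abbreviation R3_sphere :: "(complex \<times> real) set" where
  "R3_sphere \<equiv> sphere 0 1"

lemma S2_homeomorphic_R3_sphere: "S2 homeomorphic_space top_of_set R3_sphere"
proof -
  obtain f :: "(nat \<Rightarrow> real) \<Rightarrow> complex \<times> real" and g
    where "homeomorphic_maps (nsphere(3 - 1)) (top_of_set (sphere 0 1 \<inter> span (Basis :: (complex \<times> real) set))) f g"
    by (rule homeomorphic_maps_nsphere_euclidean_sphere[of "Basis :: (complex \<times> real) set" 3])
      (auto simp: independent_Basis orthogonal_Basis norm_Basis)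
  then show ?thesis by (auto simp: homeomorphic_space_def)
qed

lemma homeomorphic_R3_sphere:
  "X homeomorphic_space S2 \<Longrightarrow> X homeomorphic_space top_of_set R3_sphere"
  using S2_homeomorphic_R3_sphere homeomorphic_space_trans by blast

text \<open>Stereographic projection. It supplies the charts of the sphere, the contractibility of
  the punctured sphere, and the plane on which roots are constructed.\<close>

lemma sphere_minus_point_homeomorphic_plane:
  assumes X: "X homeomorphic_space S2" and p: "p \<in> topspace X"
  obtains \<phi> where "homeomorphic_map (subtopology X (topspace X - {p})) (euclidean :: complex topology) \<phi>"
proof -
  obtain f where f: "homeomorphic_map X (top_of_set R3_sphere) f"
    using homeomorphic_R3_sphere[OF X] by (auto simp: homeomorphic_space)
  have im: "f ` topspace X = R3_sphere" and inj: "inj_on f (topspace X)"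
    using f by (auto simp: homeomorphic_eq_everything_map)
  have fp: "f p \<in> R3_sphere" using im p by blast
  have "homeomorphic_map (subtopology X (topspace X - {p})) (subtopology (top_of_set R3_sphere) (R3_sphere - {f p})) f"
    using f im inj p by (intro homeomorphic_map_subtopologies) (auto dest: inj_onD)
  then have 1: "subtopology X (topspace X - {p}) homeomorphic_space top_of_set (R3_sphere - {f p})"
    by (metis homeomorphic_map_imp_homeomorphic_space subtopology_subtopology Int_Diff Int_absorb)
  have "(R3_sphere - {f p}) homeomorphic (UNIV :: complex set)"
    by (rule homeomorphic_punctured_sphere_affine) (use fp in \<open>auto simp: aff_dim_UNIV\<close>)
  then have "top_of_set (R3_sphere - {f p}) homeomorphic_space (euclidean :: complex topology)"
  proof -
    obtain g k where "homeomorphism (R3_sphere - {f p}) (UNIV :: complex set) g k"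
      using \<open>(R3_sphere - {f p}) homeomorphic UNIV\<close> by (auto simp: homeomorphic_def)
    moreover from this have "k y \<in> R3_sphere - {f p}" for y by (metis homeomorphism_def rangeI)
    ultimately have "homeomorphic_maps (top_of_set (R3_sphere - {f p})) (euclidean :: complex topology) g k"
      unfolding homeomorphic_maps_def homeomorphism_def
      by (auto intro!: continuous_map_into_subtopology simp del: mem_sphere_0 Diff_iff)
    then show ?thesis by (auto simp: homeomorphic_space_def)
  qed
  with 1 have "subtopology X (topspace X - {p}) homeomorphic_space (euclidean :: complex topology)"
    by (rule homeomorphic_space_trans)
  then show thesis using that by (auto simp: homeomorphic_space)
qed

lemma topspace_sphere_nonempty:
  assumes "X homeomorphic_space S2"
  shows "topspace X \<noteq> {}"
proof -
  obtain f where "homeomorphic_map X S2 f"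
    using assms by (auto simp: homeomorphic_space)
  then have "f ` topspace X = topspace S2" by (rule homeomorphic_imp_surjective_map)
  then show ?thesis using in_topspace_nsphere[of 2] by blast
qed

section \<open>Homology, orientation and surface structure of the sphere\<close>

lemma homology_sphere_2:
  assumes X: "X homeomorphic_space S2"
  shows "homology_group 0 X \<cong> integer_group" "trivial_group (homology_group 1 X)"
    "homology_group 2 X \<cong> integer_group"
proof -
  have "X homeomorphic_space top_of_set R3_sphere" by (rule homeomorphic_R3_sphere[OF X])
  moreover have "path_connected R3_sphere"
    by (rule path_connected_sphere) simp
  ultimately have "path_connected_space X"
    using homeomorphic_path_connected_space path_connectedin_euclidean path_connectedin_def by blast
  moreover have "topspace X \<noteq> {}"
    by (rule topspace_sphere_nonempty[OF X])
  ultimately show "homology_group 0 X \<cong> integer_group"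
    by (rule isomorphic_integer_zeroth_homology_group)
  have r: "reduced_homology_group p X \<cong> reduced_homology_group p S2" for p
    using X homeomorphic_space_imp_isomorphic_reduced_homology_groups by blast
  show "trivial_group (homology_group 1 X)"
    using r[of 1] reduced_homology_group_nsphere(2)[of 1 2]
    by (simp add: isomorphic_group_triviality un_reduced_homology_group)
  show "homology_group 2 X \<cong> integer_group"
    using r[of 2] reduced_homology_group_nsphere(1)[of 2]
    by (auto simp: un_reduced_homology_group intro: iso_trans)
qed

lemma euler_char_sphere:
  assumes "X homeomorphic_space S2"
  shows "euler_char X = 2"
proof -
  note h = homology_sphere_2[OF assms]
  have "abelian_rank (homology_group 0 X) = 1" "abelian_rank (homology_group 2 X) = 1"
    by (rule abelian_rank_infinite_cyclic[OF abelian_homology_group h(1)],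
        rule abelian_rank_infinite_cyclic[OF abelian_homology_group h(3)])
  moreover have "abelian_rank (homology_group 1 X) = 0"
    by (rule abelian_rank_trivial[OF abelian_homology_group h(2)])
  moreover have "{..2::nat} = {0, 1, 2}" by auto
  ultimately show ?thesis by (simp add: euler_char_def)
qed

text \<open>One global class serves: let \<open>m\<close> generate the second homology. The
  punctured sphere is contractible, so its first homology vanishes, and by exactness the second
  homology of the sphere maps onto each local group; the image of \<open>m\<close> therefore
  generates. The whole space is then a coherent neighbourhood of every point.\<close>

lemma orientable_sphere:
  assumes X: "X homeomorphic_space S2"
  shows "orientable X"
proof -
  let ?H = "homology_group 2 X"
  have "cyclic_group ?H"
    using homology_sphere_2(3)[OF X] isomorphic_group_cyclicity[of ?H integer_group] by simp
  then obtain m where m: "m \<in> carrier ?H" "carrier ?H = range (\<lambda>n::int. m [^]\<^bsub>?H\<^esub> n)"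
    using group.cyclic_group[of ?H] by auto
  define F where "F x = hom_induced 2 X {} X (topspace X - {x}) id" for x
  have gen: "generate (relative_homology_group 2 X (topspace X - {x})) {F x m} =
      carrier (relative_homology_group 2 X (topspace X - {x}))"
    and Fm: "F x m \<in> carrier (relative_homology_group 2 X (topspace X - {x}))"
    if x: "x \<in> topspace X" for x
  proof -
    let ?S = "topspace X - {x}" let ?R = "relative_homology_group 2 X ?S"
    obtain \<phi> where "homeomorphic_map (subtopology X ?S) (euclidean :: complex topology) \<phi>"
      using sphere_minus_point_homeomorphic_plane[OF X x] .
    then have "subtopology X ?S homeomorphic_space (euclidean :: complex topology)"
      by (rule homeomorphic_map_imp_homeomorphic_space)
    moreover have "contractible_space (euclidean :: complex topology)"
      by (metis contractible_UNIV contractible_space_top_of_set subtopology_UNIV)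
    ultimately have "contractible_space (subtopology X ?S)"
      using homeomorphic_space_contractibility by blast
    then have "trivial_group (reduced_homology_group 1 (subtopology X ?S))"
      by (rule trivial_reduced_homology_group_contractible_space)
    then have triv: "trivial_group (homology_group 1 (subtopology X ?S))"
      by (simp add: un_reduced_homology_group)
    have hom: "F x \<in> hom ?H ?R" unfolding F_def by (rule hom_induced_hom)
    interpret F: group_hom ?H ?R "F x"
      using hom by (simp add: group_hom_def group_hom_axioms_def)
    have "hom_boundary 2 X ?S c = \<one>\<^bsub>homology_group 1 (subtopology X ?S)\<^esub>" if "c \<in> carrier ?R" for c
      using hom_boundary_hom[of 2 X ?S] triv that by (auto simp: trivial_group_def hom_def Pi_iff)
    moreover have "F x ` carrier ?H = kernel ?R (homology_group 1 (subtopology X ?S)) (hom_boundary 2 X ?S)"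
      using homology_exactness_axiom_1[of 2 X ?S] by (simp add: F_def)
    ultimately have epi: "F x ` carrier ?H = carrier ?R"
      by (auto simp: kernel_def)
    show "F x m \<in> carrier ?R" using m by simp
    have "carrier ?R = range (\<lambda>n::int. F x m [^]\<^bsub>?R\<^esub> n)"
      unfolding epi[symmetric] m(2) image_image using F.hom_int_pow[OF m(1)] by simp
    moreover have "generate ?R {F x m} = range (\<lambda>n::int. F x m [^]\<^bsub>?R\<^esub> n)"
      using F.H.generate_pow[of "F x m"] m(1) by auto
    ultimately show "generate ?R {F x m} = carrier ?R" by simp
  qed
  show ?thesis
    unfolding orientable_def
  proof (intro exI[of _ "\<lambda>x. F x m"] conjI ballI)
    fix x assume x: "x \<in> topspace X"
    show "\<exists>U. openin X U \<and> x \<in> U \<and>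
        (\<exists>n\<in>carrier (relative_homology_group 2 X (topspace X - U)).
           \<forall>y\<in>U. hom_induced 2 X (topspace X - U) X (topspace X - {y}) id n = F y m)"
      by (rule exI[of _ "topspace X"]) (use x m(1) in \<open>auto simp: F_def intro!: bexI[of _ m]\<close>)
  qed (use gen Fm in auto)
qed

lemma chart_sphere_minus_point:
  assumes X: "X homeomorphic_space S2" and p: "p \<in> topspace X"
    and \<phi>: "homeomorphic_map (subtopology X (topspace X - {p})) (euclidean :: complex topology) \<phi>"
  shows "chart X (topspace X - {p}) \<phi>"
proof -
  have "Hausdorff_space X"
    using homeomorphic_Hausdorff_space[OF homeomorphic_R3_sphere[OF X]]
    by (simp add: Hausdorff_space_subtopology)
  then have "closedin X {p}" using p by (simp add: closedin_Hausdorff_sing_eq)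
  then have o: "openin X (topspace X - {p})" by auto
  have "\<phi> ` (topspace X - {p}) = UNIV"
    using homeomorphic_imp_surjective_map[OF \<phi>] by (auto simp: Int_absorb1)
  then show ?thesis using o \<phi> by (simp add: chart_def)
qed

lemma topspace_sphere_infinite:
  assumes X: "X homeomorphic_space S2"
  shows "infinite (topspace X)"
proof
  assume fin: "finite (topspace X)"
  obtain p where p: "p \<in> topspace X" using topspace_sphere_nonempty[OF X] by blast
  obtain \<phi> where \<phi>: "homeomorphic_map (subtopology X (topspace X - {p})) (euclidean :: complex topology) \<phi>"
    using sphere_minus_point_homeomorphic_plane[OF X p] .
  have "\<phi> ` (topspace X - {p}) = UNIV"
    using homeomorphic_imp_surjective_map[OF \<phi>] by (auto simp: Int_absorb1)
  moreover have "finite (\<phi> ` (topspace X - {p}))" using fin by blast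
  ultimately show False using infinite_UNIV_char_0[where 'a = complex] by simp
qed

lemma
  assumes X: "X homeomorphic_space S2"
  shows sphere_compact: "compact_space X" and sphere_Hausdorff: "Hausdorff_space X"
    and sphere_connected: "connected_space X" and closed_surface_sphere: "closed_surface X"
proof -
  note h = homeomorphic_R3_sphere[OF X]
  show c: "compact_space X"
    using homeomorphic_compact_space[OF h] compact_space_subtopology[of euclidean R3_sphere] by simp
  show H: "Hausdorff_space X"
    using homeomorphic_Hausdorff_space[OF h] by (simp add: Hausdorff_space_subtopology)
  have "connected R3_sphere" by (rule connected_sphere) simp
  then show co: "connected_space X"
    using homeomorphic_connected_space[OF h] connectedin_iff_connected[of R3_sphere]
    unfolding connectedin_def by simp
  have "second_countable (euclidean :: (complex \<times> real) topology)"
  proof (rule univ_second_countable[where 'a = "complex \<times> real"])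
    fix B :: "(complex \<times> real) set set"
    assume B: "countable B" "\<And>C. C \<in> B \<Longrightarrow> open C" "\<And>S. open S \<Longrightarrow> \<exists>U. U \<subseteq> B \<and> S = \<Union>U"
    have "\<exists>V\<in>B. x \<in> V \<and> V \<subseteq> S" if S: "open S" "x \<in> S" for S x
    proof -
      obtain U where "U \<subseteq> B" "S = \<Union>U" using B(3)[OF S(1)] by blast
      then show ?thesis using S(2) by blast
    qed
    then show ?thesis using B(1,2) unfolding second_countable_def by (auto simp del: open_openin simp flip: open_openin)
  qed
  then have sc: "second_countable X"
    using homeomorphic_space_second_countability[OF h] second_countable_subtopology by blast
  have ch: "\<exists>U \<phi>. chart X U \<phi> \<and> x \<in> U" if x: "x \<in> topspace X" for x
  proof -
    have "infinite (topspace X - {x})" using topspace_sphere_infinite[OF X] by simp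
    then have "topspace X - {x} \<noteq> {}" by (metis finite.emptyI)
    then obtain p where p: "p \<in> topspace X" "p \<noteq> x" by blast
    obtain \<phi> where "homeomorphic_map (subtopology X (topspace X - {p})) (euclidean :: complex topology) \<phi>"
      using sphere_minus_point_homeomorphic_plane[OF X p(1)] .
    then have "chart X (topspace X - {p}) \<phi>" by (rule chart_sphere_minus_point[OF X p(1)])
    moreover have "x \<in> topspace X - {p}" using x p by simp
    ultimately show ?thesis by blast
  qed
  have "topspace X \<noteq> {}" using topspace_sphere_infinite[OF X] by auto
  with c H co sc ch orientable_sphere[OF X] show "closed_surface X"
    by (simp add: closed_surface_def)
qed


section \<open>Charts and local powers\<close>

lemma chart_open: "chart X U \<phi> \<Longrightarrow> openin X U"
  by (simp add: chart_def)

lemma chart_subset: "chart X U \<phi> \<Longrightarrow> U \<subseteq> topspace X"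
  by (auto dest: chart_open openin_subset)

lemma chart_topspace: "chart X U \<phi> \<Longrightarrow> topspace (subtopology X U) = U"
  using chart_subset by (auto simp: Int_absorb1)

lemma chart_inj: "chart X U \<phi> \<Longrightarrow> inj_on \<phi> U"
  using chart_topspace by (metis chart_def homeomorphic_imp_injective_map)

lemma chart_continuous: "chart X U \<phi> \<Longrightarrow> continuous_map (subtopology X U) euclidean \<phi>"
  by (meson chart_def continuous_map_into_fulltopology homeomorphic_imp_continuous_map)

lemma chart_open_preimage:
  assumes "chart X U \<phi>" "open S"
  shows "openin X {x \<in> U. \<phi> x \<in> S}"
proof -
  have "openin (subtopology X U) {x \<in> topspace (subtopology X U). \<phi> x \<in> S}"
    by (rule openin_continuous_map_preimage[OF chart_continuous[OF assms(1)]]) (use assms(2) in simp)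
  then show ?thesis
    unfolding chart_topspace[OF assms(1)] using chart_open[OF assms(1)] by (simp add: openin_open_subtopology)
qed

lemma chart_open_image:
  assumes "chart X U \<phi>" "openin X W" "W \<subseteq> U"
  shows "open (\<phi> ` W)"
proof -
  have "open_map (subtopology X U) (top_of_set (\<phi> ` U)) \<phi>"
    using assms(1) by (simp add: chart_def homeomorphic_imp_open_map)
  moreover have "openin (subtopology X U) W"
    using assms by (simp add: openin_open_subtopology chart_open)
  ultimately have "openin (top_of_set (\<phi> ` U)) (\<phi> ` W)" by (simp add: open_map_def)
  moreover have "open (\<phi> ` U)" using assms(1) by (simp add: chart_def)
  ultimately show ?thesis using openin_open_trans by blast
qed

lemma chartI:
  assumes "openin X U" "inj_on \<phi> U" "continuous_map (subtopology X U) euclidean \<phi>"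
    and "\<And>W. openin X W \<Longrightarrow> W \<subseteq> U \<Longrightarrow> open (\<phi> ` W)"
  shows "chart X U \<phi>"
proof -
  have U: "topspace (subtopology X U) = U" using openin_subset[OF assms(1)] by auto
  have o: "open (\<phi> ` U)" using assms by auto
  have "open_map (subtopology X U) (top_of_set (\<phi> ` U)) \<phi>"
    unfolding open_map_def using assms(1,4) o by (auto simp: openin_open_subtopology openin_open_eq image_mono)
  moreover have "continuous_map (subtopology X U) (top_of_set (\<phi> ` U)) \<phi>"
    using assms(3) U by (auto intro!: continuous_map_into_subtopology)
  ultimately have "homeomorphic_map (subtopology X U) (top_of_set (\<phi> ` U)) \<phi>"
    using assms(2) U by (auto simp: homeomorphic_eq_everything_map intro: bijective_open_imp_closed_map)
  then show ?thesis using assms(1) o by (simp add: chart_def)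
qed

lemma chart_restrict:
  assumes "chart X U \<phi>" "openin X W" "W \<subseteq> U"
  shows "chart X W \<phi>"
proof (rule chartI)
  show "inj_on \<phi> W" using chart_inj[OF assms(1)] assms(3) by (rule inj_on_subset)
  show "continuous_map (subtopology X W) euclidean \<phi>"
    using continuous_map_from_subtopology_mono[OF chart_continuous[OF assms(1)] assms(3)] .
  show "open (\<phi> ` W')" if "openin X W'" "W' \<subseteq> W" for W'
    using chart_open_image[OF assms(1)] that assms(3) by blast
qed (fact assms)

text \<open>Invariance of domain makes \<open>h\<close> open, so continuity and injectivity suffice
  for a change of coordinate.\<close>

lemma chart_compose:
  assumes c: "chart X U \<phi>" and h: "continuous_on (\<phi> ` U) h" "inj_on h (\<phi> ` U)"
  shows "chart X U (\<lambda>x. h (\<phi> x))"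
proof (rule chartI)
  show "openin X U" by (rule chart_open[OF c])
  show "inj_on (\<lambda>x. h (\<phi> x)) U"
    using comp_inj_on[OF chart_inj[OF c] h(2)] by (simp add: o_def)
  show "continuous_map (subtopology X U) euclidean (\<lambda>x. h (\<phi> x))"
  proof -
    have "continuous_map (subtopology X U) (top_of_set (\<phi> ` U)) \<phi>"
      using chart_continuous[OF c] chart_topspace[OF c] by (auto intro!: continuous_map_into_subtopology)
    moreover have "continuous_map (top_of_set (\<phi> ` U)) euclidean h" using h(1) by simp
    ultimately show ?thesis by (metis (no_types, lifting) continuous_map_compose continuous_map_eq o_def)
  qed
  show "open ((\<lambda>x. h (\<phi> x)) ` W)" if W: "openin X W" "W \<subseteq> U" for W
  proof -
    have "open (\<phi> ` W)" by (rule chart_open_image[OF c W])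
    moreover have "continuous_on (\<phi> ` W) h" "inj_on h (\<phi> ` W)"
      using h W(2) by (meson continuous_on_subset image_mono inj_on_subset)+
    ultimately have "open (h ` \<phi> ` W)" using invariance_of_domain by blast
    then show ?thesis by (simp add: image_image)
  qed
qed

text \<open>Nonzero points with equal k-th powers differ by a root of unity as factor, and the
  finitely many roots other than 1 keep a distance from 1.\<close>

lemma power_locally_injective:
  fixes u :: complex
  assumes "u \<noteq> 0" "k \<ge> 1"
  obtains e where "e > 0" "inj_on (\<lambda>z. z ^ k) (ball u e)" "0 \<notin> ball u e"
proof -
  have "finite {z::complex. z ^ k = 1}" using assms(2) by (intro finite_nth_roots) auto
  then obtain d where d: "d > 0" "\<forall>z\<in>{z::complex. z ^ k = 1}. z \<noteq> 1 \<longrightarrow> d \<le> dist 1 z"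
    using finite_set_avoid[of "{z::complex. z ^ k = 1}" 1] by auto
  \<comment> \<open>The factor 1/2 keeps |z| > |u|/2 on the ball; the factor d/4 bounds its diameter
    by d * |u|/2, which is less than d * |z|.\<close>
  define e where "e = norm u * min (1/2) (d/4)"
  have "e > 0" using assms d by (simp add: e_def)
  have e1: "e \<le> norm u * (1 / 2)" unfolding e_def by (intro mult_left_mono) auto
  have e2: "e \<le> norm u * (d / 4)" unfolding e_def by (intro mult_left_mono) auto
  have "inj_on (\<lambda>z. z ^ k) (ball u e)"
  proof (rule inj_onI)
    fix z w assume z: "z \<in> ball u e" and w: "w \<in> ball u e" and eq: "z ^ k = w ^ k"
    have "norm u - norm z < e" using z norm_triangle_ineq2[of u z] by (simp add: dist_norm)
    then have nz: "norm z > norm u / 2" using e1 by simp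
    then have "z \<noteq> 0" by auto
    then have "(w / z) ^ k = 1" using eq by (metis power_divide divide_self power_not_zero)
    show "z = w"
    proof (rule ccontr)
      assume "z \<noteq> w"
      then have "d \<le> dist 1 (w / z)" using d(2) \<open>(w / z) ^ k = 1\<close> \<open>z \<noteq> 0\<close> by auto
      also have "\<dots> = norm (z - w) / norm z"
        using \<open>z \<noteq> 0\<close> by (simp add: dist_norm field_simps flip: norm_divide)
      finally have "d * norm z \<le> norm (z - w)" using nz \<open>z \<noteq> 0\<close> by (simp add: field_simps)
      moreover have "norm (z - w) < 2 * e"
        using z w dist_triangle2[of z w u] by (simp add: dist_norm norm_minus_commute)
      moreover have "d * norm z > d * (norm u / 2)" using d nz by simp
      ultimately show False using e2 by (simp add: field_simps)
    qed
  qed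
  moreover have "0 \<notin> ball u e" using e1 \<open>e > 0\<close> by (auto simp: dist_norm)
  ultimately show thesis using that \<open>e > 0\<close> by blast
qed

text \<open>The exponent in topological terms: in the charts, the preimages of a nearby value are
  its k-th roots, and they collapse to one point at the centre.\<close>

lemma locally_power_neighbourhood:
  assumes lp: "locally_power X Y f x k" and W: "openin X W" "x \<in> W"
  obtains W' V where "openin X W'" "x \<in> W'" "W' \<subseteq> W" "openin Y V" "f x \<in> V"
    "{x' \<in> W'. f x' = f x} = {x}"
    "\<And>y. y \<in> V \<Longrightarrow> y \<noteq> f x \<Longrightarrow> finite {x' \<in> W'. f x' = y} \<and> card {x' \<in> W'. f x' = y} = k"
proof -
  obtain U \<phi> V \<psi> where k: "k \<ge> 1" and \<phi>: "chart X U \<phi>" "x \<in> U" "\<phi> x = 0"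
    and \<psi>: "chart Y V \<psi>" "f x \<in> V" "\<psi> (f x) = 0"
    and f: "f ` U \<subseteq> V" "\<And>z. z \<in> U \<Longrightarrow> \<psi> (f z) = \<phi> z ^ k"
    using lp by (auto simp: locally_power_def)
  have "open (\<phi> ` (U \<inter> W))"
    using \<phi> W by (intro chart_open_image[OF \<phi>(1)]) (auto simp: chart_open)
  moreover have "0 \<in> \<phi> ` (U \<inter> W)" using \<phi> W by (metis IntI image_eqI)
  ultimately obtain r where r: "r > 0" "ball 0 r \<subseteq> \<phi> ` (U \<inter> W)"
    by (meson openE)
  \<comment> \<open>The radii r and r ^ k match, so that every k-th root of a value in
    \<open>V'\<close> is the coordinate of a point of \<open>W'\<close>.\<close>
  define W' where "W' = {z \<in> U. \<phi> z \<in> ball 0 r}"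
  define V' where "V' = {y \<in> V. \<psi> y \<in> ball 0 (r ^ k)}"
  have inj: "inj_on \<phi> U" "inj_on \<psi> V" using \<phi> \<psi> chart_inj by auto
  have W'W: "W' \<subseteq> W"
  proof
    fix z assume "z \<in> W'"
    then have "z \<in> U" "\<phi> z \<in> \<phi> ` (U \<inter> W)" using r by (auto simp: W'_def)
    then show "z \<in> W" using inj(1) by (auto dest: inj_onD)
  qed
  have bij: "bij_betw \<phi> {z \<in> W'. f z = y} {u. u ^ k = \<psi> y}" if y: "y \<in> V'" for y
  proof (rule bij_betw_imageI)
    show "inj_on \<phi> {z \<in> W'. f z = y}" using inj(1) by (rule inj_on_subset) (auto simp: W'_def)
    show "\<phi> ` {z \<in> W'. f z = y} = {u. u ^ k = \<psi> y}"
    proof (intro equalityI subsetI)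
      fix u assume "u \<in> {u. u ^ k = \<psi> y}"
      then have u: "u ^ k = \<psi> y" by simp
      then have "norm u ^ k < r ^ k" using y by (simp add: V'_def flip: norm_power)
      then have nu: "norm u < r" using r(1) by (meson less_imp_le power_less_imp_less_base)
      then obtain z where z: "z \<in> U" "\<phi> z = u" using r by force
      then have "\<psi> (f z) = \<psi> y" using f u by simp
      moreover have "f z \<in> V" "y \<in> V" using f z y by (auto simp: V'_def)
      ultimately have "f z = y" using inj(2) by (auto dest: inj_onD)
      then show "u \<in> \<phi> ` {z \<in> W'. f z = y}" using z nu by (auto simp: W'_def)
    qed (use f in \<open>auto simp: W'_def\<close>)
  qed
  show thesis
  proof (rule that[of W' V'])
    show "openin X W'" unfolding W'_def by (rule chart_open_preimage[OF \<phi>(1)]) simp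
    show "openin Y V'" unfolding V'_def by (rule chart_open_preimage[OF \<psi>(1)]) simp
    show "x \<in> W'" "f x \<in> V'" using \<phi> \<psi> r by (auto simp: W'_def V'_def)
    have "\<phi> ` {z \<in> W'. f z = f x} = {u. u ^ k = 0}"
      using bij[OF \<open>f x \<in> V'\<close>] \<psi>(3) by (simp add: bij_betw_def)
    then have z0: "\<phi> z = 0" if "z \<in> W'" "f z = f x" for z using that by auto
    have "z = x" if "z \<in> W'" "f z = f x" for z
      using inj_on_eq_iff[OF inj(1), of z x] z0[OF that] \<phi>(2,3) that(1) by (simp add: W'_def)
    then show "{z \<in> W'. f z = f x} = {x}" using \<open>x \<in> W'\<close> by auto
    show "finite {z \<in> W'. f z = y} \<and> card {z \<in> W'. f z = y} = k" if "y \<in> V'" "y \<noteq> f x" for y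
    proof -
      have "\<psi> y \<noteq> 0"
        using inj_on_eq_iff[OF inj(2), of y "f x"] that \<psi>(2,3) by (simp add: V'_def)
      then have "finite {u. u ^ k = \<psi> y}" "card {u. u ^ k = \<psi> y} = k"
        using k by (auto intro: finite_nth_roots card_nth_roots)
      then show ?thesis using bij[OF that(1)] bij_betw_finite bij_betw_same_card by metis
    qed
  qed (fact W'W)
qed

lemma locally_power_not_isolated:
  assumes lp: "locally_power X Y f x k" and V: "openin Y V" "f x \<in> V"
  obtains y where "y \<in> V" "y \<noteq> f x"
proof -
  obtain V' \<psi> where \<psi>: "chart Y V' \<psi>" "f x \<in> V'" "\<psi> (f x) = 0"
    using lp by (auto simp: locally_power_def)
  have "open (\<psi> ` (V' \<inter> V))"
    using \<psi> V by (intro chart_open_image[OF \<psi>(1)]) (auto simp: chart_open)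
  moreover have "0 \<in> \<psi> ` (V' \<inter> V)" using \<psi> V by (metis IntI image_eqI)
  ultimately have "\<not> \<psi> ` (V' \<inter> V) \<subseteq> {0}"
    by (metis not_open_singleton subset_singletonD empty_iff)
  then show thesis using that \<psi>(3) by blast
qed

text \<open>A nearby value has \<open>k\<close> preimages in one neighbourhood and \<open>l\<close>
  in a smaller one, so l \<le> k; then the roles are exchanged. Hence the definite description in
  \<open>local_degree\<close> is meaningful.\<close>

lemma locally_power_unique:
  assumes k: "locally_power X Y f x k" and l: "locally_power X Y f x l" and x: "x \<in> topspace X"
  shows "k = l"
proof -
  have le: "k \<ge> l" if k: "locally_power X Y f x k" and l: "locally_power X Y f x l" for k l
  proof -
    obtain W1 V1 where 1: "openin X W1" "x \<in> W1" "openin Y V1" "f x \<in> V1"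
      "\<And>y. y \<in> V1 \<Longrightarrow> y \<noteq> f x \<Longrightarrow> finite {x' \<in> W1. f x' = y} \<and> card {x' \<in> W1. f x' = y} = k"
      by (rule locally_power_neighbourhood[OF k openin_topspace x]) (rule that)
    obtain W2 V2 where 2: "W2 \<subseteq> W1" "openin Y V2" "f x \<in> V2"
      "\<And>y. y \<in> V2 \<Longrightarrow> y \<noteq> f x \<Longrightarrow> finite {x' \<in> W2. f x' = y} \<and> card {x' \<in> W2. f x' = y} = l"
      by (rule locally_power_neighbourhood[OF l 1(1,2)]) (rule that)
    obtain y where y: "y \<in> V1 \<inter> V2" "y \<noteq> f x"
      using locally_power_not_isolated[OF k, of "V1 \<inter> V2"] 1 2 by auto
    then have "card {x' \<in> W2. f x' = y} \<le> card {x' \<in> W1. f x' = y}"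
      using 1 2 by (intro card_mono) auto
    then show ?thesis using 1 2 y by auto
  qed
  show ?thesis using le[OF k l] le[OF l k] by simp
qed

lemma local_degree_eqI:
  "locally_power X Y f x k \<Longrightarrow> x \<in> topspace X \<Longrightarrow> local_degree X Y f x = k"
  unfolding local_degree_def using locally_power_unique by (metis the_equality)

text \<open>Away from the centre the k-th power is locally injective, so the power minus its value
  at the point is itself a coordinate, and in it \<open>f\<close> has exponent 1.\<close>

lemma locally_power_punctured:
  assumes lp: "locally_power X Y f x k"
  obtains U where "openin X U" "x \<in> U" "\<And>x'. x' \<in> U \<Longrightarrow> x' \<noteq> x \<Longrightarrow> locally_power X Y f x' 1"
proof -
  obtain U \<phi> V \<psi> where k: "k \<ge> 1" and \<phi>: "chart X U \<phi>" "x \<in> U" "\<phi> x = 0"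
    and \<psi>: "chart Y V \<psi>" "f x \<in> V" "\<psi> (f x) = 0"
    and f: "f ` U \<subseteq> V" "\<And>z. z \<in> U \<Longrightarrow> \<psi> (f z) = \<phi> z ^ k"
    using lp by (auto simp: locally_power_def)
  show thesis
  proof (rule that[of U])
    fix x' assume x': "x' \<in> U" "x' \<noteq> x"
    define u where "u = \<phi> x'"
    have "u \<noteq> 0"
      using inj_on_eq_iff[OF chart_inj[OF \<phi>(1)] x'(1) \<phi>(2)] x'(2) \<phi>(3) by (simp add: u_def)
    then obtain e where e: "e > 0" "inj_on (\<lambda>z. z ^ k) (ball u e)"
      using power_locally_injective k by metis
    define U' where "U' = {z \<in> U. \<phi> z \<in> ball u e}"
    have "openin X U'" unfolding U'_def by (rule chart_open_preimage[OF \<phi>(1)]) simp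
    then have c: "chart X U' \<phi>" by (rule chart_restrict[OF \<phi>(1)]) (auto simp: U'_def)
    have "chart X U' (\<lambda>z. \<phi> z ^ k - u ^ k)"
    proof (rule chart_compose[OF c, where h = "\<lambda>z. z ^ k - u ^ k"])
      have sub: "\<phi> ` U' \<subseteq> ball u e" by (auto simp: U'_def)
      show "inj_on (\<lambda>z. z ^ k - u ^ k) (\<phi> ` U')"
        using inj_on_subset[OF e(2) sub] by (auto simp: inj_on_def)
    qed (intro continuous_intros)
    moreover have "chart Y V (\<lambda>y. \<psi> y - u ^ k)"
      by (rule chart_compose[OF \<psi>(1)]) (auto intro!: continuous_intros simp: inj_on_def)
    moreover have "x' \<in> U'" using x' e by (simp add: U'_def u_def)
    moreover have "f ` U' \<subseteq> V" "f x' \<in> V" using f x' by (auto simp: U'_def)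
    ultimately show "locally_power X Y f x' 1"
      unfolding locally_power_def using f x'
      by (intro conjI exI[of _ U'] exI[of _ V] exI[of _ "\<lambda>z. \<phi> z ^ k - u ^ k"] exI[of _ "\<lambda>y. \<psi> y - u ^ k"])
        (auto simp: U'_def u_def)
  qed (use \<phi> in \<open>auto simp: chart_open\<close>)
qed

section \<open>Conservation of fibre weights\<close>

definition multiplicity_at :: "'a topology \<Rightarrow> 'b topology \<Rightarrow> ('a \<Rightarrow> 'b) \<Rightarrow> ('a \<Rightarrow> nat) \<Rightarrow> 'a \<Rightarrow> bool" where
  "multiplicity_at X Y f m x \<longleftrightarrow> (\<forall>W. openin X W \<and> x \<in> W \<longrightarrow>
     (\<exists>W' V. openin X W' \<and> x \<in> W' \<and> W' \<subseteq> W \<and> openin Y V \<and> f x \<in> V \<and>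
        (\<forall>y\<in>V. finite {x' \<in> W'. f x' = y} \<and> (\<Sum>x'\<in>{x' \<in> W'. f x' = y}. m x') = m x)))"

lemma multiplicity_atD:
  assumes "multiplicity_at X Y f m x" "openin X W" "x \<in> W"
  shows "\<exists>W' V. openin X W' \<and> x \<in> W' \<and> W' \<subseteq> W \<and> openin Y V \<and> f x \<in> V \<and>
        (\<forall>y\<in>V. finite {x' \<in> W'. f x' = y} \<and> (\<Sum>x'\<in>{x' \<in> W'. f x' = y}. m x') = m x)"
  using assms unfolding multiplicity_at_def by blast

text \<open>Over a value near f x, but different from it, lie \<open>k\<close> points close to
  \<open>x\<close>, and each has local degree 1 by \<open>locally_power_punctured\<close>; they add
  up to the degree \<open>k\<close> at \<open>x\<close>.\<close>

lemma multiplicity_at_local_degree: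
  assumes lp: "locally_power X Y f x k" and x: "x \<in> topspace X"
  shows "multiplicity_at X Y f (local_degree X Y f) x"
  unfolding multiplicity_at_def
proof (intro allI impI)
  fix W assume W: "openin X W \<and> x \<in> W"
  obtain U where U: "openin X U" "x \<in> U" "\<And>x'. x' \<in> U \<Longrightarrow> x' \<noteq> x \<Longrightarrow> locally_power X Y f x' 1"
    using locally_power_punctured[OF lp] by blast
  obtain W' V where 1: "openin X W'" "x \<in> W'" "W' \<subseteq> W \<inter> U" "openin Y V" "f x \<in> V"
    "{x' \<in> W'. f x' = f x} = {x}"
    "\<And>y. y \<in> V \<Longrightarrow> y \<noteq> f x \<Longrightarrow> finite {x' \<in> W'. f x' = y} \<and> card {x' \<in> W'. f x' = y} = k"
  proof (rule locally_power_neighbourhood[OF lp, of "W \<inter> U"])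
    show "openin X (W \<inter> U)" "x \<in> W \<inter> U" using W U by auto
  qed (rule that)
  have "finite {x' \<in> W'. f x' = y} \<and> (\<Sum>x'\<in>{x' \<in> W'. f x' = y}. local_degree X Y f x') = local_degree X Y f x"
    if y: "y \<in> V" for y
  proof (cases "y = f x")
    case False
    have "local_degree X Y f x' = 1" if "x' \<in> {x' \<in> W'. f x' = y}" for x'
    proof -
      have "x' \<in> U" "x' \<noteq> x" using that False 1(3) by auto
      then show ?thesis using U(3) openin_subset[OF U(1)] by (intro local_degree_eqI) auto
    qed
    then show ?thesis using 1(7)[OF y False] local_degree_eqI[OF lp x] by simp
  qed (simp add: 1(6))
  then show "\<exists>W' V. openin X W' \<and> x \<in> W' \<and> W' \<subseteq> W \<and> openin Y V \<and> f x \<in> V \<and>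
        (\<forall>y\<in>V. finite {x' \<in> W'. f x' = y} \<and>
           (\<Sum>x'\<in>{x' \<in> W'. f x' = y}. local_degree X Y f x') = local_degree X Y f x)"
    using 1 by (intro exI[of _ W'] exI[of _ V]) auto
qed

lemma Hausdorff_finite_disjoint_neighbourhoods:
  assumes H: "Hausdorff_space X" and F: "finite F" "F \<subseteq> topspace X"
  obtains D where "\<And>x. x \<in> F \<Longrightarrow> openin X (D x) \<and> x \<in> D x"
    "\<And>x y. x \<in> F \<Longrightarrow> y \<in> F \<Longrightarrow> x \<noteq> y \<Longrightarrow> D x \<inter> D y = {}"
proof -
  have "\<forall>x\<in>F. \<forall>y\<in>F. x \<noteq> y \<longrightarrow> (\<exists>U V. openin X U \<and> openin X V \<and> x \<in> U \<and> y \<in> V \<and> disjnt U V)"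
    using H F unfolding Hausdorff_space_def by blast
  then obtain A B where AB: "\<And>x y. x \<in> F \<Longrightarrow> y \<in> F \<Longrightarrow> x \<noteq> y \<Longrightarrow>
      openin X (A x y) \<and> openin X (B x y) \<and> x \<in> A x y \<and> y \<in> B x y \<and> disjnt (A x y) (B x y)"
    by metis
  define D where "D x = topspace X \<inter> (\<Inter>y\<in>F - {x}. A x y \<inter> B y x)" for x
  show thesis
  proof (rule that[of D])
    fix x assume x: "x \<in> F"
    have "openin X (D x)"
    proof (cases "F - {x} = {}")
      case False
      have "openin X (\<Inter>y\<in>F - {x}. A x y \<inter> B y x)"
        by (rule openin_Inter) (use False F AB x in auto)
      then show ?thesis by (simp add: D_def openin_Int)
    qed (simp only: D_def, simp)
    moreover have "x \<in> D x" using x F AB by (auto simp: D_def)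
    ultimately show "openin X (D x) \<and> x \<in> D x" ..
  next
    fix x y assume xy: "x \<in> F" "y \<in> F" "x \<noteq> y"
    then have "D x \<subseteq> A x y" "D y \<subseteq> B x y" by (auto simp: D_def)
    then show "D x \<inter> D y = {}" using AB[OF xy] by (auto simp: disjnt_def)
  qed
qed

text \<open>Conservation isolates the points of a fibre, and compactness then makes it finite. As a
  proper map is closed, values near \<open>y0\<close> have no preimages away from the fibre, so the
  weights close to its points add up to the weight of the nearby fibre.\<close>

lemma fibre_weight_locally_constant:
  assumes H: "Hausdorff_space X" and p: "proper_map X Y f"
    and m: "\<And>x. x \<in> topspace X \<Longrightarrow> multiplicity_at X Y f m x \<and> m x \<ge> 1"
    and y0: "y0 \<in> topspace Y"
  shows "finite (fibre X f y0) \<and>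
    (\<exists>V. openin Y V \<and> y0 \<in> V \<and> (\<forall>y\<in>V. sum m (fibre X f y) = sum m (fibre X f y0)))"
proof -
  let ?F = "fibre X f y0"
  have comp: "compactin X ?F" using p y0 by (simp add: proper_map_def fibre_def)
  have "\<exists>W. openin X W \<and> x \<in> W \<and> W \<inter> ?F = {x}" if x: "x \<in> ?F" for x
  proof -
    have xX: "x \<in> topspace X" "f x = y0" using x by (auto simp: fibre_def)
    obtain W V where WV: "openin X W" "x \<in> W" "f x \<in> V"
      "\<forall>y\<in>V. finite {x' \<in> W. f x' = y} \<and> (\<Sum>x'\<in>{x' \<in> W. f x' = y}. m x') = m x"
      using multiplicity_atD[OF conjunct1[OF m[OF xX(1)]] openin_topspace xX(1)] by blast
    let ?S = "{x' \<in> W. f x' = y0}"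
    have S: "finite ?S" "sum m ?S = m x" "x \<in> ?S" using WV xX by auto
    \<comment> \<open>The point \<open>x\<close> alone accounts for the total m x, and any other
      point would add at least 1.\<close>
    then have "sum m (?S - {x}) = 0" by (simp add: sum.remove)
    then have m0: "\<forall>x'\<in>?S - {x}. m x' = 0" using S by simp
    have "x' = x" if "x' \<in> ?S" for x'
    proof (rule ccontr)
      assume "x' \<noteq> x"
      then have "m x' = 0" using m0 that by blast
      moreover have "m x' \<ge> 1" using m openin_subset[OF WV(1)] that by blast
      ultimately show False by simp
    qed
    then have "?S = {x}" using S(3) by blast
    moreover have "W \<inter> ?F = ?S" using openin_subset[OF WV(1)] by (auto simp: fibre_def)
    ultimately have "W \<inter> ?F = {x}" by simp
    then show ?thesis using WV by blast
  qed
  then obtain W where W: "\<And>x. x \<in> ?F \<Longrightarrow> openin X (W x) \<and> x \<in> W x \<and> W x \<inter> ?F = {x}" by metis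
  have "\<exists>G. finite G \<and> G \<subseteq> W ` ?F \<and> ?F \<subseteq> \<Union>G"
    by (rule compactinD[OF comp]) (use W in blast)+
  then obtain G where G: "finite G" "G \<subseteq> W ` ?F" "?F \<subseteq> \<Union>G" by blast
  then obtain F0 where F0: "finite F0" "F0 \<subseteq> ?F" "G = W ` F0" by (meson finite_subset_image)
  have "?F \<subseteq> F0"
  proof
    fix x assume "x \<in> ?F"
    then obtain x' where "x' \<in> F0" "x \<in> W x' \<inter> ?F" using G F0 by blast
    moreover have "W x' \<inter> ?F = {x'}" using W F0(2) \<open>x' \<in> F0\<close> by blast
    ultimately show "x \<in> F0" by auto
  qed
  then have fin: "finite ?F" using F0 finite_subset by blast
  have FX: "?F \<subseteq> topspace X" by (auto simp: fibre_def)
  obtain D where D: "\<And>x. x \<in> ?F \<Longrightarrow> openin X (D x) \<and> x \<in> D x"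
    "\<And>x y. x \<in> ?F \<Longrightarrow> y \<in> ?F \<Longrightarrow> x \<noteq> y \<Longrightarrow> D x \<inter> D y = {}"
    using Hausdorff_finite_disjoint_neighbourhoods[OF H fin FX] by metis
  define Q where "Q x W' V \<longleftrightarrow> openin X W' \<and> x \<in> W' \<and> W' \<subseteq> D x \<and> openin Y V \<and> y0 \<in> V \<and>
        (\<forall>y\<in>V. finite {x' \<in> W'. f x' = y} \<and> (\<Sum>x'\<in>{x' \<in> W'. f x' = y}. m x') = m x)" for x W' V
  have "\<exists>W' V. Q x W' V" if x: "x \<in> ?F" for x
  proof -
    have xX: "x \<in> topspace X" "f x = y0" using x by (auto simp: fibre_def)
    then show ?thesis
      using multiplicity_atD[OF conjunct1[OF m[OF xX(1)]] conjunct1[OF D(1)[OF x]] conjunct2[OF D(1)[OF x]]]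
      by (simp add: Q_def)
  qed
  then obtain W' V' where "\<And>x. x \<in> ?F \<Longrightarrow> Q x (W' x) (V' x)" by metis
  then have WV: "\<And>x. x \<in> ?F \<Longrightarrow> openin X (W' x) \<and> x \<in> W' x \<and> W' x \<subseteq> D x \<and> openin Y (V' x) \<and> y0 \<in> V' x \<and>
        (\<forall>y\<in>V' x. finite {x' \<in> W' x. f x' = y} \<and> (\<Sum>x'\<in>{x' \<in> W' x. f x' = y}. m x') = m x)"
    unfolding Q_def .
  \<comment> \<open>The closed set of values that have a preimage outside the chosen
    neighbourhoods.\<close>
  define C where "C = f ` (topspace X - (\<Union>x\<in>?F. W' x))"
  define V where "V = topspace Y \<inter> (\<Inter>x\<in>?F. V' x) - C"
  have "closedin X (topspace X - (\<Union>x\<in>?F. W' x))" using WV by (intro closedin_diff) auto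
  then have "closedin Y C" unfolding C_def using p by (auto simp: proper_map_def closed_map_def)
  moreover have "openin Y (topspace Y \<inter> (\<Inter>x\<in>?F. V' x))"
  proof (cases "?F = {}")
    case False
    then have "openin Y (\<Inter>x\<in>?F. V' x)" using fin WV by (intro openin_Inter) auto
    then show ?thesis by (simp add: openin_Int)
  qed simp
  ultimately have "openin Y V" unfolding V_def by (rule openin_diff[rotated])
  moreover have "y0 \<in> V" using y0 WV by (auto simp: V_def C_def fibre_def)
  moreover have "sum m (fibre X f y) = sum m ?F" if y: "y \<in> V" for y
  proof -
    have eq: "fibre X f y = (\<Union>x\<in>?F. {x' \<in> W' x. f x' = y})"
      using y WV openin_subset by (fastforce simp: fibre_def V_def C_def)
    have "sum m (fibre X f y) = (\<Sum>x\<in>?F. sum m {x' \<in> W' x. f x' = y})"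
      unfolding eq
    proof (rule sum.UNION_disjoint[OF fin])
      show "\<forall>x\<in>?F. finite {x' \<in> W' x. f x' = y}" using y WV by (auto simp: V_def)
      show "\<forall>i\<in>?F. \<forall>j\<in>?F. i \<noteq> j \<longrightarrow> {x' \<in> W' i. f x' = y} \<inter> {x' \<in> W' j. f x' = y} = {}"
        using D(2) WV by blast
    qed
    also have "\<dots> = sum m ?F" using y WV by (intro sum.cong) (auto simp: V_def)
    finally show ?thesis .
  qed
  ultimately show ?thesis using fin by blast
qed

lemma fibre_weight_constant:
  assumes H: "Hausdorff_space X" and p: "proper_map X Y f" and c: "connected_space Y"
    and m: "\<And>x. x \<in> topspace X \<Longrightarrow> multiplicity_at X Y f m x \<and> m x \<ge> 1"
    and y: "y \<in> topspace Y" "y' \<in> topspace Y"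
  shows "sum m (fibre X f y) = sum m (fibre X f y')"
proof (rule ccontr)
  assume ne: "sum m (fibre X f y) \<noteq> sum m (fibre X f y')"
  let ?N = "\<lambda>y. sum m (fibre X f y)"
  let ?A = "{z \<in> topspace Y. ?N z = ?N y}" and ?B = "{z \<in> topspace Y. ?N z \<noteq> ?N y}"
  have loc: "\<exists>V. openin Y V \<and> z \<in> V \<and> (\<forall>w\<in>V. ?N w = ?N z)" if "z \<in> topspace Y" for z
    using fibre_weight_locally_constant[OF H p m that] by blast
  have op: "openin Y {z \<in> topspace Y. Q (?N z)}" for Q
  proof (subst openin_subopen, intro ballI)
    fix z assume z: "z \<in> {z \<in> topspace Y. Q (?N z)}"
    then obtain V where V: "openin Y V" "z \<in> V" "\<forall>w\<in>V. ?N w = ?N z" using loc by blast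
    have "V \<subseteq> {z \<in> topspace Y. Q (?N z)}"
    proof
      fix w assume w: "w \<in> V"
      have "w \<in> topspace Y" using openin_subset[OF V(1)] w by blast
      moreover have "Q (?N w)" using V(3) w z by simp
      ultimately show "w \<in> {z \<in> topspace Y. Q (?N z)}" by simp
    qed
    with V(1,2) show "\<exists>T. openin Y T \<and> z \<in> T \<and> T \<subseteq> {z \<in> topspace Y. Q (?N z)}" by blast
  qed
  have "openin Y ?A" using op[of "\<lambda>n. n = ?N y"] .
  moreover have "openin Y ?B" using op[of "\<lambda>n. n \<noteq> ?N y"] .
  moreover have "topspace Y \<subseteq> ?A \<union> ?B" "?A \<inter> ?B = {}" "?A \<noteq> {}" "?B \<noteq> {}" using y ne by auto
  ultimately show False using c unfolding connected_space_def by blast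
qed


section \<open>Roots of functions on the plane and the sphere\<close>

text \<open>\<kappa> itself may have no root because it may wind around 0, but after the
  substitution of u ^ m its winding number is a multiple of m. On the half-plane covering the
  punctured disc: one turn changes the logarithm \<open>L\<close> by a constant \<open>D\<close> in
  2 pi i Z, m turns change it by m * D, and \<open>L\<close> divided by m changes by D, which the
  exponential does not see.\<close>

lemma punctured_disc_root:
  fixes \<kappa> :: "complex \<Rightarrow> complex"
  assumes r: "r > 0" and m: "m \<ge> 1" and s: "s ^ m \<le> r"
    and cont: "continuous_on (ball 0 r - {0}) \<kappa>" and nz: "\<And>u. u \<in> ball 0 r - {0} \<Longrightarrow> \<kappa> u \<noteq> 0"
  obtains \<rho> where "continuous_on (ball 0 s - {0}) \<rho>"
    "\<And>u. u \<in> ball 0 s - {0} \<Longrightarrow> \<rho> u ^ m = \<kappa> (u ^ m)"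
proof -
  \<comment> \<open>Under \<open>exp\<close> this half-plane is the universal cover of the punctured
    disc of radius r.\<close>
  define H where "H = {w::complex. Re w < ln r}"
  have H_exp: "exp w \<in> ball 0 r - {0}" if "w \<in> H" for w
    using that r by (simp add: H_def dist_norm) (metis exp_less_mono exp_ln)
  have convH: "convex H" unfolding H_def by (rule convex_halfspace_Re_lt)
  have "continuous_on H (\<lambda>w. \<kappa> (exp w))"
    by (rule continuous_on_compose2[OF cont]) (use H_exp in \<open>auto intro!: continuous_intros\<close>)
  moreover have "\<kappa> (exp w) \<noteq> 0" if "w \<in> H" for w using nz[OF H_exp[OF that]] .
  ultimately obtain L where L: "continuous_on H L" "\<And>w. w \<in> H \<Longrightarrow> \<kappa> (exp w) = exp (L w)"
    using continuous_logarithm_on_contractible[OF _ convex_imp_contractible[OF convH]] by metis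
  define T where "T = 2 * of_real pi * \<i>"
  have T_H: "w + of_nat j * T \<in> H" if "w \<in> H" for w j using that by (simp add: H_def T_def)
  have exp_T: "exp (w + of_nat j * T) = exp w" for w j
    using exp_integer_2pi[of "of_nat j"] by (simp add: exp_add T_def mult.assoc mult.left_commute)
  \<comment> \<open>The increment takes values in 2 pi i Z. Different values are at least 1 apart,
    so it is constant on the connected set \<open>H\<close>.\<close>
  have "(\<lambda>w. L (w + T) - L w) constant_on H"
  proof (rule continuous_discrete_range_constant)
    show "connected H" using convH by (rule convex_connected)
    show "continuous_on H (\<lambda>w. L (w + T) - L w)"
      by (intro continuous_intros L continuous_on_compose2[OF L(1)]) (use T_H[of _ 1] in auto)
    fix x assume x: "x \<in> H"
    show "\<exists>e>0. \<forall>y. y \<in> H \<and> L (y + T) - L y \<noteq> L (x + T) - L x \<longrightarrow>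
         e \<le> cmod (L (y + T) - L y - (L (x + T) - L x))"
    proof (intro exI[of _ 1] conjI allI impI)
      have e1: "\<exists>n::int. L (y + T) - L y = of_real (2 * of_int n * pi) * \<i>" if "y \<in> H" for y
      proof -
        have "exp (L (y + T)) = exp (L y)"
          using L(2)[OF that] L(2)[OF T_H[OF that, of 1]] exp_T[of y 1] by simp
        then have "exp (L (y + T) - L y) = 1" by (simp add: exp_diff)
        then show ?thesis unfolding exp_eq_1 by (auto simp: complex_eq_iff)
      qed
      fix y assume y: "y \<in> H \<and> L (y + T) - L y \<noteq> L (x + T) - L x"
      obtain a b :: int where ab: "L (y + T) - L y = of_real (2 * of_int a * pi) * \<i>"
        "L (x + T) - L x = of_real (2 * of_int b * pi) * \<i>"
        using e1 x y by meson
      then have "a \<noteq> b" using y by auto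
      then have "\<bar>real_of_int a - real_of_int b\<bar> \<ge> 1" by linarith
      then have "1 * 1 \<le> \<bar>real_of_int a - real_of_int b\<bar> * (2 * pi)"
        using pi_gt3 by (intro mult_mono) auto
      moreover have "cmod (L (y + T) - L y - (L (x + T) - L x)) = \<bar>real_of_int a - real_of_int b\<bar> * (2 * pi)"
      proof -
        have "L (y + T) - L y - (L (x + T) - L x) = of_real ((of_int a - of_int b) * (2 * pi)) * \<i>"
          unfolding ab by (simp add: algebra_simps)
        then show ?thesis by (simp only: norm_mult norm_of_real abs_mult) simp
      qed
      ultimately show "1 \<le> cmod (L (y + T) - L y - (L (x + T) - L x))" by simp
    qed simp
  qed
  then obtain D where D: "\<And>w. w \<in> H \<Longrightarrow> L (w + T) - L w = D" by (auto simp: constant_on_def)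
  have "\<exists>w. w \<in> H" by (rule exI[of _ "of_real (ln r - 1)"]) (simp add: H_def)
  then obtain w0 where "w0 \<in> H" by blast
  have "exp (L (w0 + T)) = exp (L w0)"
    using L(2)[OF \<open>w0 \<in> H\<close>] L(2)[OF T_H[OF \<open>w0 \<in> H\<close>, of 1]] exp_T[of w0 1] by simp
  then have "exp (L (w0 + T) - L w0) = 1" by (simp add: exp_diff)
  then have expD: "exp D = 1" by (simp only: D[OF \<open>w0 \<in> H\<close>])
  have Dj: "L (w + of_nat j * T) = L w + of_nat j * D" if "w \<in> H" for w j
  proof (induction j)
    case (Suc j)
    have "L (w + of_nat j * T + T) = L (w + of_nat j * T) + D"
      using D[OF T_H[OF that, of j]] by (simp add: algebra_simps)
    then show ?case using Suc by (simp add: algebra_simps)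
  qed simp
  define P where "P l = exp (L (of_nat m * l) / of_nat m)" for l
  have m0: "of_nat m \<noteq> (0::complex)" using m by auto
  have P1: "P (l + of_nat j * T) = P l" if "of_nat m * l \<in> H" for l j
  proof -
    \<comment> \<open>Adding j periods to l adds m * j periods to m * l.\<close>
    have "L (of_nat m * (l + of_nat j * T)) = L (of_nat m * l) + of_nat (m * j) * D"
      using Dj[OF that, of "m * j"] by (simp add: algebra_simps)
    then have "P (l + of_nat j * T) = exp (L (of_nat m * l) / of_nat m + of_nat j * D)"
      using m0 by (simp add: P_def add_divide_distrib)
    also have "\<dots> = P l" using expD by (simp add: P_def exp_add exp_of_nat_mult)
    finally show ?thesis .
  qed
  have Re_l: "of_nat m * l \<in> H" if "exp l \<in> ball 0 s - {0}" for l
  proof -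
    have "exp (Re l) < s" using that by (simp add: dist_norm)
    then have "exp (Re l) ^ m < s ^ m" using m by (intro power_strict_mono) auto
    then have "exp (of_nat m * Re l) < r" using s by (simp add: exp_of_nat_mult)
    then show ?thesis using r by (simp add: H_def) (metis ln_exp ln_less_cancel_iff exp_gt_zero)
  qed
  have P2: "P l = P l'" if "exp l = exp l'" "exp l \<in> ball 0 s - {0}" for l l'
  proof -
    have "\<exists>n::int. l = l' + of_real (of_int (2 * n) * pi) * \<i>"
      by (rule iffD1[OF exp_eq that(1)])
    then obtain n :: int where "l = l' + of_real (of_int (2 * n) * pi) * \<i>" ..
    then have n: "l = l' + of_int n * T" by (simp add: T_def)
    show ?thesis
    proof (cases "n \<ge> 0")
      case True
      then have "l = l' + of_nat (nat n) * T" using n by simp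
      then show ?thesis using P1[OF Re_l, of l' "nat n"] that by simp
    next
      case False
      then have "l' = l + of_nat (nat (- n)) * T" using n by (simp add: algebra_simps)
      then show ?thesis using P1[OF Re_l, of l "nat (- n)"] that by simp
    qed
  qed
  define \<rho> where "\<rho> u = P (Ln u)" for u
  show thesis
  proof (rule that[of \<rho>])
    fix u :: complex assume u: "u \<in> ball 0 s - {0}"
    then have u0: "u \<noteq> 0" by auto
    have h: "of_nat m * Ln u \<in> H" using Re_l[of "Ln u"] u u0 by simp
    have "\<rho> u ^ m = exp (L (of_nat m * Ln u))"
      using m0 by (simp add: \<rho>_def P_def flip: exp_of_nat_mult)
    also have "\<dots> = \<kappa> (exp (of_nat m * Ln u))" using L(2)[OF h] by simp
    also have "\<dots> = \<kappa> (u ^ m)" using u0 by (simp add: exp_of_nat_mult)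
    finally show "\<rho> u ^ m = \<kappa> (u ^ m)" .
  next
    have "isCont \<rho> u" if u: "u \<in> ball 0 s - {0}" for u
    proof -
      have u0: "u \<noteq> 0" using u by auto
      define N where "N = ball u (norm u) \<inter> (ball 0 s - {0})"
      \<comment> \<open>A logarithm that is continuous near \<open>u\<close> even if
        \<open>u\<close> lies on the cut of \<open>Ln\<close>; by \<open>P2\<close> every logarithm
        of v gives the same value of \<rho>.\<close>
      define l where "l v = Ln (v / u) + Ln u" for v
      have op: "open N" unfolding N_def by (intro open_Int open_ball open_Diff) auto
      have uN: "u \<in> N" using u u0 by (simp add: N_def)
      have Re: "Re (v / u) > 0" if "v \<in> N" for v
      proof -
        have "norm (v / u - 1) < 1"
          using that u0 by (simp add: N_def dist_norm norm_minus_commute divide_simps norm_divide diff_divide_eq_iff)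
        then show ?thesis using abs_Re_le_cmod[of "v / u - 1"] by simp
      qed
      have exp_l: "exp (l v) = v" if "v \<in> N" for v
        using that u0 by (simp add: l_def exp_add N_def)
      have eq: "\<rho> v = P (l v)" if "v \<in> N" for v
        unfolding \<rho>_def using that exp_l[OF that] by (intro P2) (auto simp: N_def)
      have "continuous_on N l"
        unfolding l_def using Re u0 by (intro continuous_intros) (force simp: complex_nonpos_Reals_iff)+
      moreover have "of_nat m * l v \<in> H" if "v \<in> N" for v
        using Re_l[of "l v"] exp_l[OF that] that by (simp add: N_def)
      ultimately have "continuous_on N (\<lambda>v. P (l v))"
        unfolding P_def using m0 by (intro continuous_intros continuous_on_compose2[OF L(1)]) auto
      then have "continuous_on N \<rho>" using eq by (simp cong: continuous_on_cong)
      then show ?thesis using op uN by (simp add: continuous_on_eq_continuous_at)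
    qed
    then show "continuous_on (ball 0 s - {0}) \<rho>" by (simp add: continuous_at_imp_continuous_on)
  qed
qed

section \<open>Gluing m-th roots over the plane minus finitely many points\<close>

definition root_on :: "nat \<Rightarrow> (complex \<Rightarrow> complex) \<Rightarrow> complex set \<Rightarrow> (complex \<Rightarrow> complex) \<Rightarrow> bool" where
  "root_on m F A g \<longleftrightarrow> continuous_on A g \<and> (\<forall>w\<in>A. g w ^ m = F w)"

lemma root_on_subset: "root_on m F A g \<Longrightarrow> B \<subseteq> A \<Longrightarrow> root_on m F B g"
  unfolding root_on_def by (meson continuous_on_subset subsetD)

text \<open>The quotient of two roots takes values in the finite set of m-th roots of unity.\<close>

lemma root_on_eq:
  assumes m: "m \<ge> 1" and A: "connected A" and g: "root_on m F A g" and h: "root_on m F A h"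
    and nz: "\<And>w. w \<in> A \<Longrightarrow> F w \<noteq> 0" and w0: "w0 \<in> A" "g w0 = h w0" and w: "w \<in> A"
  shows "g w = h w"
proof -
  have h0: "h w \<noteq> 0" if "w \<in> A" for w
  proof -
    have "h w ^ m = F w" using h that by (simp add: root_on_def)
    then show ?thesis using nz[OF that] m by (cases m) auto
  qed
  have "(\<lambda>w. g w / h w) constant_on A"
  proof (rule continuous_finite_range_constant[OF A])
    show "continuous_on A (\<lambda>w. g w / h w)"
      using g h h0 by (intro continuous_intros) (auto simp: root_on_def)
    have "(\<lambda>w. g w / h w) ` A \<subseteq> {z. z ^ m = 1}"
      using g h nz by (auto simp: root_on_def power_divide)
    then show "finite ((\<lambda>w. g w / h w) ` A)"
      using finite_nth_roots[of m 1] m by (meson finite_subset less_le_trans zero_less_one)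
  qed
  then have "g w / h w = g w0 / h w0" using w w0(1) by (auto simp: constant_on_def)
  then show ?thesis using w0 h0[OF w] h0[OF w0(1)] by simp
qed

lemma root_on_scale:
  assumes m: "m \<ge> 1" and g: "root_on m F A g" and w: "w \<in> A" "v ^ m = F w" "F w \<noteq> 0"
  obtains h where "root_on m F A h" "h w = v"
proof -
  have g0: "g w ^ m = F w" using g w by (auto simp: root_on_def)
  then have "g w \<noteq> 0" using w(3) m by (cases m) auto
  have "root_on m F A (\<lambda>z. (v / g w) * g z)"
    using g g0 w \<open>g w \<noteq> 0\<close> unfolding root_on_def by (auto intro!: continuous_intros simp: power_mult_distrib power_divide)
  then show thesis using that \<open>g w \<noteq> 0\<close> by simp
qed

lemma root_on_glue:
  fixes A :: "'i \<Rightarrow> complex set"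
  assumes op: "\<And>i. i \<in> I \<Longrightarrow> open (A i)" and g: "\<And>i. i \<in> I \<Longrightarrow> root_on m F (A i) (g i)"
    and eq: "\<And>i j w. i \<in> I \<Longrightarrow> j \<in> I \<Longrightarrow> w \<in> A i \<Longrightarrow> w \<in> A j \<Longrightarrow> g i w = g j w"
  obtains G where "root_on m F (\<Union>i\<in>I. A i) G"
proof -
  define G where "G w = g (SOME i. i \<in> I \<and> w \<in> A i) w" for w
  have G: "G w = g i w" if "i \<in> I" "w \<in> A i" for w i
  proof -
    have "(SOME i. i \<in> I \<and> w \<in> A i) \<in> I \<and> w \<in> A (SOME i. i \<in> I \<and> w \<in> A i)"
      using that by (intro someI[of "\<lambda>i. i \<in> I \<and> w \<in> A i" i]) simp
    then show ?thesis unfolding G_def using that by (intro eq) auto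
  qed
  have "continuous_on (\<Union>i\<in>I. A i) G"
  proof (rule continuous_on_open_UN)
    fix i assume i: "i \<in> I"
    have "continuous_on (A i) (g i)" using g[OF i] by (simp add: root_on_def)
    then show "continuous_on (A i) G" using G[OF i] by (simp cong: continuous_on_cong)
  qed (fact op)
  moreover have "G w ^ m = F w" if "w \<in> (\<Union>i\<in>I. A i)" for w
    using that G g by (auto simp: root_on_def)
  ultimately show thesis using that[of G] by (simp add: root_on_def)
qed

lemma convex_combination_norm_less:
  fixes p q :: complex
  assumes "norm p = R" "norm q = R" "p \<noteq> q" "0 < t" "t < 1"
  shows "norm ((1 - t) *\<^sub>R p + t *\<^sub>R q) < R"
proof -
  have "(norm ((1 - t) *\<^sub>R p + t *\<^sub>R q))\<^sup>2 =
      (1 - t) * (norm p)\<^sup>2 + t * (norm q)\<^sup>2 - t * (1 - t) * (norm (p - q))\<^sup>2"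
    unfolding cmod_power2 by (simp add: power2_eq_square algebra_simps)
  also have "\<dots> = R\<^sup>2 - t * (1 - t) * (norm (p - q))\<^sup>2"
    using assms by (simp add: algebra_simps)
  also have "\<dots> < R\<^sup>2" using assms by simp
  finally show ?thesis using assms(1) by (metis norm_ge_zero power_less_imp_less_base)
qed

text \<open>For balls centred on the circle of radius \<open>R\<close>. It allows local roots at two
  boundary points to be compared inside the disc, where both agree with a root already
  constructed.\<close>

lemma spherical_balls_meet_inside:
  fixes p q :: complex
  assumes p: "norm p = R" and q: "norm q = R" and R: "R > 0" and ne: "ball p r \<inter> ball q s \<noteq> {}"
  shows "ball p r \<inter> ball q s \<inter> ball 0 R \<noteq> {}"
proof -
  obtain x where x: "dist p x < r" "dist q x < s" using ne by auto
  then have rs: "r > 0" "s > 0" by (meson zero_le_dist le_less_trans)+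
  show ?thesis
  proof (cases "p = q")
    case True
    define e where "e = min (1/2) (min r s / (2 * R))"
    have e: "0 < e" "e < 1" "e * R < r" "e * R < s"
      using rs R by (auto simp: e_def field_simps min_def)
    let ?x = "(1 - e) *\<^sub>R p"
    have "p - ?x = e *\<^sub>R p" by (simp add: algebra_simps)
    then have "dist p ?x = e * R" using e p by (simp add: dist_norm)
    moreover have "norm ?x < R" using e p R by simp
    ultimately have "?x \<in> ball p r \<inter> ball q s \<inter> ball 0 R" using e True by simp
    then show ?thesis by blast
  next
    case False
    define d where "d = dist p q"
    have d: "d > 0" using False by (simp add: d_def)
    have "d < r + s" using x dist_triangle2[of p q x] by (simp add: d_def dist_commute)
    then have "1 < (r + s) / d" using d by (simp add: less_divide_eq)
    \<comment> \<open>A point of the chord at distance t * d from \<open>p\<close> and (1 - t) * d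
      from \<open>q\<close> is sought; strict convexity puts it inside the disc.\<close>
    then have "max 0 (1 - s / d) < min 1 (r / d)" using rs d by (simp add: add_divide_distrib)
    then obtain t where t: "max 0 (1 - s / d) < t" "t < min 1 (r / d)" using dense by blast
    let ?x = "(1 - t) *\<^sub>R p + t *\<^sub>R q"
    have "p - ?x = t *\<^sub>R (p - q)" "q - ?x = (1 - t) *\<^sub>R (q - p)" by (simp_all add: algebra_simps)
    then have "dist p ?x = t * d" "dist q ?x = (1 - t) * d"
      using t by (simp_all add: dist_norm d_def norm_minus_commute)
    moreover have "t * d < r" "(1 - t) * d < s" using t d by (auto simp: field_simps)
    moreover have "norm ?x < R" using convex_combination_norm_less[OF p q False, of t] t by simp
    ultimately have "?x \<in> ball p r \<inter> ball q s \<inter> ball 0 R" by simp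
    then show ?thesis by blast
  qed
qed

text \<open>Monodromy in the form of a continuous induction on the radius of a disc about 0. A root
  on an open disc extends across each boundary point, the extensions agree on overlaps because they
  agree inside the disc, and compactness yields a larger disc. Around points of \<open>S\<close>
  local roots are assumed, and removing finitely many points does not disconnect the
  overlaps.\<close>

lemma global_root:
  fixes F :: "complex \<Rightarrow> complex"
  assumes m: "m \<ge> 1" and S: "finite S" and cont: "continuous_on (- S) F"
    and nz: "\<And>w. w \<notin> S \<Longrightarrow> F w \<noteq> 0"
    and loc: "\<And>z. z \<in> S \<Longrightarrow> \<exists>r>0. \<exists>g. root_on m F (ball z r - S) g"
  obtains g where "root_on m F (- S) g"
proof -
  have local: "\<exists>r>0. \<exists>g. root_on m F (ball z r - S) g" for z
  proof (cases "z \<in> S")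
    case False
    have "open (- S)" using S by (simp add: finite_imp_closed open_Compl)
    then obtain r where r: "r > 0" "ball z r \<subseteq> - S" using False by (meson ComplI openE)
    have "continuous_on (ball z r) F" using cont r(2) continuous_on_subset by blast
    moreover have "\<And>w. w \<in> ball z r \<Longrightarrow> F w \<noteq> 0" using nz r(2) by blast
    ultimately obtain l where l: "continuous_on (ball z r) l" "\<And>w. w \<in> ball z r \<Longrightarrow> F w = exp (l w)"
      using continuous_logarithm_on_ball by metis
    have "root_on m F (ball z r) (\<lambda>w. exp (l w / of_nat m))"
      unfolding root_on_def using l m by (auto intro!: continuous_intros simp flip: exp_of_nat_mult)
    then have "root_on m F (ball z r - S) (\<lambda>w. exp (l w / of_nat m))" by (rule root_on_subset) auto
    then show ?thesis using r by blast
  qed (rule loc)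
  have nonempty: "\<exists>w. w \<in> A - S" if "open A" "A \<noteq> {}" for A
  proof -
    have "infinite A" using that finite_imp_not_open by blast
    then have "A - S \<noteq> {}" using S by (metis Diff_eq_empty_iff finite_subset)
    then show ?thesis by blast
  qed
  have conn: "connected (A - S)" if "open A" "connected A" for A
    by (rule connected_open_delete_finite[OF that _ S]) simp
  have unique: "g w = h w" if "open A" "connected A" "root_on m F (A - S) g" "root_on m F (A - S) h"
      "w0 \<in> A - S" "g w0 = h w0" "w \<in> A - S" for A g h w0 w
    by (rule root_on_eq[OF m conn[OF that(1,2)] that(3,4) _ that(5,6,7)]) (use nz in auto)
  define P where "P R \<longleftrightarrow> (\<exists>g. root_on m F (ball 0 R - S) g)" for R
  obtain R0 where R0: "R0 > 0" "P R0" using local[of 0] by (auto simp: P_def)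
  obtain w0 where w0: "w0 \<in> ball 0 R0 - S" using nonempty[of "ball 0 R0"] R0 by auto
  obtain g0 where "root_on m F (ball 0 R0 - S) g0" using R0 by (auto simp: P_def)
  then have v0: "g0 w0 ^ m = F w0" using w0 by (simp add: root_on_def)
  define v0 where "v0 = g0 w0"
  note v0 = v0[folded v0_def]
  \<comment> \<open>Roots on nested discs are made compatible by prescribing the common value
    \<open>v0\<close> at \<open>w0\<close>.\<close>
  have chain: "\<exists>g. root_on m F ((\<Union>R\<in>T. ball 0 R) - S) g" if T: "\<And>R. R \<in> T \<Longrightarrow> R \<ge> R0 \<and> P R" for T
  proof -
    have "\<exists>g. root_on m F (ball 0 R - S) g \<and> g w0 = v0" if R: "R \<in> T" for R
    proof -
      have "w0 \<in> ball 0 R - S" using T[OF R] w0 by auto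
      then show ?thesis using T[OF R] v0 nz root_on_scale[OF m] unfolding P_def by (metis DiffD2)
    qed
    then have "\<forall>R\<in>T. \<exists>g. root_on m F (ball 0 R - S) g \<and> g w0 = v0" by blast
    from bchoice[OF this] obtain g where
      g: "\<And>R. R \<in> T \<Longrightarrow> root_on m F (ball 0 R - S) (g R) \<and> g R w0 = v0" by blast
    have le: "g R w = g R' w" if "R \<in> T" "R' \<in> T" "w \<in> ball 0 R - S" "R \<le> R'" for R R' w
    proof (rule unique[of "ball 0 R" "g R" "g R'" w0 w])
      show "root_on m F (ball 0 R - S) (g R')"
        by (rule root_on_subset[OF conjunct1[OF g[OF that(2)]]]) (use that(4) in auto)
      show "w0 \<in> ball 0 R - S" using T[OF that(1)] w0 by auto
    qed (use g that in auto)
    obtain G where "root_on m F (\<Union>R\<in>T. ball 0 R - S) G"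
    proof (rule root_on_glue[of T "\<lambda>R. ball 0 R - S" m F g])
      show "open (ball 0 R - S)" for R :: real using S by (intro open_Diff finite_imp_closed) auto
      show "g R w = g R' w" if "R \<in> T" "R' \<in> T" "w \<in> ball 0 R - S" "w \<in> ball 0 R' - S" for R R' w
      proof (cases "R \<le> R'")
        case True
        then show ?thesis by (rule le[OF that(1,2,3)])
      next
        case False
        then have "R' \<le> R" by simp
        then show ?thesis by (rule le[OF that(2,1,4), symmetric])
      qed
    qed (use g in auto)
    moreover have "(\<Union>R\<in>T. ball 0 R - S) = (\<Union>R\<in>T. ball 0 R) - S" by auto
    ultimately show ?thesis by auto
  qed
  have extend: "\<exists>R'>R. P R'" if R: "R \<ge> R0" "P R" for R
  proof -
    have R_pos: "R > 0" using R R0 by simp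
    obtain g where g: "root_on m F (ball 0 R - S) g" using R by (auto simp: P_def)
    have "\<exists>r h. r > 0 \<and> root_on m F (ball p r - S) h \<and> (\<forall>w\<in>ball p r \<inter> ball 0 R - S. h w = g w)"
      if p: "norm p = R" for p
    proof -
      obtain r h where h: "r > 0" "root_on m F (ball p r - S) h" using local[of p] by blast
      have "ball p r \<inter> ball p r \<inter> ball 0 R \<noteq> {}"
        using h by (intro spherical_balls_meet_inside[OF p p R_pos]) auto
      then obtain w where w: "w \<in> ball p r \<inter> ball 0 R - S"
        using nonempty[of "ball p r \<inter> ball 0 R"] by auto
      have "g w ^ m = F w" using g w by (auto simp: root_on_def)
      then obtain h' where h': "root_on m F (ball p r - S) h'" "h' w = g w"
        using root_on_scale[OF m h(2), of w "g w"] w nz by auto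
      have "h' z = g z" if "z \<in> ball p r \<inter> ball 0 R - S" for z
      proof (rule unique[of "ball p r \<inter> ball 0 R" h' g w z])
        show "root_on m F (ball p r \<inter> ball 0 R - S) h'" "root_on m F (ball p r \<inter> ball 0 R - S) g"
          by (rule root_on_subset[OF h'(1)], blast, rule root_on_subset[OF g], blast)
        show "connected (ball p r \<inter> ball 0 R)" by (intro convex_connected convex_Int convex_ball)
      qed (use w h' that in auto)
      then show ?thesis using h h' by blast
    qed
    then have "\<forall>p\<in>{p. norm p = R}. \<exists>rh. fst rh > 0 \<and> root_on m F (ball p (fst rh) - S) (snd rh) \<and>
        (\<forall>w\<in>ball p (fst rh) \<inter> ball 0 R - S. snd rh w = g w)" by simp
    from bchoice[OF this] obtain rh where rh0: "\<forall>p\<in>{p. norm p = R}. fst (rh p) > 0 \<and>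
        root_on m F (ball p (fst (rh p)) - S) (snd (rh p)) \<and>
        (\<forall>w\<in>ball p (fst (rh p)) \<inter> ball 0 R - S. snd (rh p) w = g w)" ..
    define r h where "r p = fst (rh p)" and "h p = snd (rh p)" for p
    have rh: "r p > 0 \<and> root_on m F (ball p (r p) - S) (h p) \<and>
        (\<forall>w\<in>ball p (r p) \<inter> ball 0 R - S. h p w = g w)" if p: "norm p = R" for p
    proof -
      have "p \<in> {p. norm p = R}" using p by simp
      from bspec[OF rh0 this] show ?thesis unfolding r_def h_def .
    qed
    have hh: "h p w = h q w" if p: "norm p = R" and q: "norm q = R" and w: "w \<in> ball p (r p) \<inter> ball q (r q) - S" for p q w
    proof -
      have "ball p (r p) \<inter> ball q (r q) \<inter> ball 0 R \<noteq> {}"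
        using w by (intro spherical_balls_meet_inside[OF p q R_pos]) auto
      then obtain z where z: "z \<in> ball p (r p) \<inter> ball q (r q) \<inter> ball 0 R - S"
        using nonempty[of "ball p (r p) \<inter> ball q (r q) \<inter> ball 0 R"] by auto
      show ?thesis
      proof (rule unique[of "ball p (r p) \<inter> ball q (r q)" "h p" "h q" z w])
        show "root_on m F (ball p (r p) \<inter> ball q (r q) - S) (h p)"
          by (rule root_on_subset[of m F "ball p (r p) - S"]) (use rh[OF p] in auto)
        show "root_on m F (ball p (r p) \<inter> ball q (r q) - S) (h q)"
          by (rule root_on_subset[of m F "ball q (r q) - S"]) (use rh[OF q] in auto)
        show "connected (ball p (r p) \<inter> ball q (r q))" by (intro convex_connected convex_Int convex_ball)
        show "h p z = h q z" using rh[OF p] rh[OF q] z by auto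
      qed (use z w in auto)
    qed
    \<comment> \<open>The index 0 stands for the disc itself, the other indices for balls around
      boundary points; R > 0 keeps the two kinds apart.\<close>
    define A where "A p = (if p = 0 then ball 0 R else ball p (r p))" for p
    define k where "k p = (if p = 0 then g else h p)" for p
    define I where "I = insert 0 (sphere (0::complex) R)"
    have I: "p = 0 \<or> (p \<noteq> 0 \<and> norm p = R)" if "p \<in> I" for p using that R_pos by (auto simp: I_def)
    obtain G where G: "root_on m F (\<Union>p\<in>I. A p - S) G"
    proof (rule root_on_glue[of I "\<lambda>p. A p - S" m F k])
      show "open (A p - S)" for p using S by (intro open_Diff finite_imp_closed) (auto simp: A_def)
      show "root_on m F (A p - S) (k p)" if "p \<in> I" for p
        using I[OF that] g rh by (auto simp: A_def k_def)
      show "k p w = k q w" if pq: "p \<in> I" "q \<in> I" and w: "w \<in> A p - S" "w \<in> A q - S" for p q w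
        using I[OF pq(1)]
      proof (elim disjE conjE)
        assume p: "p = 0"
        from I[OF pq(2)] show ?thesis
        proof (elim disjE conjE)
          assume "q \<noteq> 0" "norm q = R" then show ?thesis using rh[of q] w p by (auto simp: A_def k_def)
        qed (simp add: p)
      next
        assume p: "p \<noteq> 0" "norm p = R"
        from I[OF pq(2)] show ?thesis
        proof (elim disjE conjE)
          assume "q \<noteq> 0" "norm q = R" then show ?thesis using hh[of p q w] w p by (auto simp: A_def k_def)
        next
          assume "q = 0" then show ?thesis using rh[of p] w p by (auto simp: A_def k_def)
        qed
      qed
    qed
    define U where "U = (\<Union>p\<in>I. A p)"
    have "open U" unfolding U_def A_def by (intro open_UN) auto
    moreover have "cball 0 R \<subseteq> U"
    proof
      fix z :: complex assume "z \<in> cball 0 R"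
      then consider "z \<in> ball 0 R" | "norm z = R" by fastforce
      then show "z \<in> U"
      proof cases
        case 1
        then show ?thesis by (auto simp: U_def I_def A_def)
      next
        case 2
        then have "z \<in> A z" "z \<in> I" using rh[of z] R_pos by (auto simp: A_def I_def)
        then show ?thesis by (auto simp: U_def)
      qed
    qed
    ultimately obtain e where e: "e > 0" "(\<Union>x\<in>cball 0 R. ball x e) \<subseteq> U"
      by (rule compact_subset_open_imp_ball_epsilon_subset[OF compact_cball])
    have "ball 0 (R + e) \<subseteq> U"
    proof
      fix z :: complex assume z: "z \<in> ball 0 (R + e)"
      show "z \<in> U"
      proof (cases "norm z \<le> R")
        case True then show ?thesis using \<open>cball 0 R \<subseteq> U\<close> by auto
      next
        case False
        then have nz: "norm z > R" by simp
        then have "z \<noteq> 0" using R_pos by force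
        let ?x = "(R / norm z) *\<^sub>R z"
        have "z - ?x = (1 - R / norm z) *\<^sub>R z" by (simp add: algebra_simps)
        then have "dist ?x z = \<bar>1 - R / norm z\<bar> * norm z" by (simp add: dist_norm norm_minus_commute)
        also have "\<bar>1 - R / norm z\<bar> = 1 - R / norm z"
          using nz R_pos by (intro abs_of_nonneg) (simp add: divide_le_eq_1)
        also have "(1 - R / norm z) * norm z = norm z - R" using \<open>z \<noteq> 0\<close> by (simp add: left_diff_distrib)
        finally have "z \<in> ball ?x e" using z by simp
        moreover have "?x \<in> cball 0 R" using nz R_pos by (simp add: norm_minus_commute)
        ultimately show ?thesis using e by blast
      qed
    qed
    moreover have "(\<Union>p\<in>I. A p - S) = U - S" by (auto simp: U_def)
    ultimately have "root_on m F (ball 0 (R + e) - S) G"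
      using G by (auto intro: root_on_subset[of m F "U - S" G])
    then show ?thesis using e by (intro exI[of _ "R + e"]) (auto simp: P_def)
  qed
  \<comment> \<open>Otherwise the admissible radii are bounded; their supremum is admissible by
    \<open>chain\<close>, and \<open>extend\<close> exceeds it.\<close>
  have all: "\<exists>R'\<ge>R. R' \<ge> R0 \<and> P R'" for R
  proof (rule ccontr)
    assume *: "\<not> ?thesis"
    define T where "T = {R'. R' \<ge> R0 \<and> P R'}"
    have bd: "bdd_above T" using * by (intro bdd_aboveI[of _ R]) (auto simp: T_def)
    have ne: "R0 \<in> T" using R0 by (simp add: T_def)
    define M where "M = Sup T"
    have M: "M \<ge> R0" unfolding M_def using ne bd by (rule cSup_upper)
    obtain g where "root_on m F ((\<Union>R\<in>T. ball 0 R) - S) g" using chain[of T] by (auto simp: T_def)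
    moreover have "ball 0 M \<subseteq> (\<Union>R\<in>T. ball (0::complex) R)"
    proof
      fix z :: complex assume "z \<in> ball 0 M"
      then obtain R' where "R' \<in> T" "norm z < R'"
        using ne bd unfolding M_def by (metis less_cSup_iff empty_iff mem_ball_0)
      then show "z \<in> (\<Union>R\<in>T. ball 0 R)" by auto
    qed
    ultimately have "root_on m F (ball 0 M - S) g" by (elim root_on_subset) blast
    then have "P M" by (auto simp: P_def)
    then obtain R' where "R' > M" "P R'" using extend M by blast
    then have "R' \<in> T" using M by (simp add: T_def)
    then have "R' \<le> M" unfolding M_def using bd by (rule cSup_upper)
    then show False using \<open>R' > M\<close> by simp
  qed
  obtain g where "root_on m F ((\<Union>R\<in>{R. R \<ge> R0 \<and> P R}. ball 0 R) - S) g" using chain[of "{R. R \<ge> R0 \<and> P R}"] by auto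
  moreover have "(\<Union>R\<in>{R. R \<ge> R0 \<and> P R}. ball (0::complex) R) = UNIV"
  proof (intro equalityI subsetI UNIV_I)
    fix z :: complex
    obtain R where "R \<ge> norm z + 1" "R \<ge> R0 \<and> P R" using all[of "norm z + 1"] by blast
    then show "z \<in> (\<Union>R\<in>{R. R \<ge> R0 \<and> P R}. ball 0 R)" by (intro UN_I[of R]) auto
  qed
  ultimately show thesis using that by (auto simp: Compl_eq_Diff_UNIV)
qed


section \<open>Proper covers with given local degrees, and their roots\<close>

definition power_cover :: "'a topology \<Rightarrow> 'b topology \<Rightarrow> ('a \<Rightarrow> 'b) \<Rightarrow> ('a \<Rightarrow> nat) \<Rightarrow> bool" where
  "power_cover X Y f D \<longleftrightarrow> Hausdorff_space X \<and> proper_map X Y f \<and> continuous_map X Y f \<and>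
     (\<forall>x\<in>topspace X. locally_power X Y f x (D x))"

lemma power_cover_branched_cover:
  assumes "branched_cover X Y f" "compact_space X" "Hausdorff_space X" "Hausdorff_space Y"
  shows "power_cover X Y f (local_degree X Y f)"
proof -
  have c: "continuous_map X Y f" using assms by (simp add: branched_cover_def)
  have "proper_map X Y f"
    using continuous_imp_proper_map[OF assms(2) Hausdorff_imp_kc_space[OF assms(4)] c] .
  moreover have "locally_power X Y f x (local_degree X Y f x)" if x: "x \<in> topspace X" for x
  proof -
    obtain k where k: "locally_power X Y f x k" using assms(1) x by (auto simp: branched_cover_def)
    then show ?thesis using local_degree_eqI[OF k x] by simp
  qed
  ultimately show ?thesis using assms c by (simp add: power_cover_def)
qed

text \<open>\<open>D\<close> is a parameter distinct from \<open>local_degree\<close> because the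
  same weights are carried along to restrictions and roots of a map, which have other topologies as
  source and target; \<open>locally_power_unique\<close> identifies the two.\<close>

lemma power_cover_weight_constant:
  assumes pc: "power_cover X Y f D" and Y: "connected_space Y" and y: "y \<in> topspace Y" "y' \<in> topspace Y"
  shows "sum D (fibre X f y) = sum D (fibre X f y')" "finite (fibre X f y)"
proof -
  have lp: "locally_power X Y f x (D x)" if "x \<in> topspace X" for x
    using pc that by (simp add: power_cover_def)
  have D: "local_degree X Y f x = D x" if "x \<in> topspace X" for x
    using local_degree_eqI[OF lp[OF that] that] .
  have m: "multiplicity_at X Y f (local_degree X Y f) x \<and> local_degree X Y f x \<ge> 1" if "x \<in> topspace X" for x
  proof
    show "multiplicity_at X Y f (local_degree X Y f) x"
      by (rule multiplicity_at_local_degree[OF lp[OF that] that])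
    show "local_degree X Y f x \<ge> 1" using lp[OF that] D[OF that] by (simp add: locally_power_def)
  qed
  have H: "Hausdorff_space X" and p: "proper_map X Y f" using pc by (auto simp: power_cover_def)
  have "sum (local_degree X Y f) (fibre X f y) = sum (local_degree X Y f) (fibre X f y')"
    by (rule fibre_weight_constant[OF H p Y m y])
  moreover have "sum (local_degree X Y f) (fibre X f z) = sum D (fibre X f z)" for z
    by (rule sum.cong) (auto simp: fibre_def D)
  ultimately show "sum D (fibre X f y) = sum D (fibre X f y')" by simp
  show "finite (fibre X f y)" using fibre_weight_locally_constant[OF H p m y(1)] by blast
qed

lemma chart_subtopology:
  assumes "chart X U \<phi>" "openin X X0" "U \<subseteq> X0"
  shows "chart (subtopology X X0) U \<phi>"
  using assms by (simp add: chart_def openin_open_subtopology subtopology_subtopology Int_absorb1)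

lemma locally_power_subtopology:
  assumes lp: "locally_power X Y f x k" and Y0: "openin Y Y0" and X0: "X0 = {x \<in> topspace X. f x \<in> Y0}"
    and f: "continuous_map X Y f" and x: "x \<in> X0"
  shows "locally_power (subtopology X X0) (subtopology Y Y0) f x k"
proof -
  obtain U \<phi> V \<psi> where k: "k \<ge> 1" and \<phi>: "chart X U \<phi>" "x \<in> U" "\<phi> x = 0"
    and \<psi>: "chart Y V \<psi>" "f x \<in> V" "\<psi> (f x) = 0"
    and fU: "f ` U \<subseteq> V" "\<And>z. z \<in> U \<Longrightarrow> \<psi> (f z) = \<phi> z ^ k"
    using lp by (auto simp: locally_power_def)
  have oX0: "openin X X0" unfolding X0 by (rule openin_continuous_map_preimage[OF f Y0])
  have "chart X (U \<inter> X0) \<phi>"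
    by (rule chart_restrict[OF \<phi>(1)]) (auto intro: openin_Int chart_open[OF \<phi>(1)] oX0)
  then have 1: "chart (subtopology X X0) (U \<inter> X0) \<phi>" by (rule chart_subtopology[OF _ oX0]) auto
  have "chart Y (V \<inter> Y0) \<psi>"
    by (rule chart_restrict[OF \<psi>(1)]) (auto intro: openin_Int chart_open[OF \<psi>(1)] Y0)
  then have 2: "chart (subtopology Y Y0) (V \<inter> Y0) \<psi>" by (rule chart_subtopology[OF _ Y0]) auto
  show ?thesis
    unfolding locally_power_def
  proof (intro conjI exI)
    show "chart (subtopology X X0) (U \<inter> X0) \<phi>" "chart (subtopology Y Y0) (V \<inter> Y0) \<psi>" by fact+
    show "f ` (U \<inter> X0) \<subseteq> V \<inter> Y0" using fU X0 by auto
  qed (use k \<phi> \<psi> fU x X0 in auto)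
qed

lemma power_cover_subtopology:
  assumes pc: "power_cover X Y f D" and Y0: "openin Y Y0" and X0: "X0 = {x \<in> topspace X. f x \<in> Y0}"
  shows "power_cover (subtopology X X0) (subtopology Y Y0) f D"
  unfolding power_cover_def
proof (intro conjI ballI)
  have f: "continuous_map X Y f" using pc by (simp add: power_cover_def)
  show "Hausdorff_space (subtopology X X0)" using pc by (simp add: power_cover_def Hausdorff_space_subtopology)
  show "proper_map (subtopology X X0) (subtopology Y Y0) f"
    by (rule proper_map_restriction) (use pc X0 in \<open>auto simp: power_cover_def\<close>)
  show "continuous_map (subtopology X X0) (subtopology Y Y0) f"
    by (rule continuous_map_into_subtopology[OF continuous_map_from_subtopology[OF f]]) (auto simp: X0)
  fix x assume "x \<in> topspace (subtopology X X0)"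
  then have "x \<in> X0" "x \<in> topspace X" by auto
  then show "locally_power (subtopology X X0) (subtopology Y Y0) f x (D x)"
    using pc by (intro locally_power_subtopology[OF _ Y0 X0 f]) (auto simp: power_cover_def)
qed

lemma chart_homeomorphic_preimage:
  assumes h: "homeomorphic_maps Y Z h h'" and c: "chart Y V \<psi>"
  shows "chart Z (h ` V) (\<lambda>z. \<psi> (h' z))"
proof -
  have hm: "homeomorphic_map Y Z h" and hm': "homeomorphic_map Z Y h'"
    using h homeomorphic_maps_map by blast+
  have VY: "V \<subseteq> topspace Y" by (rule chart_subset[OF c])
  have h'h: "h' (h y) = y" if "y \<in> topspace Y" for y using h that by (simp add: homeomorphic_maps_def)
  have im: "h' ` h ` V = V" using VY h'h by (force simp: image_image)
  have oV: "openin Z (h ` V)"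
    using homeomorphic_map_openness[OF hm VY] chart_open[OF c] by simp
  have sub: "h ` V \<subseteq> topspace Z" by (rule openin_subset[OF oV])
  have "homeomorphic_map (subtopology Z (h ` V)) (subtopology Y V) h'"
    by (rule homeomorphic_map_subtopologies[OF hm']) (use sub im VY in \<open>auto simp: Int_absorb1\<close>)
  moreover have "homeomorphic_map (subtopology Y V) (top_of_set (\<psi> ` V)) \<psi>"
    using c by (simp add: chart_def)
  ultimately have "homeomorphic_map (subtopology Z (h ` V)) (top_of_set (\<psi> ` V)) (\<psi> \<circ> h')"
    by (rule homeomorphic_map_compose)
  moreover have "(\<lambda>z. \<psi> (h' z)) ` h ` V = \<psi> ` V" using im by (metis image_image)
  ultimately show ?thesis using oV c by (simp add: chart_def o_def)
qed

lemma locally_power_homeomorphic_target: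
  assumes lp: "locally_power X Y f x k" and h: "homeomorphic_maps Y Z h h'"
  shows "locally_power X Z (\<lambda>x. h (f x)) x k"
proof -
  obtain U \<phi> V \<psi> where k: "k \<ge> 1" and \<phi>: "chart X U \<phi>" "x \<in> U" "\<phi> x = 0"
    and \<psi>: "chart Y V \<psi>" "f x \<in> V" "\<psi> (f x) = 0"
    and fU: "f ` U \<subseteq> V" "\<And>z. z \<in> U \<Longrightarrow> \<psi> (f z) = \<phi> z ^ k"
    using lp by (auto simp: locally_power_def)
  have h'h: "h' (h y) = y" if "y \<in> V" for y
    using h that chart_subset[OF \<psi>(1)] by (auto simp: homeomorphic_maps_def)
  show ?thesis
    unfolding locally_power_def
  proof (intro conjI exI)
    show "chart Z (h ` V) (\<lambda>z. \<psi> (h' z))" by (rule chart_homeomorphic_preimage[OF h \<psi>(1)])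
    show "chart X U \<phi>" by fact
    show "\<forall>z\<in>U. \<psi> (h' (h (f z))) = \<phi> z ^ k" using fU h'h by auto
    show "\<psi> (h' (h (f x))) = 0" using \<psi> h'h by simp
  qed (use k \<phi> \<psi> fU in auto)
qed

lemma power_cover_homeomorphic_target:
  assumes pc: "power_cover X Y f D" and h: "homeomorphic_map Y Z h"
  shows "power_cover X Z (\<lambda>x. h (f x)) D"
proof -
  obtain h' where h': "homeomorphic_maps Y Z h h'" using h homeomorphic_map_maps by blast
  have "proper_map X Z (h \<circ> f)" "continuous_map X Z (h \<circ> f)"
    using pc h by (auto simp: power_cover_def intro: proper_map_compose continuous_map_compose
        homeomorphic_imp_proper_map homeomorphic_imp_continuous_map)
  then show ?thesis
    using pc locally_power_homeomorphic_target[where f = f, OF _ h'] unfolding power_cover_def o_def by simp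
qed

lemma chart_open_plane:
  assumes "open A" "open N" "N \<subseteq> A" "continuous_on N \<theta>" "inj_on \<theta> N"
  shows "chart (top_of_set A) N (\<theta> :: complex \<Rightarrow> complex)"
proof (rule chartI)
  show "openin (top_of_set A) N" using assms by (simp add: openin_open_eq)
  show "continuous_map (subtopology (top_of_set A) N) euclidean \<theta>"
    using assms by (simp add: subtopology_subtopology Int_absorb1)
  show "open (\<theta> ` W)" if "openin (top_of_set A) W" "W \<subseteq> N" for W
  proof (rule invariance_of_domain)
    show "open W" using that assms(1) by (simp add: openin_open_eq)
    show "continuous_on W \<theta>" "inj_on \<theta> W"
      using that assms continuous_on_subset inj_on_subset by blast+
  qed
qed fact

lemma open_power_preimage:
  assumes "open C"
  shows "open {u::complex. u ^ q \<in> C}"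
proof -
  have "continuous_on UNIV (\<lambda>u::complex. u ^ q)" by (intro continuous_intros)
  then show ?thesis
    using assms continuous_on_open_vimage[OF open_UNIV, of "\<lambda>u. u ^ q"] by (auto simp: vimage_def)
qed

text \<open>Since \<open>B\<close> omits 0, the m-th power is locally injective at g x, so \<psi> (w
  ^ m) is a coordinate there. In it \<open>g\<close> has the same expression as \<open>F\<close> in
  \<psi>, hence the same exponent.\<close>

lemma locally_power_root:
  fixes B :: "complex set"
  assumes B: "open B" "0 \<notin> B" and m: "m \<ge> 1" and lp: "locally_power X (top_of_set B) F x k"
    and F: "\<And>z. z \<in> topspace X \<Longrightarrow> F z \<in> B" and x: "x \<in> topspace X"
    and g: "continuous_map X euclidean g" "\<And>z. z \<in> topspace X \<Longrightarrow> g z ^ m = F z"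
  shows "locally_power X (top_of_set {w. w ^ m \<in> B}) g x k"
proof -
  let ?A = "{w. w ^ m \<in> B}"
  obtain U \<phi> V \<psi> where k: "k \<ge> 1" and \<phi>: "chart X U \<phi>" "x \<in> U" "\<phi> x = 0"
    and \<psi>: "chart (top_of_set B) V \<psi>" "F x \<in> V" "\<psi> (F x) = 0"
    and fU: "F ` U \<subseteq> V" "\<And>z. z \<in> U \<Longrightarrow> \<psi> (F z) = \<phi> z ^ k"
    using lp by (auto simp: locally_power_def)
  note pre = open_power_preimage[of _ m]
  have oA: "open ?A" by (rule pre[OF B(1)])
  have oV: "open V" and VB: "V \<subseteq> B"
    using chart_open[OF \<psi>(1)] B(1) openin_open_eq by blast+
  have gx: "g x ^ m \<in> V" using g(2)[OF x] \<psi>(2) by simp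
  then have "g x ^ m \<noteq> 0" using VB B(2) by (metis subsetD)
  then have "g x \<noteq> 0" using m by (cases m) auto
  then obtain e where e: "e > 0" "inj_on (\<lambda>z. z ^ m) (ball (g x) e)"
    using power_locally_injective[OF _ m] by metis
  define N where "N = {w. w ^ m \<in> V} \<inter> ball (g x) e"
  have oN: "open N" unfolding N_def by (intro open_Int pre oV open_ball)
  have NA: "N \<subseteq> ?A" using VB by (auto simp: N_def)
  have inj: "inj_on (\<lambda>w. w ^ m) N" by (rule inj_on_subset[OF e(2)]) (auto simp: N_def)
  have cont: "continuous_on V \<psi>"
    using chart_continuous[OF \<psi>(1)] VB by (simp add: subtopology_subtopology Int_absorb1)
  have cN: "chart (top_of_set ?A) N (\<lambda>w. \<psi> (w ^ m))"
  proof (rule chart_open_plane[OF oA oN NA])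
    show "continuous_on N (\<lambda>w. \<psi> (w ^ m))"
      by (rule continuous_on_compose2[OF cont]) (auto simp: N_def intro!: continuous_intros)
    have "inj_on \<psi> ((\<lambda>w. w ^ m) ` N)"
      by (rule inj_on_subset[OF chart_inj[OF \<psi>(1)]]) (auto simp: N_def)
    then show "inj_on (\<lambda>w. \<psi> (w ^ m)) N"
      using comp_inj_on[OF inj] by (simp add: o_def)
  qed
  define U' where "U' = U \<inter> {z \<in> topspace X. g z \<in> N}"
  have "openin X {z \<in> topspace X. g z \<in> N}"
    by (rule openin_continuous_map_preimage[OF g(1)]) (use oN in simp)
  then have "openin X U'" unfolding U'_def using chart_open[OF \<phi>(1)] by (rule openin_Int[rotated])
  then have cU: "chart X U' \<phi>" by (rule chart_restrict[OF \<phi>(1)]) (auto simp: U'_def)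
  show ?thesis
    unfolding locally_power_def
  proof (intro conjI exI)
    show "chart X U' \<phi>" "chart (top_of_set ?A) N (\<lambda>w. \<psi> (w ^ m))" by fact+
    show "x \<in> U'" using \<phi> x gx e by (auto simp: U'_def N_def)
    then show "g x \<in> N" by (simp add: U'_def)
    show "\<psi> (g x ^ m) = 0" using g(2)[OF x] \<psi> by simp
    show "\<forall>z\<in>U'. \<psi> (g z ^ m) = \<phi> z ^ k" using fU g(2) by (auto simp: U'_def)
    show "g ` U' \<subseteq> N" by (auto simp: U'_def)
  qed (use k \<phi> in auto)
qed

lemma proper_map_cong:
  assumes "proper_map X Y f" "\<And>x. x \<in> topspace X \<Longrightarrow> f x = g x"
  shows "proper_map X Y g"
proof -
  have "{x \<in> topspace X. g x = y} = {x \<in> topspace X. f x = y}" for y using assms(2) by auto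
  moreover have "closed_map X Y g"
    using closed_map_eq[OF proper_imp_closed_map[OF assms(1)], of g] assms(2) by blast
  ultimately show ?thesis using assms(1) by (simp add: proper_map_def)
qed

text \<open>The target is the full preimage of \<open>B\<close> under the power map;
  \<open>g\<close> inherits properness from the composite \<open>F\<close>.\<close>

lemma power_cover_root:
  fixes B :: "complex set"
  assumes B: "open B" "0 \<notin> B" and m: "m \<ge> 1" and pc: "power_cover X (top_of_set B) F D"
    and g: "continuous_map X euclidean g" "\<And>z. z \<in> topspace X \<Longrightarrow> g z ^ m = F z"
  shows "power_cover X (top_of_set {w. w ^ m \<in> B}) g D"
proof -
  let ?A = "{w. w ^ m \<in> B}"
  have F: "F z \<in> B" if "z \<in> topspace X" for z
    using pc that by (auto simp: power_cover_def continuous_map_def)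
  have gA: "continuous_map X (top_of_set ?A) g"
    by (rule continuous_map_into_subtopology[OF g(1)]) (use g(2) F in auto)
  have "proper_map X (top_of_set ?A) g"
  proof (rule proper_map_from_composition_right[OF _ _ gA])
    show "Hausdorff_space (top_of_set ?A)" by (rule Hausdorff_space_subtopology) simp
    have eq: "\<And>x. x \<in> topspace X \<Longrightarrow> F x = ((\<lambda>w. w ^ m) \<circ> g) x" using g(2) by simp
    have "proper_map X (top_of_set B) F" using pc by (simp add: power_cover_def)
    then show "proper_map X (top_of_set B) ((\<lambda>w. w ^ m) \<circ> g)"
      using eq by (rule proper_map_cong)
    show "continuous_map (top_of_set ?A) (top_of_set B) (\<lambda>w. w ^ m)"
      by (rule continuous_map_into_subtopology) (auto intro!: continuous_intros)
  qed
  moreover have "locally_power X (top_of_set ?A) g x (D x)" if x: "x \<in> topspace X" for x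
    using pc x by (intro locally_power_root[OF B m _ F x g]) (auto simp: power_cover_def)
  ultimately show ?thesis using pc gA by (simp add: power_cover_def)
qed

text \<open>\<open>h\<close> may wind around 0 at f x, and divisibility undoes this: in coordinates
  \<open>h \<circ> f\<close> is \<kappa> (z ^ k) with k = m * q, that is \<kappa> ((z ^ q) ^ m), and
  \<open>punctured_disc_root\<close> is applied at z ^ q.\<close>

lemma locally_power_local_root:
  assumes lp: "locally_power X Y f x k" and mk: "m dvd k" and V0: "openin Y V0" "f x \<in> V0"
    and h: "continuous_map (subtopology Y (V0 - {f x})) euclidean h" "\<And>y. y \<in> V0 - {f x} \<Longrightarrow> h y \<noteq> (0::complex)"
  obtains U g where "openin X U" "x \<in> U" "continuous_map (subtopology X (U - {x})) euclidean g"
    "\<And>z. z \<in> U - {x} \<Longrightarrow> g z ^ m = h (f z)"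
proof -
  obtain U \<phi> V \<psi> where k: "k \<ge> 1" and \<phi>: "chart X U \<phi>" "x \<in> U" "\<phi> x = 0"
    and \<psi>: "chart Y V \<psi>" "f x \<in> V" "\<psi> (f x) = 0"
    and fU: "f ` U \<subseteq> V" "\<And>z. z \<in> U \<Longrightarrow> \<psi> (f z) = \<phi> z ^ k"
    using lp by (auto simp: locally_power_def)
  obtain q where q: "k = m * q" using mk by (auto simp: dvd_def)
  have m: "m \<ge> 1" and q1: "q \<ge> 1" using k q by (auto simp: Suc_le_eq intro: gr0I)
  have "chart Y (V \<inter> V0) \<psi>"
    by (rule chart_restrict[OF \<psi>(1)]) (auto intro: openin_Int chart_open[OF \<psi>(1)] V0)
  then obtain "homeomorphic_map (subtopology Y (V \<inter> V0)) (top_of_set (\<psi> ` (V \<inter> V0))) \<psi>" "open (\<psi> ` (V \<inter> V0))"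
    by (simp add: chart_def)
  then obtain \<psi>' where hm: "homeomorphic_maps (subtopology Y (V \<inter> V0)) (top_of_set (\<psi> ` (V \<inter> V0))) \<psi> \<psi>'"
    and oim: "open (\<psi> ` (V \<inter> V0))"
    using homeomorphic_map_maps by blast
  have VV: "V \<inter> V0 \<subseteq> topspace Y" using chart_subset[OF \<psi>(1)] by auto
  have inv: "\<psi>' (\<psi> y) = y" if "y \<in> V \<inter> V0" for y
    using hm that VV by (auto simp: homeomorphic_maps_def)
  have inv2: "\<psi>' u \<in> V \<inter> V0" "\<psi> (\<psi>' u) = u" if "u \<in> \<psi> ` (V \<inter> V0)" for u
    using that inv by auto
  have "0 \<in> \<psi> ` (V \<inter> V0)" using \<psi> V0 by (metis IntI image_eqI)
  then obtain r where r: "r > 0" "ball 0 r \<subseteq> \<psi> ` (V \<inter> V0)" using oim by (meson openE)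
  have \<psi>'0: "\<psi>' u \<in> V0 - {f x}" "\<psi>' u \<in> V" "\<psi> (\<psi>' u) = u" if "u \<in> ball 0 r - {0}" for u
  proof -
    have "u \<in> \<psi> ` (V \<inter> V0)" using that r by auto
    from inv2[OF this] show "\<psi>' u \<in> V" "\<psi> (\<psi>' u) = u" by auto
    show "\<psi>' u \<in> V0 - {f x}" using inv2[OF \<open>u \<in> \<psi> ` (V \<inter> V0)\<close>] that \<psi>(3) by auto
  qed
  have c\<psi>': "continuous_map (top_of_set (ball 0 r - {0})) (subtopology Y (V0 - {f x})) \<psi>'"
  proof (rule continuous_map_into_subtopology)
    have "continuous_map (top_of_set (\<psi> ` (V \<inter> V0))) (subtopology Y (V \<inter> V0)) \<psi>'"
      using hm by (simp add: homeomorphic_maps_def)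
    then have "continuous_map (top_of_set (\<psi> ` (V \<inter> V0))) Y \<psi>'" by (rule continuous_map_into_fulltopology)
    then show "continuous_map (top_of_set (ball 0 r - {0})) Y \<psi>'"
      by (rule continuous_map_from_subtopology_mono) (use r in auto)
    show "\<psi>' \<in> topspace (top_of_set (ball 0 r - {0})) \<rightarrow> V0 - {f x}" using \<psi>'0(1) by auto
  qed
  have "continuous_map (top_of_set (ball 0 r - {0})) euclidean (h \<circ> \<psi>')"
    by (rule continuous_map_compose[OF c\<psi>' h(1)])
  then have c\<kappa>: "continuous_on (ball 0 r - {0}) (\<lambda>u. h (\<psi>' u))" by (simp add: o_def)
  define s where "s = min 1 r"
  have s: "s > 0" "s \<le> 1" using r by (auto simp: s_def)
  have "s ^ m \<le> s ^ 1" using s m by (intro power_decreasing) auto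
  then have sm: "s ^ m \<le> r" by (simp add: s_def)
  obtain \<rho> where \<rho>: "continuous_on (ball 0 s - {0}) \<rho>"
    "\<And>u. u \<in> ball 0 s - {0} \<Longrightarrow> \<rho> u ^ m = h (\<psi>' (u ^ m))"
    by (rule punctured_disc_root[OF r(1) m sm c\<kappa>]) (use h(2) \<psi>'0(1) in blast)+
  define U' where "U' = {z \<in> U. \<phi> z \<in> {u. u ^ q \<in> ball 0 s}}"
  have "open {u::complex. u ^ q \<in> ball 0 s}" by (rule open_power_preimage) simp
  then have oU': "openin X U'" unfolding U'_def by (rule chart_open_preimage[OF \<phi>(1)])
  have \<phi>0: "\<phi> z ^ q \<in> ball 0 s - {0}" if "z \<in> U' - {x}" for z
  proof -
    have "\<phi> z \<noteq> 0" using inj_on_eq_iff[OF chart_inj[OF \<phi>(1)], of z x] that \<phi> by (simp add: U'_def)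
    then show ?thesis using that by (simp add: U'_def)
  qed
  show thesis
  proof (rule that[of U' "\<lambda>z. \<rho> (\<phi> z ^ q)"])
    show "openin X U'" by fact
    show "x \<in> U'" using \<phi> s q1 by (cases q) (simp_all add: U'_def)
    have "continuous_map (subtopology X (U' - {x})) euclidean \<phi>"
      by (rule continuous_map_from_subtopology_mono[OF chart_continuous[OF \<phi>(1)]]) (auto simp: U'_def)
    then have "continuous_map (subtopology X (U' - {x})) euclidean (\<lambda>z. \<phi> z ^ q)"
      by (rule continuous_map_compose[where g = "\<lambda>u. u ^ q", unfolded o_def]) (auto intro!: continuous_intros)
    then have "continuous_map (subtopology X (U' - {x})) (top_of_set (ball 0 s - {0})) (\<lambda>z. \<phi> z ^ q)"
      by (rule continuous_map_into_subtopology) (use \<phi>0 in auto)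
    then show "continuous_map (subtopology X (U' - {x})) euclidean (\<lambda>z. \<rho> (\<phi> z ^ q))"
      by (rule continuous_map_compose[where g = \<rho>, unfolded o_def]) (use \<rho> in simp)
    fix z assume z: "z \<in> U' - {x}"
    have "\<rho> (\<phi> z ^ q) ^ m = h (\<psi>' ((\<phi> z ^ q) ^ m))" by (rule \<rho>(2)[OF \<phi>0[OF z]])
    also have "(\<phi> z ^ q) ^ m = \<psi> (f z)" using fU z q by (simp add: U'_def mult.commute flip: power_mult)
    also have "\<psi>' (\<psi> (f z)) = f z"
    proof (rule inv)
      have "norm (\<phi> z ^ q) < s" using \<phi>0[OF z] by simp
      then have "norm (\<phi> z ^ q) ^ m < s ^ m" using m by (intro power_strict_mono) auto
      then have "norm ((\<phi> z ^ q) ^ m) < r" using sm by (simp add: norm_power)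
      then have "(\<phi> z ^ q) ^ m \<in> \<psi> ` (V \<inter> V0)" using r by auto
      then have "\<psi> (f z) \<in> \<psi> ` (V \<inter> V0)" using \<open>(\<phi> z ^ q) ^ m = \<psi> (f z)\<close> by simp
      then obtain y where y: "y \<in> V \<inter> V0" "\<psi> (f z) = \<psi> y" by blast
      have "f z \<in> V" using fU z by (auto simp: U'_def)
      then have "f z = y" using inj_on_eq_iff[OF chart_inj[OF \<psi>(1)]] y by blast
      then show "f z \<in> V \<inter> V0" using y by simp
    qed
    finally show "\<rho> (\<phi> z ^ q) ^ m = h (f z)" .
  qed
qed

text \<open>A point of \<open>T\<close> is taken as the point at infinity. This turns the sphere
  minus \<open>T\<close> into the plane minus a finite set, where \<open>global_root\<close>
  applies.\<close>

lemma sphere_root: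
  assumes X: "X homeomorphic_space S2" and T: "finite T" "T \<subseteq> topspace X" "T \<noteq> {}" and m: "m \<ge> 1"
    and F: "continuous_map (subtopology X (topspace X - T)) euclidean F" "\<And>z. z \<in> topspace X - T \<Longrightarrow> F z \<noteq> (0::complex)"
    and loc: "\<And>x. x \<in> T \<Longrightarrow> \<exists>U g. openin X U \<and> x \<in> U \<and>
       continuous_map (subtopology X (U - T)) euclidean g \<and> (\<forall>z\<in>U - T. g z ^ m = F z)"
  obtains g where "continuous_map (subtopology X (topspace X - T)) euclidean g"
    "\<And>z. z \<in> topspace X - T \<Longrightarrow> g z ^ m = F z"
proof -
  obtain p0 where p0: "p0 \<in> T" using T by blast
  have p0X: "p0 \<in> topspace X" using p0 T by blast
  let ?X0 = "topspace X - {p0}"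
  obtain \<theta> where hm: "homeomorphic_map (subtopology X ?X0) (euclidean :: complex topology) \<theta>"
    by (rule sphere_minus_point_homeomorphic_plane[OF X p0X])
  then obtain \<eta> where maps: "homeomorphic_maps (subtopology X ?X0) (euclidean :: complex topology) \<theta> \<eta>"
    using homeomorphic_map_maps by blast
  have ch: "chart X ?X0 \<theta>" by (rule chart_sphere_minus_point[OF X p0X hm])
  have c\<theta>: "continuous_map (subtopology X ?X0) euclidean \<theta>"
    and c\<eta>: "continuous_map euclidean (subtopology X ?X0) \<eta>"
    using maps by (auto simp: homeomorphic_maps_def)
  have \<eta>\<theta>: "\<eta> (\<theta> x) = x" if "x \<in> ?X0" for x using maps that by (auto simp: homeomorphic_maps_def)
  have \<theta>\<eta>: "\<theta> (\<eta> w) = w" for w using maps by (auto simp: homeomorphic_maps_def)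
  have \<eta>X: "\<eta> w \<in> ?X0" for w using c\<eta> by (auto simp: continuous_map_def)
  define S where "S = \<theta> ` (T - {p0})"
  have S_iff: "w \<in> S \<longleftrightarrow> \<eta> w \<in> T" for w
  proof
    assume "w \<in> S"
    then show "\<eta> w \<in> T" using \<eta>\<theta> T by (auto simp: S_def)
  next
    assume "\<eta> w \<in> T"
    then have "\<eta> w \<in> T - {p0}" using \<eta>X[of w] by auto
    then show "w \<in> S" unfolding S_def using \<theta>\<eta>[of w] by (metis imageI)
  qed
  have \<eta>_sub: "continuous_map (top_of_set C) (subtopology X E) \<eta>" if "\<And>w. w \<in> C \<Longrightarrow> \<eta> w \<in> E" for C E
  proof (rule continuous_map_into_subtopology)
    show "continuous_map (top_of_set C) X \<eta>"
      by (rule continuous_map_from_subtopology[OF continuous_map_into_fulltopology[OF c\<eta>]])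
  qed (use that in auto)
  have comp: "continuous_on C (\<lambda>w. G (\<eta> w))"
    if "continuous_map (subtopology X E) euclidean G" "\<And>w. w \<in> C \<Longrightarrow> \<eta> w \<in> E" for C E and G :: "_ \<Rightarrow> complex"
    using continuous_map_compose[OF \<eta>_sub[OF that(2)] that(1)] by (simp add: o_def)
  have root: "root_on m (\<lambda>w. F (\<eta> w)) C (\<lambda>w. G (\<eta> w))"
    if "continuous_map (subtopology X E) euclidean G" "\<And>w. w \<in> C \<Longrightarrow> \<eta> w \<in> E" "\<And>z. z \<in> E \<Longrightarrow> G z ^ m = F z"
    for C E and G :: "_ \<Rightarrow> complex"
    unfolding root_on_def using comp[OF that(1,2)] that(2,3) by blast
  obtain G where G: "root_on m (\<lambda>w. F (\<eta> w)) (- S) G"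
  proof (rule global_root[OF m])
    show "finite S" using T by (simp add: S_def)
    show "continuous_on (- S) (\<lambda>w. F (\<eta> w))"
      by (rule comp[OF F(1)]) (use \<eta>X S_iff in auto)
    show "F (\<eta> w) \<noteq> 0" if "w \<notin> S" for w using that \<eta>X[of w] S_iff by (intro F(2)) auto
    fix z assume "z \<in> S"
    then obtain x where x: "x \<in> T - {p0}" "z = \<theta> x" by (auto simp: S_def)
    obtain U g where U: "openin X U" "x \<in> U" "continuous_map (subtopology X (U - T)) euclidean g"
      "\<forall>z\<in>U - T. g z ^ m = F z"
      using loc x by blast
    have "openin X (U \<inter> ?X0)" using U(1) chart_open[OF ch] by (rule openin_Int)
    then have "open (\<theta> ` (U \<inter> ?X0))" by (rule chart_open_image[OF ch]) auto
    moreover have "z \<in> \<theta> ` (U \<inter> ?X0)" using x U T by auto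
    ultimately obtain r where r: "r > 0" "ball z r \<subseteq> \<theta> ` (U \<inter> ?X0)" by (meson openE)
    have "\<eta> w \<in> U - T" if w: "w \<in> ball z r - S" for w
    proof -
      have "w \<in> \<theta> ` (U \<inter> ?X0)" using w r by blast
      then obtain y where y: "y \<in> U" "y \<in> ?X0" "w = \<theta> y" by blast
      then have "\<eta> w \<in> U" using \<eta>\<theta>[OF y(2)] by simp
      then show ?thesis using w S_iff by auto
    qed
    then have "root_on m (\<lambda>w. F (\<eta> w)) (ball z r - S) (\<lambda>w. g (\<eta> w))"
      using U(4) by (intro root[OF U(3)]) auto
    then show "\<exists>r>0. \<exists>g. root_on m (\<lambda>w. F (\<eta> w)) (ball z r - S) g" using r by blast
  qed (rule that)
  have \<theta>S: "\<theta> z \<in> - S" "\<eta> (\<theta> z) = z" if "z \<in> topspace X - T" for z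
  proof -
    have z: "z \<in> ?X0" using that p0 by auto
    then show "\<eta> (\<theta> z) = z" by (rule \<eta>\<theta>)
    then show "\<theta> z \<in> - S" using S_iff[of "\<theta> z"] that by simp
  qed
  show thesis
  proof (rule that[of "\<lambda>z. G (\<theta> z)"])
    have "continuous_map (subtopology X (topspace X - T)) euclidean \<theta>"
      by (rule continuous_map_from_subtopology_mono[OF c\<theta>]) (use p0 in auto)
    then have "continuous_map (subtopology X (topspace X - T)) (top_of_set (- S)) \<theta>"
      by (rule continuous_map_into_subtopology) (use \<theta>S in auto)
    then show "continuous_map (subtopology X (topspace X - T)) euclidean (\<lambda>z. G (\<theta> z))"
      by (rule continuous_map_compose[where g = G, unfolded o_def]) (use G in \<open>simp add: root_on_def\<close>)
    show "G (\<theta> z) ^ m = F z" if "z \<in> topspace X - T" for z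
      using G \<theta>S[OF that] by (simp add: root_on_def)
  qed
qed


section \<open>Obstructions\<close>

lemma mset_set_three_distinct:
  assumes "mset_set S = {#a, b, c#}"
  shows "S = {a, b, c}" "a \<noteq> b" "a \<noteq> c" "b \<noteq> c"
proof -
  have fin: "finite S" using assms by (metis add_mset_not_empty mset_set.infinite)
  show S: "S = {a, b, c}" using assms fin by (metis finite_set_mset_mset_set set_mset_add_mset_insert set_mset_empty)
  have "card S = 3" using assms by (metis size_mset_set size_add_mset size_empty numeral_3_eq_3)
  then show "a \<noteq> b" "a \<noteq> c" "b \<noteq> c" unfolding S by (auto simp: card_insert_if split: if_splits)
qed

lemma realizable_threeE:
  assumes "realizable X Y d {#A, B, C#}"
  obtains f a b c where "branched_cover X Y f" "a \<noteq> b" "a \<noteq> c" "b \<noteq> c"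
    "a \<in> topspace Y" "b \<in> topspace Y" "c \<in> topspace Y"
    "local_degrees X Y f a = A" "local_degrees X Y f b = B" "local_degrees X Y f c = C"
proof -
  obtain f where f: "branched_cover X Y f"
    "image_mset (local_degrees X Y f) (mset_set (branching_points X Y f)) = {#A, B, C#}"
    using assms by (auto simp: realizable_def)
  obtain a M where a: "mset_set (branching_points X Y f) = add_mset a M" "local_degrees X Y f a = A"
    "image_mset (local_degrees X Y f) M = {#B, C#}"
    using msed_map_invR[OF f(2)] by blast
  obtain b N where b: "M = add_mset b N" "local_degrees X Y f b = B" "image_mset (local_degrees X Y f) N = {#C#}"
    using msed_map_invR[OF a(3)] by blast
  obtain c where c: "N = {#c#}" "local_degrees X Y f c = C"
    using msed_map_invR[OF b(3)] by auto
  have M: "mset_set (branching_points X Y f) = {#a, b, c#}" using a b c by simp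
  note d = mset_set_three_distinct[OF M]
  have "{a, b, c} \<subseteq> topspace Y" unfolding d(1)[symmetric] by (auto simp: branching_points_def)
  then show thesis using f(1) d a b c by (intro that[of f a b c]) auto
qed

lemma local_degrees_fibre:
  assumes "local_degrees X Y f y = A" "A \<noteq> {#}"
  shows "finite (fibre X f y)" "fibre X f y \<noteq> {}"
    "\<And>x. x \<in> fibre X f y \<Longrightarrow> local_degree X Y f x \<in># A"
    "sum (local_degree X Y f) (fibre X f y) = sum_mset A"
    "card {x \<in> fibre X f y. local_degree X Y f x = e} = count A e"
proof -
  \<comment> \<open>\<open>mset_set\<close> of an infinite set is empty, so a nonempty multiset of
    local degrees forces a finite fibre.\<close>
  show fin: "finite (fibre X f y)" using assms unfolding local_degrees_def by (metis image_mset_empty mset_set.infinite)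
  show "fibre X f y \<noteq> {}" using assms unfolding local_degrees_def by auto
  show "local_degree X Y f x \<in># A" if "x \<in> fibre X f y" for x
    using assms(1) that fin unfolding local_degrees_def by auto
  show "sum (local_degree X Y f) (fibre X f y) = sum_mset A"
    using assms(1) unfolding local_degrees_def by (simp add: sum_unfold_sum_mset)
  show "card {x \<in> fibre X f y. local_degree X Y f x = e} = count A e"
    using fin assms(1)[symmetric] unfolding local_degrees_def
    by (simp add: count_image_mset' filter_mset_mset_set) (simp add: image_mset_filter_mset_swap eq_commute)
qed

section \<open>The common setting of types 4 and 5, and the cube root\<close>

lemma open_Compl_finite: "finite (S :: complex set) \<Longrightarrow> open (- S)"
  by (simp add: finite_imp_closed open_Compl)

lemma connected_Compl_finite: "finite (S :: complex set) \<Longrightarrow> connected (- S)"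
  unfolding Compl_eq_Diff_UNIV by (rule connected_open_delete_finite) (auto simp: connected_UNIV)

text \<open>What both obstructions start from: local degrees divisible by 3 over \<open>y3\<close>
  and \<open>y6\<close>. The preimages of these points become the punctures \<open>T\<close>, and
  \<open>ne\<close> provides one to be placed at infinity.\<close>

locale three_fold_branching =
  fixes X :: "'a topology" and Y :: "'b topology" and f y2 y3 y6
  assumes X: "X homeomorphic_space S2" and Y: "Y homeomorphic_space S2"
    and f: "branched_cover X Y f"
    and y: "y2 \<in> topspace Y" "y3 \<in> topspace Y" "y6 \<in> topspace Y" "y2 \<noteq> y3" "y2 \<noteq> y6" "y3 \<noteq> y6"
    and fin: "finite (fibre X f y3)" "finite (fibre X f y6)" and ne: "fibre X f y3 \<noteq> {}"
    and div: "\<And>x. x \<in> fibre X f y3 \<union> fibre X f y6 \<Longrightarrow> 3 dvd local_degree X Y f x"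
begin

abbreviation "D \<equiv> local_degree X Y f"
definition "T = fibre X f y3 \<union> fibre X f y6"
definition "X1 = subtopology X (topspace X - T)"

lemma pc: "power_cover X Y f D"
  by (rule power_cover_branched_cover[OF f sphere_compact[OF X] sphere_Hausdorff[OF X] sphere_Hausdorff[OF Y]])

lemma lp: "x \<in> topspace X \<Longrightarrow> locally_power X Y f x (D x)"
  using pc by (simp add: power_cover_def)

lemma cf: "continuous_map X Y f"
  using f by (simp add: branched_cover_def)

lemma T_finite: "finite T" and T_sub: "T \<subseteq> topspace X" and T_ne: "T \<noteq> {}"
  using fin ne by (auto simp: T_def fibre_def)

lemma normalized_chart:
  obtains h where "homeomorphic_map (subtopology Y (topspace Y - {y3})) (euclidean :: complex topology) h"
    "h y6 = 0" "h y2 = 1"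
proof -
  obtain h where h: "homeomorphic_map (subtopology Y (topspace Y - {y3})) (euclidean :: complex topology) h"
    by (rule sphere_minus_point_homeomorphic_plane[OF Y y(2)])
  have "inj_on h (topspace Y - {y3})" using homeomorphic_imp_injective_map[OF h] by (simp add: Int_absorb1)
  then have ne: "h y2 \<noteq> h y6" using inj_on_eq_iff[of h "topspace Y - {y3}" y2 y6] y by simp
  define A where "A w = (w - h y6) / (h y2 - h y6)" for w
  define A' where "A' w = w * (h y2 - h y6) + h y6" for w
  have "homeomorphic_maps euclidean euclidean A A'"
    unfolding homeomorphic_maps_def using ne
    by (auto simp: A_def A'_def intro!: continuous_intros)
  then have "homeomorphic_map euclidean euclidean A" using homeomorphic_maps_map by blast
  then have "homeomorphic_map (subtopology Y (topspace Y - {y3})) euclidean (A \<circ> h)"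
    using h homeomorphic_map_compose by blast
  moreover have "(A \<circ> h) y6 = 0" "(A \<circ> h) y2 = 1" using ne by (auto simp: A_def)
  ultimately show thesis by (rule that)
qed

text \<open>Off \<open>T\<close> the composite \<open>h \<circ> f\<close> is finite and nonzero, and
  around each puncture it winds a multiple of three times.\<close>

lemma cube_root:
  obtains h g where "homeomorphic_map (subtopology Y (topspace Y - {y3})) (euclidean :: complex topology) h"
    "h y6 = 0" "h y2 = 1" "power_cover X1 (top_of_set (- {0})) g D"
    "\<And>x. x \<in> topspace X - T \<Longrightarrow> g x ^ 3 = h (f x)"
proof -
  obtain h where h: "homeomorphic_map (subtopology Y (topspace Y - {y3})) (euclidean :: complex topology) h"
    "h y6 = 0" "h y2 = 1" by (rule normalized_chart)
  have ch: "continuous_map (subtopology Y (topspace Y - {y3})) euclidean h"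
    using h(1) by (rule homeomorphic_imp_continuous_map)
  have inj: "inj_on h (topspace Y - {y3})" and surj: "h ` (topspace Y - {y3}) = UNIV"
    using homeomorphic_imp_injective_map[OF h(1)] homeomorphic_imp_surjective_map[OF h(1)]
    by (simp_all add: Int_absorb1)
  have h0: "h y \<noteq> 0" if "y \<in> topspace Y - {y3, y6}" for y
    using inj_on_eq_iff[OF inj, of y y6] that h(2) y by simp
  let ?Y0 = "topspace Y - {y3, y6}"
  have cl: "closedin Y {z}" if "z \<in> topspace Y" for z
    using sphere_Hausdorff[OF Y] that by (simp add: closedin_Hausdorff_sing_eq)
  have o3: "openin Y (topspace Y - {y3})" and o6: "openin Y (topspace Y - {y6})"
    using cl y by auto
  have eq: "?Y0 = (topspace Y - {y3}) \<inter> (topspace Y - {y6})" by auto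
  have oY0: "openin Y ?Y0" unfolding eq by (rule openin_Int[OF o3 o6])
  have X0: "topspace X - T = {x \<in> topspace X. f x \<in> ?Y0}"
    using cf by (auto simp: T_def fibre_def continuous_map_def)
  have pc1: "power_cover X1 (subtopology Y ?Y0) f D"
    unfolding X1_def by (rule power_cover_subtopology[OF pc oY0 X0])
  have "h ` ?Y0 = - {0}"
  proof
    show "h ` ?Y0 \<subseteq> - {0}"
    proof
      fix w assume "w \<in> h ` ?Y0"
      then obtain z where "z \<in> ?Y0" "w = h z" by (rule imageE)
      then show "w \<in> - {0}" using h0[of z] by simp
    qed
    show "- {0} \<subseteq> h ` ?Y0"
    proof
      fix w :: complex assume w: "w \<in> - {0}"
      then obtain z where z: "z \<in> topspace Y - {y3}" "w = h z" using surj by (metis UNIV_I imageE)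
      then have "z \<noteq> y6" using w h(2) by auto
      then show "w \<in> h ` ?Y0" using z by blast
    qed
  qed
  then have "homeomorphic_map (subtopology (subtopology Y (topspace Y - {y3})) ?Y0) (top_of_set (- {0})) h"
    by (intro homeomorphic_map_subtopologies[OF h(1)]) (auto simp: Int_absorb1 Int_absorb2 intro: arg_cong)
  moreover have "subtopology (subtopology Y (topspace Y - {y3})) ?Y0 = subtopology Y ?Y0"
    unfolding subtopology_subtopology by (rule arg_cong[where f = "subtopology Y"]) blast
  ultimately have h1: "homeomorphic_map (subtopology Y ?Y0) (top_of_set (- {0})) h" by simp
  have pc2: "power_cover X1 (top_of_set (- {0})) (\<lambda>x. h (f x)) D"
    by (rule power_cover_homeomorphic_target[OF pc1 h1])
  obtain g where g: "continuous_map (subtopology X (topspace X - T)) euclidean g"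
    "\<And>z. z \<in> topspace X - T \<Longrightarrow> g z ^ 3 = h (f z)"
  proof (rule sphere_root[OF X T_finite T_sub T_ne, of 3 "\<lambda>x. h (f x)"])
    show "continuous_map (subtopology X (topspace X - T)) euclidean (\<lambda>x. h (f x))"
      using pc2 continuous_map_into_fulltopology by (auto simp: power_cover_def X1_def)
    show "h (f z) \<noteq> 0" if "z \<in> topspace X - T" for z using that X0 h0 by blast
    fix x assume x: "x \<in> T"
    then have xX: "x \<in> topspace X" using T_sub by blast
    \<comment> \<open>A neighbourhood of f x that contains no other point of {y3, y6}, so that
      \<open>h\<close> is finite and nonzero on the rest of it.\<close>
    have "\<exists>V0. openin Y V0 \<and> f x \<in> V0 \<and> V0 - {f x} \<subseteq> ?Y0"
    proof (cases "f x = y3")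
      case True
      then show ?thesis using o6 y by (intro exI[of _ "topspace Y - {y6}"]) auto
    next
      case False
      then have "f x = y6" using x by (auto simp: T_def fibre_def)
      then show ?thesis using o3 y by (intro exI[of _ "topspace Y - {y3}"]) auto
    qed
    then obtain V0 where V0: "openin Y V0" "f x \<in> V0" "V0 - {f x} \<subseteq> ?Y0" by blast
    have c1: "continuous_map (subtopology Y (V0 - {f x})) euclidean h"
      by (rule continuous_map_from_subtopology_mono[OF ch]) (use V0(3) in auto)
    have n1: "h y \<noteq> 0" if "y \<in> V0 - {f x}" for y using h0 V0(3) that by blast
    have d1: "3 dvd D x" using div x by (simp add: T_def)
    obtain U g where U: "openin X U" "x \<in> U" "continuous_map (subtopology X (U - {x})) euclidean g"
      "\<And>z. z \<in> U - {x} \<Longrightarrow> g z ^ 3 = h (f z)"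
    proof (rule locally_power_local_root[OF lp[OF xX] d1 V0(1,2) c1])
      show "h y \<noteq> 0" if "y \<in> V0 - {f x}" for y by (rule n1[OF that])
    qed (rule that)
    have "continuous_map (subtopology X (U - T)) euclidean g"
      by (rule continuous_map_from_subtopology_mono[OF U(3)]) (use x in auto)
    then show "\<exists>U g. openin X U \<and> x \<in> U \<and> continuous_map (subtopology X (U - T)) euclidean g \<and>
        (\<forall>z\<in>U - T. g z ^ 3 = h (f z))"
      using U x by (intro exI[of _ U] exI[of _ g]) auto
  qed (use that in auto)
  have "power_cover X1 (top_of_set {w. w ^ 3 \<in> - {0}}) g D"
    by (rule power_cover_root[OF _ _ _ pc2]) (use g in \<open>auto simp: X1_def open_Compl_finite\<close>)
  moreover have "{w::complex. w ^ 3 \<in> - {0}} = - {0}" by auto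
  ultimately have "power_cover X1 (top_of_set (- {0})) g D" by simp
  with h g(2) show thesis by (intro that[of h g]) auto
qed

end

lemma primitive_cube_root:
  obtains w :: complex where "w\<^sup>2 + w + 1 = 0" "w \<noteq> 0" "w \<noteq> 1" "w\<^sup>2 \<noteq> 0" "w\<^sup>2 \<noteq> 1" "w\<^sup>2 \<noteq> w" "w ^ 3 = 1"
    "\<And>z. z ^ 3 = 1 \<longleftrightarrow> z = 1 \<or> z = w \<or> z = w\<^sup>2"
proof -
  define w where "w = Complex (- 1 / 2) (sqrt 3 / 2)"
  have e: "w\<^sup>2 + w + 1 = 0" by (simp add: w_def complex_eq_iff power2_eq_square)
  have w0: "w \<noteq> 0" and w1: "w \<noteq> 1" by (auto simp: w_def complex_eq_iff)
  have sq: "w\<^sup>2 = - w - 1" using e by (simp add: algebra_simps eq_neg_iff_add_eq_0)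
  have "w\<^sup>2 \<noteq> 1" unfolding sq by (auto simp: w_def complex_eq_iff)
  moreover have "w\<^sup>2 \<noteq> w" using w0 w1 by (simp add: power2_eq_square)
  moreover have "w ^ 3 = 1"
  proof -
    have "w ^ 3 - 1 = (w - 1) * (w\<^sup>2 + w + 1)" by (simp add: power3_eq_cube power2_eq_square algebra_simps)
    then show ?thesis unfolding e by simp
  qed
  moreover have "z ^ 3 = 1 \<longleftrightarrow> z = 1 \<or> z = w \<or> z = w\<^sup>2" for z
  proof -
    have "z ^ 3 - 1 = (z - 1) * (z\<^sup>2 + z + 1)" by (simp add: power3_eq_cube power2_eq_square algebra_simps)
    also have "z\<^sup>2 + z + 1 = (z - w) * (z + w + 1) + (w\<^sup>2 + w + 1)" by (simp add: power2_eq_square algebra_simps)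
    also have "\<dots> = (z - w) * (z - w\<^sup>2)" unfolding e sq by (simp add: algebra_simps)
    finally have "z ^ 3 - 1 = (z - 1) * ((z - w) * (z - w\<^sup>2))" .
    then show ?thesis by (metis (no_types, lifting) eq_iff_diff_eq_0 mult_eq_0_iff)
  qed
  ultimately show thesis using that[of w] e w0 w1 by auto
qed

lemma local_square_root:
  assumes "c \<noteq> (0::complex)"
  obtains e r where "e > 0" "continuous_on (ball c e) r" "\<And>w. w \<in> ball c e \<Longrightarrow> r w ^ 2 = w"
proof -
  have "continuous_on (ball c (norm c)) (\<lambda>w. w)" "\<And>w. w \<in> ball c (norm c) \<Longrightarrow> w \<noteq> 0"
    by (auto simp: dist_norm)
  then obtain l where l: "continuous_on (ball c (norm c)) l" "\<And>w. w \<in> ball c (norm c) \<Longrightarrow> w = exp (l w)"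
    using continuous_logarithm_on_ball[of c "norm c" "\<lambda>w. w"] by auto
  show thesis
  proof (rule that[of "norm c" "\<lambda>w. exp (l w / 2)"])
    show "continuous_on (ball c (norm c)) (\<lambda>w. exp (l w / 2))" by (intro continuous_intros l) simp
    show "exp (l w / 2) ^ 2 = w" if "w \<in> ball c (norm c)" for w
      using l(2)[OF that] by (simp flip: exp_double)
  qed (use assms in simp)
qed

context three_fold_branching
begin

text \<open>The fibres of \<open>g\<close> over the three cube roots of unity have equal weight
  because the plane minus 0 is connected, and together they form the fibre of \<open>f\<close> over
  \<open>y2\<close>, whose coordinate is 1.\<close>

lemma cube_root_fibres:
  assumes g: "power_cover X1 (top_of_set (- {0})) g D"
    and h: "homeomorphic_map (subtopology Y (topspace Y - {y3})) (euclidean :: complex topology) h" "h y2 = 1"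
    and gh: "\<forall>x\<in>topspace X - T. g x ^ 3 = h (f x)"
    and w: "w ^ 3 = (1::complex)" "w \<noteq> 1" "w\<^sup>2 \<noteq> 1" "w\<^sup>2 \<noteq> w" "\<And>z. z ^ 3 = 1 \<longleftrightarrow> z = 1 \<or> z = w \<or> z = w\<^sup>2"
    and c: "c ^ 3 = 1"
  shows "fibre X1 g c \<subseteq> fibre X f y2" "finite (fibre X1 g c)"
    "3 * sum D (fibre X1 g c) = sum D (fibre X f y2)"
proof -
  have inj: "inj_on h (topspace Y - {y3})"
    using homeomorphic_imp_injective_map[OF h(1)] by (simp add: Int_absorb1)
  have fX: "f x \<in> topspace Y" if "x \<in> topspace X" for x using cf that by (auto simp: continuous_map_def)
  have sub: "fibre X1 g c \<subseteq> fibre X f y2" if "c ^ 3 = 1" for c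
  proof
    fix x assume x: "x \<in> fibre X1 g c"
    then have xX: "x \<in> topspace X - T" and "g x = c" by (auto simp: fibre_def X1_def)
    then have "h (f x) = h y2" using bspec[OF gh xX] that h(2) by simp
    moreover have "f x \<in> topspace Y - {y3}" using xX fX by (auto simp: T_def fibre_def)
    ultimately have "f x = y2" using inj_on_eq_iff[OF inj, of "f x" y2] y by simp
    then show "x \<in> fibre X f y2" using xX by (simp add: fibre_def)
  qed
  show "fibre X1 g c \<subseteq> fibre X f y2" by (rule sub[OF c])
  have conn: "connected_space (top_of_set (- {0::complex}))"
    using connected_Compl_finite[of "{0}"] connectedin_iff_connected[of "- {0::complex}"]
    unfolding connectedin_def by simp
  have nz: "z \<noteq> 0" if "z ^ 3 = 1" for z :: complex using that by auto
  have const: "sum D (fibre X1 g z) = sum D (fibre X1 g c)" "finite (fibre X1 g z)" if "z ^ 3 = 1" for z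
    using power_cover_weight_constant[OF g conn, of z c] nz[OF that] nz[OF c] by auto
  show "finite (fibre X1 g c)" by (rule const(2)[OF c])
  have w2: "(w\<^sup>2) ^ 3 = 1" using w(5) by blast
  have eq: "fibre X f y2 = fibre X1 g 1 \<union> fibre X1 g w \<union> fibre X1 g (w\<^sup>2)"
  proof
    show "fibre X f y2 \<subseteq> fibre X1 g 1 \<union> fibre X1 g w \<union> fibre X1 g (w\<^sup>2)"
    proof
      fix x assume x: "x \<in> fibre X f y2"
      then have xX: "x \<in> topspace X - T" using y by (auto simp: fibre_def T_def)
      then have "g x ^ 3 = 1" using bspec[OF gh xX] x h(2) by (simp add: fibre_def)
      then have "g x = 1 \<or> g x = w \<or> g x = w\<^sup>2" using w(5) by blast
      then show "x \<in> fibre X1 g 1 \<union> fibre X1 g w \<union> fibre X1 g (w\<^sup>2)"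
        using xX by (auto simp: fibre_def X1_def)
    qed
    show "fibre X1 g 1 \<union> fibre X1 g w \<union> fibre X1 g (w\<^sup>2) \<subseteq> fibre X f y2"
      using sub w(1) w2 by auto
  qed
  have one3: "(1::complex) ^ 3 = 1" by simp
  have disj: "fibre X1 g a \<inter> fibre X1 g b = {}" if "a \<noteq> b" for a b using that by (auto simp: fibre_def)
  have "sum D (fibre X f y2) = sum D (fibre X1 g 1 \<union> fibre X1 g w) + sum D (fibre X1 g (w\<^sup>2))"
    unfolding eq
  proof (rule sum.union_disjoint)
    show "(fibre X1 g 1 \<union> fibre X1 g w) \<inter> fibre X1 g (w\<^sup>2) = {}"
      using disj[OF w(3)] disj[OF w(4)] by blast
  qed (use const(2)[OF one3] const(2)[OF w(1)] const(2)[OF w2] in blast)+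
  also have "sum D (fibre X1 g 1 \<union> fibre X1 g w) = sum D (fibre X1 g 1) + sum D (fibre X1 g w)"
    by (rule sum.union_disjoint[OF const(2)[OF one3] const(2)[OF w(1)] disj[OF w(2)[symmetric]]])
  finally show "3 * sum D (fibre X1 g c) = sum D (fibre X f y2)"
    using const(1)[OF one3] const(1)[OF w(1)] const(1)[OF w2] by simp
qed

lemma degree_one_points:
  assumes odd: "sum D (fibre X f y2) = 3 * n" "odd n"
    and D: "\<And>x. x \<in> fibre X f y2 \<Longrightarrow> D x = 1 \<or> D x = 2"
  shows "card {x \<in> fibre X f y2. D x = 1} \<noteq> 1"
proof
  assume one: "card {x \<in> fibre X f y2. D x = 1} = 1"
  obtain h g where hg: "homeomorphic_map (subtopology Y (topspace Y - {y3})) (euclidean :: complex topology) h"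
    "h y6 = 0" "h y2 = 1" "power_cover X1 (top_of_set (- {0})) g D"
    "\<And>x. x \<in> topspace X - T \<Longrightarrow> g x ^ 3 = h (f x)"
    by (rule cube_root) (rule that)
  obtain w :: complex where w: "w\<^sup>2 + w + 1 = 0" "w \<noteq> 0" "w \<noteq> 1" "w\<^sup>2 \<noteq> 0" "w\<^sup>2 \<noteq> 1" "w\<^sup>2 \<noteq> w" "w ^ 3 = 1"
    "\<And>z. z ^ 3 = 1 \<longleftrightarrow> z = 1 \<or> z = w \<or> z = w\<^sup>2" using primitive_cube_root by blast
  have gh: "\<forall>x\<in>topspace X - T. g x ^ 3 = h (f x)" using hg(5) by blast
  note fib = cube_root_fibres[OF hg(4,1,3) gh w(7,3,5,6,8)]
  \<comment> \<open>A fibre with all local degrees 2 would have even weight, but its weight is the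
    odd number n.\<close>
  have ex: "\<exists>x. x \<in> fibre X1 g c \<and> x \<in> {x \<in> fibre X f y2. D x = 1}" if c: "c ^ 3 = 1" for c
  proof (rule ccontr)
    assume *: "\<not> ?thesis"
    have "D x = 2" if "x \<in> fibre X1 g c" for x using * D fib(1)[OF c] that by blast
    then have "sum D (fibre X1 g c) = 2 * card (fibre X1 g c)" by simp
    moreover have "sum D (fibre X1 g c) = n" using fib(3)[OF c] odd(1) by simp
    ultimately show False using odd(2) by simp
  qed
  obtain x1 where x1: "x1 \<in> fibre X1 g 1" "x1 \<in> {x \<in> fibre X f y2. D x = 1}" using ex[of 1] by auto
  obtain x2 where x2: "x2 \<in> fibre X1 g w" "x2 \<in> {x \<in> fibre X f y2. D x = 1}" using ex[OF w(7)] by auto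
  have "x1 \<noteq> x2" using x1 x2 w by (auto simp: fibre_def)
  then show False using one x1(2) x2(2) by (metis card_1_singletonE singletonD)
qed

end


section \<open>The square root and the divisibility condition of type 5\<close>

context three_fold_branching
begin

text \<open>For punctures at which \<open>q \<circ> g\<close> tends to a nonzero value
  \<open>c\<close>: there a branch of the square root near \<open>c\<close> does. This applies to
  the preimages of \<open>y3\<close> and \<open>y6\<close>, with limits 1 and 1 / w.\<close>

lemma square_root_near:
  assumes g: "\<And>x. x \<in> topspace X - T2 \<Longrightarrow> g x \<in> B" and cg: "continuous_map (subtopology X (topspace X - T2)) euclidean g"
    and U: "openin X U" and c: "c \<noteq> (0::complex)" and q: "continuous_on B q"
    and e: "\<And>e. e > 0 \<Longrightarrow> \<exists>U. openin X U \<and> x \<in> U \<and> (\<forall>z\<in>U - T2. q (g z) \<in> ball c e)"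
  shows "\<exists>U s. openin X U \<and> x \<in> U \<and> continuous_map (subtopology X (U - T2)) euclidean s \<and>
     (\<forall>z\<in>U - T2. s z ^ 2 = q (g z))"
proof -
  obtain e r where r: "e > 0" "continuous_on (ball c e) r" "\<And>w. w \<in> ball c e \<Longrightarrow> r w ^ 2 = w"
    by (rule local_square_root[OF c]) (rule that)
  obtain U where U: "openin X U" "x \<in> U" "\<forall>z\<in>U - T2. q (g z) \<in> ball c e"
    using e[OF r(1)] by blast
  have UX: "U - T2 \<subseteq> topspace X - T2" using openin_subset[OF U(1)] by blast
  have "continuous_map (subtopology X (U - T2)) euclidean g"
    by (rule continuous_map_from_subtopology_mono[OF cg UX])
  then have "continuous_map (subtopology X (U - T2)) (top_of_set B) g"
    by (rule continuous_map_into_subtopology) (use UX g in auto)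
  then have "continuous_map (subtopology X (U - T2)) euclidean (\<lambda>z. q (g z))"
    by (rule continuous_map_compose[where g = q, unfolded o_def]) (use q in simp)
  then have "continuous_map (subtopology X (U - T2)) (top_of_set (ball c e)) (\<lambda>z. q (g z))"
    by (rule continuous_map_into_subtopology) (use U(3) in auto)
  then have "continuous_map (subtopology X (U - T2)) euclidean (\<lambda>z. r (q (g z)))"
    by (rule continuous_map_compose[where g = r, unfolded o_def]) (use r in simp)
  then show ?thesis using U r(3) by (intro exI[of _ U] exI[of _ "\<lambda>z. r (q (g z))"]) auto
qed

lemma four_dvd_degree:
  assumes n: "sum D (fibre X f y2) = 3 * n" and D2: "\<And>x. x \<in> fibre X f y2 \<Longrightarrow> D x = 2"
  shows "4 dvd n"
proof -
  obtain h g where hg: "homeomorphic_map (subtopology Y (topspace Y - {y3})) (euclidean :: complex topology) h"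
    "h y6 = 0" "h y2 = 1" "power_cover X1 (top_of_set (- {0})) g D"
    "\<And>x. x \<in> topspace X - T \<Longrightarrow> g x ^ 3 = h (f x)"
    by (rule cube_root) (rule that)
  have gh: "\<forall>x\<in>topspace X - T. g x ^ 3 = h (f x)" using hg(5) by blast
  obtain w :: complex where w: "w\<^sup>2 + w + 1 = 0" "w \<noteq> 0" "w \<noteq> 1" "w\<^sup>2 \<noteq> 0" "w\<^sup>2 \<noteq> 1" "w\<^sup>2 \<noteq> w" "w ^ 3 = 1"
    "\<And>z. z ^ 3 = 1 \<longleftrightarrow> z = 1 \<or> z = w \<or> z = w\<^sup>2" using primitive_cube_root by blast
  note fib = cube_root_fibres[OF hg(4,1,3) gh w(7,3,5,6,8)]
  have one3: "(1::complex) ^ 3 = 1" by simp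
  have w23: "(w\<^sup>2) ^ 3 = 1" using w(8) by blast
  \<comment> \<open>This Moebius map sends 1, w, infinity, 0 to 0, infinity, 1, 1 / w. Zeros and
    poles of \<open>q \<circ> g\<close> thus lie over 1 and w, where \<open>D\<close> is 2.
    \<open>B0\<close> and \<open>B\<close> are the plane without the exceptional finite values of
    \<open>g\<close> and of \<open>q \<circ> g\<close>.\<close>
  define q where "q z = (z - 1) / (z - w)" for z
  define q' where "q' v = (w * v - 1) / (v - 1)" for v
  define B0 where "B0 = - {0, 1, w}"
  define B where "B = - {0, 1, 1 / w}"
  define T2 where "T2 = T \<union> fibre X1 g 1 \<union> fibre X1 g w"
  have q_nz: "q z \<in> B" if "z \<in> B0" for z
  proof -
    have z: "z \<noteq> 0" "z \<noteq> 1" "z \<noteq> w" using that by (auto simp: B0_def)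
    have "q z \<noteq> 0" "q z \<noteq> 1" using z w by (auto simp: q_def)
    moreover have "q z \<noteq> 1 / w"
    proof
      assume "q z = 1 / w"
      then have "w * (z - 1) = z - w" using z w by (simp add: q_def field_simps)
      then have "z * (w - 1) = 0" by (simp add: algebra_simps)
      then show False using z w by simp
    qed
    ultimately show ?thesis by (simp add: B_def)
  qed
  have q'_nz: "q' v \<in> B0" if "v \<in> B" for v
  proof -
    have v: "v \<noteq> 0" "v \<noteq> 1" "w * v \<noteq> 1" using that w by (auto simp: B_def field_simps)
    have "q' v \<noteq> 0" using v by (simp add: q'_def)
    moreover have "q' v \<noteq> 1"
    proof
      assume "q' v = 1"
      then have "v * (w - 1) = 0" using v by (simp add: q'_def field_simps)
      then show False using v w by simp
    qed
    moreover have "q' v \<noteq> w"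
    proof
      assume "q' v = w"
      then have "w * v - 1 = w * (v - 1)" using v by (simp add: q'_def field_simps)
      then show False using w by (simp add: algebra_simps)
    qed
    ultimately show ?thesis by (simp add: B0_def)
  qed
  have q'q: "q' (q z) = z" if "z \<in> B0" for z
  proof -
    have z: "z - w \<noteq> 0" "w - 1 \<noteq> 0" using that w by (auto simp: B0_def)
    have "w * q z - 1 = z * (w - 1) / (z - w)" "q z - 1 = (w - 1) / (z - w)"
      using z by (auto simp: q_def field_simps)
    then show ?thesis using z by (simp add: q'_def)
  qed
  have qq': "q (q' v) = v" if "v \<in> B" for v
  proof -
    have v: "v - 1 \<noteq> 0" "w - 1 \<noteq> 0" using that w by (auto simp: B_def)
    have "q' v - 1 = v * (w - 1) / (v - 1)" "q' v - w = (w - 1) / (v - 1)"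
      using v by (auto simp: q'_def field_simps)
    then show ?thesis using v by (simp add: q_def)
  qed
  have cq: "continuous_on B0 q" unfolding q_def by (intro continuous_intros) (auto simp: B0_def)
  have cq': "continuous_on B q'" unfolding q'_def by (intro continuous_intros) (auto simp: B_def)
  have "homeomorphic_maps (top_of_set B0) (top_of_set B) q q'"
    unfolding homeomorphic_maps_def using cq cq' q_nz q'_nz q'q qq'
    by (auto intro!: continuous_map_into_subtopology)
  then have hq: "homeomorphic_map (top_of_set B0) (top_of_set B) q" using homeomorphic_maps_map by blast
  have oB0: "open B0" and oB: "open B" unfolding B0_def B_def by (intro open_Compl_finite; simp)+
  have X0: "topspace X - T2 = {x \<in> topspace X1. g x \<in> B0}"
    using hg(4) by (auto simp: T2_def X1_def fibre_def B0_def power_cover_def continuous_map_def)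
  have sX1: "subtopology X1 (topspace X - T2) = subtopology X (topspace X - T2)"
    unfolding X1_def subtopology_subtopology by (rule arg_cong[where f = "subtopology X"]) (auto simp: T2_def)
  have "power_cover (subtopology X1 (topspace X - T2)) (subtopology (top_of_set (- {0})) B0) g D"
    by (rule power_cover_subtopology[OF hg(4) _ X0]) (auto simp: B0_def openin_open_eq open_Compl_finite)
  moreover have "subtopology (top_of_set (- {0})) B0 = top_of_set B0"
    unfolding subtopology_subtopology by (rule arg_cong[where f = "subtopology euclidean"]) (auto simp: B0_def)
  ultimately have pc0: "power_cover (subtopology X (topspace X - T2)) (top_of_set B0) g D"
    unfolding sX1 by simp
  have pc1: "power_cover (subtopology X (topspace X - T2)) (top_of_set B) (\<lambda>x. q (g x)) D"
    by (rule power_cover_homeomorphic_target[OF pc0 hq])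
  have gB0: "g x \<in> B0" if "x \<in> topspace X - T2" for x using that X0 by blast
  have cg: "continuous_map (subtopology X (topspace X - T2)) euclidean g"
    using pc0 by (auto simp: power_cover_def dest: continuous_map_into_fulltopology)
  have ch: "continuous_map (subtopology Y (topspace Y - {y3})) euclidean h"
    using hg(1) by (rule homeomorphic_imp_continuous_map)
  have cl: "closedin Y {z}" if "z \<in> topspace Y" for z
    using sphere_Hausdorff[OF Y] that by (simp add: closedin_Hausdorff_sing_eq)
  have oY3: "openin Y (topspace Y - {y3})" using cl y by auto
  have near0: "\<exists>U. openin X U \<and> x \<in> U \<and> (\<forall>z\<in>U - T2. norm (g z) < d)" if x: "x \<in> fibre X f y6" and d: "d > 0" for x d
  proof -
    have "openin (subtopology Y (topspace Y - {y3})) {y \<in> topspace (subtopology Y (topspace Y - {y3})). h y \<in> ball 0 (d ^ 3)}"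
      by (rule openin_continuous_map_preimage[OF ch]) simp
    then have oV: "openin Y {y \<in> topspace Y - {y3}. h y \<in> ball 0 (d ^ 3)}"
      using oY3 by (simp add: openin_open_subtopology Int_absorb1)
    let ?U = "{z \<in> topspace X. f z \<in> {y \<in> topspace Y - {y3}. h y \<in> ball 0 (d ^ 3)}}"
    have "openin X ?U" by (rule openin_continuous_map_preimage[OF cf oV])
    moreover have "x \<in> ?U" using x y hg(2) d by (auto simp: fibre_def)
    moreover have "norm (g z) < d" if z: "z \<in> ?U - T2" for z
    proof -
      have "z \<in> topspace X - T" using z by (auto simp: T2_def)
      then have "norm (g z) ^ 3 < d ^ 3" using z hg(5)[of z] by (simp flip: norm_power)
      then show ?thesis using d by (meson less_imp_le power_less_imp_less_base)
    qed
    ultimately show ?thesis by blast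
  qed
  have nearinf: "\<exists>U. openin X U \<and> x \<in> U \<and> (\<forall>z\<in>U - T2. norm (g z) > d)" if x: "x \<in> fibre X f y3" and d: "d > 0" for x d
  proof -
    obtain h' where h': "homeomorphic_maps (subtopology Y (topspace Y - {y3})) (euclidean :: complex topology) h h'"
      using hg(1) homeomorphic_map_maps by blast
    have ch': "continuous_map euclidean Y h'"
      using h' continuous_map_into_fulltopology by (auto simp: homeomorphic_maps_def)
    \<comment> \<open>A compact set that avoids \<open>y3\<close>; outside it |h| exceeds d ^ 3, so
      |g| exceeds d.\<close>
    let ?K = "h' ` cball 0 (d ^ 3)"
    have "compactin Y ?K" by (rule image_compactin[OF _ ch']) simp
    then have "closedin Y ?K" by (rule compactin_imp_closedin[OF sphere_Hausdorff[OF Y]])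
    then have oV: "openin Y (topspace Y - ?K)" by auto
    let ?U = "{z \<in> topspace X. f z \<in> topspace Y - ?K}"
    have "openin X ?U" by (rule openin_continuous_map_preimage[OF cf oV])
    moreover have "y3 \<notin> ?K" using h' by (auto simp: homeomorphic_maps_def continuous_map_def)
    then have "x \<in> ?U" using x y by (auto simp: fibre_def)
    moreover have "norm (g z) > d" if z: "z \<in> ?U - T2" for z
    proof -
      have zT: "z \<in> topspace X - T" using z by (auto simp: T2_def)
      then have "f z \<in> topspace Y - {y3}" using cf by (auto simp: T_def fibre_def continuous_map_def)
      then have "h' (h (f z)) = f z" using h' by (simp add: homeomorphic_maps_def)
      then have "h (f z) \<notin> cball 0 (d ^ 3)" using z by (metis DiffD1 DiffD2 imageI mem_Collect_eq)
      then have "d ^ 3 < norm (g z) ^ 3" using hg(5)[OF zT] by (simp flip: norm_power)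
      then show ?thesis by (meson norm_ge_zero power_less_imp_less_base)
    qed
    ultimately show ?thesis by blast
  qed
  have T2_fin: "finite T2" using T_finite fib(2)[OF one3] fib(2)[OF w(7)] by (simp add: T2_def)
  have T2_sub: "T2 \<subseteq> topspace X" using T_sub by (auto simp: T2_def fibre_def X1_def)
  have T2_ne: "T2 \<noteq> {}" using T_ne by (auto simp: T2_def)
  obtain s where s: "continuous_map (subtopology X (topspace X - T2)) euclidean s"
    "\<And>z. z \<in> topspace X - T2 \<Longrightarrow> s z ^ 2 = q (g z)"
  proof (rule sphere_root[OF X T2_fin T2_sub T2_ne, of 2 "\<lambda>x. q (g x)"])
    show "continuous_map (subtopology X (topspace X - T2)) euclidean (\<lambda>x. q (g x))"
      using pc1 continuous_map_into_fulltopology by (auto simp: power_cover_def)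
    show "q (g z) \<noteq> 0" if "z \<in> topspace X - T2" for z
      using q_nz[OF gB0[OF that]] by (auto simp: B_def)
    fix x assume x: "x \<in> T2"
    then consider "x \<in> fibre X f y3" | "x \<in> fibre X f y6" | c where "c = 1 \<or> c = w" "x \<in> fibre X1 g c"
      by (auto simp: T2_def T_def)
    then show "\<exists>U s. openin X U \<and> x \<in> U \<and> continuous_map (subtopology X (U - T2)) euclidean s \<and>
        (\<forall>z\<in>U - T2. s z ^ 2 = q (g z))"
    proof cases
      case 1
      show ?thesis
      proof (rule square_root_near[OF gB0 cg openin_topspace _ cq])
        show "(1::complex) \<noteq> 0" by simp
        fix e :: real assume e: "e > 0"
        \<comment> \<open>Chosen so that |v| > d gives |v - w| > |w - 1| / e, whence |1 - q v| = |w
          - 1| / |v - w| < e.\<close>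
        define d where "d = norm w + norm (w - 1) / e + 1"
        have "d > 0" using e by (simp add: d_def add_nonneg_pos)
        then obtain U where U: "openin X U" "x \<in> U" "\<forall>z\<in>U - T2. norm (g z) > d" using nearinf[OF 1] by blast
        have "q v \<in> ball 1 e" if v: "norm v > d" for v
        proof -
          have "norm (v - w) \<ge> norm v - norm w" by (rule norm_triangle_ineq2)
          then have *: "norm (v - w) > norm (w - 1) / e" using v by (simp add: d_def)
          moreover have "norm (w - 1) / e \<ge> 0" using e by simp
          ultimately have "norm (v - w) > 0" by linarith
          then have "v \<noteq> w" by auto
          then have "1 - q v = (1 - w) / (v - w)" by (simp add: q_def field_simps)
          then have "dist 1 (q v) = norm (w - 1) / norm (v - w)"
            by (simp add: dist_norm norm_divide norm_minus_commute)
          also have "\<dots> < e" using * e \<open>norm (v - w) > 0\<close> by (simp add: field_simps)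
          finally show ?thesis by simp
        qed
        then show "\<exists>U. openin X U \<and> x \<in> U \<and> (\<forall>z\<in>U - T2. q (g z) \<in> ball 1 e)" using U by blast
      qed
    next
      case 2
      show ?thesis
      proof (rule square_root_near[OF gB0 cg openin_topspace _ cq])
        show "1 / w \<noteq> 0" using w by simp
        fix e :: real assume e: "e > 0"
        have "continuous_on (- {w}) q" unfolding q_def by (intro continuous_intros) auto
        moreover have "open (- {w})" by (rule open_Compl_finite) simp
        moreover have "0 \<in> - {w}" using w by simp
        ultimately have "isCont q 0" by (simp add: continuous_on_eq_continuous_at)
        then obtain d where d: "d > 0" "\<And>v. dist v 0 < d \<Longrightarrow> dist (q v) (q 0) < e"
          using e by (auto simp: continuous_at_eps_delta)
        obtain U where U: "openin X U" "x \<in> U" "\<forall>z\<in>U - T2. norm (g z) < d" using near0[OF 2 d(1)] by blast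
        have "q 0 = 1 / w" by (simp add: q_def)
        then have "q v \<in> ball (1 / w) e" if "norm v < d" for v using d(2)[of v] that by (simp add: dist_commute)
        then show "\<exists>U. openin X U \<and> x \<in> U \<and> (\<forall>z\<in>U - T2. q (g z) \<in> ball (1 / w) e)" using U by blast
      qed
    next
      case 3
      have xX1: "x \<in> topspace X1" and gx: "g x = c" using 3 by (auto simp: fibre_def)
      have "c ^ 3 = 1" using 3 w(7) by auto
      then have "D x = 2" using fib(1) D2 3(2) by blast
      then have lpx: "locally_power X1 (top_of_set (- {0})) g x 2"
        using hg(4) xX1 by (auto simp: power_cover_def)
      \<comment> \<open>Of the excluded values 0, 1, w only \<open>c\<close> is put back, so that
        \<open>q\<close> is finite and nonzero on \<open>V0\<close> without
        \<open>c\<close>.\<close>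
      define V0 where "V0 = B0 \<union> {c}"
      have V0eq: "V0 = - ({0, 1, w} - {c})" using 3(1) w by (auto simp: V0_def B0_def)
      have V0d: "V0 - {g x} = B0" using 3(1) gx by (auto simp: V0_def B0_def)
      have "open V0" unfolding V0eq by (rule open_Compl_finite) simp
      then have oV0: "openin (top_of_set (- {0})) V0"
        using 3(1) w by (auto simp: openin_open_eq open_Compl_finite V0_def B0_def)
      have gV0: "g x \<in> V0" using gx by (simp add: V0_def)
      obtain U s where U: "openin X1 U" "x \<in> U" "continuous_map (subtopology X1 (U - {x})) euclidean s"
        "\<And>z. z \<in> U - {x} \<Longrightarrow> s z ^ 2 = q (g z)"
      proof (rule locally_power_local_root[OF lpx _ oV0 gV0, of 2 q])
        show "continuous_map (subtopology (top_of_set (- {0})) (V0 - {g x})) euclidean q"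
          unfolding V0d subtopology_subtopology
          by (rule continuous_map_from_subtopology_mono[of _ B0]) (use cq in auto)
        show "q v \<noteq> 0" if "v \<in> V0 - {g x}" for v using that q_nz unfolding V0d by (auto simp: B_def)
      qed (use that in auto)
      have oX1: "openin X (topspace X - T)"
        using T_finite T_sub sphere_Hausdorff[OF X] by (simp add: closedin_Hausdorff_finite openin_diff)
      then have oU: "openin X U" "U \<subseteq> topspace X - T" using U(1) by (auto simp: X1_def openin_open_subtopology)
      have "subtopology X1 (U - {x}) = subtopology X (U - {x})"
        unfolding X1_def subtopology_subtopology by (rule arg_cong[where f = "subtopology X"]) (use oU in auto)
      then have "continuous_map (subtopology X (U - {x})) euclidean s" using U(3) by simp
      then have "continuous_map (subtopology X (U - T2)) euclidean s"
        by (rule continuous_map_from_subtopology_mono) (use x in auto)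
      then show ?thesis using U(2,4) oU(1) x by (intro exI[of _ U] exI[of _ s]) auto
    qed
  qed (use that in auto)
  define A where "A = {v. v\<^sup>2 \<in> B}"
  have pcs: "power_cover (subtopology X (topspace X - T2)) (top_of_set A) s D"
    unfolding A_def by (rule power_cover_root[OF oB _ _ pc1]) (use s in \<open>auto simp: B_def\<close>)
  have "A = - ({v. v\<^sup>2 = 0} \<union> {v. v\<^sup>2 = 1} \<union> {v. v\<^sup>2 = 1 / w})" by (auto simp: A_def B_def)
  moreover have "finite {v::complex. v\<^sup>2 = z}" for z by (rule finite_nth_roots) simp
  ultimately have "connected A" by (simp only: connected_Compl_finite finite_Un simp_thms)
  then have conn: "connected_space (top_of_set A)"
    using connectedin_iff_connected[of A] unfolding connectedin_def by simp
  \<comment> \<open>The fibre of \<open>g\<close> over the third cube root of unity w^2 splits into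
    the fibres of \<open>s\<close> over the two square roots of q (w^2); they have equal weight
    because \<open>A\<close> is connected.\<close>
  define s0 where "s0 = csqrt (q (w\<^sup>2))"
  have w2B: "w\<^sup>2 \<in> B0" using w by (simp add: B0_def)
  have s0: "s0\<^sup>2 = q (w\<^sup>2)" by (simp add: s0_def)
  have "s0\<^sup>2 \<in> B" unfolding s0 by (rule q_nz[OF w2B])
  then have s0A: "s0 \<in> A" "- s0 \<in> A" and s00: "s0 \<noteq> - s0" by (auto simp: A_def B_def)
  let ?F = "\<lambda>v. fibre (subtopology X (topspace X - T2)) s v"
  have eq: "fibre X1 g (w\<^sup>2) = ?F s0 \<union> ?F (- s0)"
  proof (intro equalityI subsetI)
    fix x assume x: "x \<in> fibre X1 g (w\<^sup>2)"
    then have xX: "x \<in> topspace X - T2" unfolding X0 using w2B by (simp add: fibre_def)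
    have "(s x)\<^sup>2 = s0\<^sup>2" using s(2)[OF xX] x s0 by (simp add: fibre_def)
    then have "s x = s0 \<or> s x = - s0" by (simp add: power2_eq_iff)
    then show "x \<in> ?F s0 \<union> ?F (- s0)" using xX by (auto simp: fibre_def)
  next
    fix x assume "x \<in> ?F s0 \<union> ?F (- s0)"
    then have xX: "x \<in> topspace X - T2" and "(s x)\<^sup>2 = s0\<^sup>2" by (auto simp: fibre_def)
    then have "q (g x) = q (w\<^sup>2)" using s(2)[OF xX] s0 by simp
    then have "g x = w\<^sup>2" using q'q[OF gB0[OF xX]] q'q[OF w2B] by metis
    moreover have "x \<in> topspace X1" using xX X0 by blast
    ultimately show "x \<in> fibre X1 g (w\<^sup>2)" by (simp add: fibre_def)
  qed
  have const: "sum D (?F s0) = sum D (?F (- s0))" "finite (?F s0)" "finite (?F (- s0))"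
    using power_cover_weight_constant[OF pcs conn, of s0 "- s0"]
      power_cover_weight_constant[OF pcs conn, of "- s0" "s0"] s0A by auto
  have "sum D (fibre X1 g (w\<^sup>2)) = sum D (?F s0) + sum D (?F (- s0))"
    unfolding eq using const s00 by (intro sum.union_disjoint) (auto simp: fibre_def[of _ s])
  also have "\<dots> = 2 * sum D (?F s0)" using const by simp
  also have "sum D (?F s0) = (\<Sum>x\<in>?F s0. 2)"
  proof (rule sum.cong[OF refl])
    fix x assume "x \<in> ?F s0"
    then have "x \<in> fibre X1 g (w\<^sup>2)" using eq by blast
    then show "D x = 2" using fib(1)[OF w23] D2 by blast
  qed
  finally have "sum D (fibre X1 g (w\<^sup>2)) = 4 * card (?F s0)" by simp
  moreover have "sum D (fibre X1 g (w\<^sup>2)) = n" using fib(3)[OF w23] n by simp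
  ultimately show ?thesis by simp
qed

end

section \<open>Consequences for types 4 and 5\<close>

lemma not_realizable_4:
  assumes X: "X homeomorphic_space S2" and Y: "Y homeomorphic_space S2"
  shows "\<not> realizable X Y (6 * k + 9) (partitions_4 k)"
proof
  let ?A = "replicate_mset (3*k + 4) 2 + {#1#} :: nat multiset"
  let ?B = "replicate_mset (2*k + 3) 3 :: nat multiset"
  let ?C = "replicate_mset k 6 + {#3, 3, 3#} :: nat multiset"
  assume "realizable X Y (6 * k + 9) (partitions_4 k)"
  then have r: "realizable X Y (6 * k + 9) {#?A, ?B, ?C#}" unfolding partitions_4_def .
  obtain f a b c where f: "branched_cover X Y f" "a \<noteq> b" "a \<noteq> c" "b \<noteq> c"
    "a \<in> topspace Y" "b \<in> topspace Y" "c \<in> topspace Y"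
    "local_degrees X Y f a = ?A" "local_degrees X Y f b = ?B" "local_degrees X Y f c = ?C"
    by (rule realizable_threeE[OF r]) (rule that)
  have "size ?A \<noteq> 0" "size ?B \<noteq> 0" "size ?C \<noteq> 0" by simp_all
  then have ne: "?A \<noteq> {#}" "?B \<noteq> {#}" "?C \<noteq> {#}" by (metis size_empty)+
  note A = local_degrees_fibre[OF f(8) ne(1)]
  note B = local_degrees_fibre[OF f(9) ne(2)]
  note C = local_degrees_fibre[OF f(10) ne(3)]
  interpret three_fold_branching X Y f a b c
  proof
    show "3 dvd local_degree X Y f x" if "x \<in> fibre X f b \<union> fibre X f c" for x
      using that B(3)[of x] C(3)[of x] by (auto split: if_splits)
  qed (use X Y f B C in auto)
  have "sum D (fibre X f a) = 3 * (2 * k + 3)" unfolding A(4) by simp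
  moreover have "odd (2 * k + 3)" by simp
  moreover have "D x = 1 \<or> D x = 2" if "x \<in> fibre X f a" for x
    using A(3)[OF that] by (auto split: if_splits)
  ultimately have "card {x \<in> fibre X f a. D x = 1} \<noteq> 1" by (rule degree_one_points)
  then show False unfolding A(5) by simp
qed

lemma realizable_5_dvd:
  assumes X: "X homeomorphic_space S2" and Y: "Y homeomorphic_space S2"
    and r: "realizable X Y (6 * k + 12) (partitions_5 k)"
  shows "12 dvd 6 * k + 12"
proof -
  let ?A = "replicate_mset (3*k + 6) 2 :: nat multiset"
  let ?B = "replicate_mset (2*k + 4) 3 :: nat multiset"
  let ?C = "replicate_mset k 6 + {#3, 3, 3, 3#} :: nat multiset"
  have r': "realizable X Y (6 * k + 12) {#?A, ?B, ?C#}" using r unfolding partitions_5_def .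
  obtain f a b c where f: "branched_cover X Y f" "a \<noteq> b" "a \<noteq> c" "b \<noteq> c"
    "a \<in> topspace Y" "b \<in> topspace Y" "c \<in> topspace Y"
    "local_degrees X Y f a = ?A" "local_degrees X Y f b = ?B" "local_degrees X Y f c = ?C"
    by (rule realizable_threeE[OF r']) (rule that)
  have "size ?A \<noteq> 0" "size ?B \<noteq> 0" "size ?C \<noteq> 0" by simp_all
  then have ne: "?A \<noteq> {#}" "?B \<noteq> {#}" "?C \<noteq> {#}" by (metis size_empty)+
  note A = local_degrees_fibre[OF f(8) ne(1)]
  note B = local_degrees_fibre[OF f(9) ne(2)]
  note C = local_degrees_fibre[OF f(10) ne(3)]
  interpret three_fold_branching X Y f a b c
  proof
    show "3 dvd local_degree X Y f x" if "x \<in> fibre X f b \<union> fibre X f c" for x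
      using that B(3)[of x] C(3)[of x] by (auto split: if_splits)
  qed (use X Y f B C in auto)
  have "sum D (fibre X f a) = 3 * (2 * k + 4)" unfolding A(4) by simp
  moreover have "D x = 2" if "x \<in> fibre X f a" for x
    using A(3)[OF that] by (auto split: if_splits)
  ultimately have "4 dvd 2 * k + 4" by (rule four_dvd_degree)
  then have "3 * 4 dvd 3 * (2 * k + 4)" by (rule mult_dvd_mono[OF dvd_refl])
  then show ?thesis by (simp add: algebra_simps)
qed


section \<open>Quotients of the plane\<close>

text \<open>The compact piece of Cayley's cubic surface. Every ray from the origin meets it exactly once,
so that normalizing turns it into a round sphere.\<close>

definition on_cayley_pillow :: "real \<Rightarrow> real \<Rightarrow> real \<Rightarrow> bool" where
  "on_cayley_pillow a b c \<longleftrightarrow> \<bar>a\<bar> \<le> 1 \<and> \<bar>b\<bar> \<le> 1 \<and> \<bar>c\<bar> \<le> 1 \<and> 1 + 2 * (a * b * c) = a\<^sup>2 + b\<^sup>2 + c\<^sup>2"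

text \<open>Cayley's equation can be written (c - a * b)^2 = (1 - a^2) * (1 - b^2), and here c - a *
  b is sin x * sin y.\<close>

lemma cayley_cos: "on_cayley_pillow (cos x) (cos y) (cos (x - y))"
proof -
  have "(sin x)\<^sup>2 = 1 - (cos x)\<^sup>2" "(sin y)\<^sup>2 = 1 - (cos y)\<^sup>2" by (simp_all add: sin_squared_eq)
  then have "(sin x * sin y)\<^sup>2 = (1 - (cos x)\<^sup>2) * (1 - (cos y)\<^sup>2)" by (simp add: power_mult_distrib)
  moreover have "1 + 2 * (a * b * (a * b + r)) = a\<^sup>2 + b\<^sup>2 + (a * b + r)\<^sup>2"
    if "r\<^sup>2 = (1 - a\<^sup>2) * (1 - b\<^sup>2)" for a b r :: real
    using that by (simp add: power2_eq_square algebra_simps)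
  ultimately have "1 + 2 * (cos x * cos y * cos (x - y)) = (cos x)\<^sup>2 + (cos y)\<^sup>2 + (cos (x - y))\<^sup>2"
    unfolding cos_diff by blast
  then show ?thesis by (simp add: on_cayley_pillow_def)
qed

text \<open>With P = a * b * c, comparing the equations at the scales 1 and t and cancelling 1 - t
  gives 1 + t = 2 * t^2 * P. Since P \<le> 1 in the cube, the right side is less than 2 * t, which
  is impossible for t < 1.\<close>

lemma cayley_ray_unique_aux:
  assumes p: "on_cayley_pillow a b c" and q: "on_cayley_pillow (t * a) (t * b) (t * c)" and t: "0 < t" "t < 1"
  shows False
proof -
  define P where "P = a * b * c"
  have "\<bar>P\<bar> \<le> 1 * 1 * 1"
    unfolding P_def abs_mult using p by (intro mult_mono) (auto simp: on_cayley_pillow_def)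
  then have P: "P \<le> 1" by simp
  have 1: "1 + 2 * P = a\<^sup>2 + b\<^sup>2 + c\<^sup>2" using p by (simp add: on_cayley_pillow_def P_def)
  have "1 + 2 * (t ^ 3 * P) = t\<^sup>2 * (a\<^sup>2 + b\<^sup>2 + c\<^sup>2)"
    using q by (simp add: on_cayley_pillow_def P_def power2_eq_square power3_eq_cube algebra_simps)
  then have "1 + 2 * (t ^ 3 * P) = t\<^sup>2 * (1 + 2 * P)" using 1 by simp
  then have "(1 - t) * (1 + t - 2 * (t\<^sup>2 * P)) = 0"
    by (simp add: power2_eq_square power3_eq_cube algebra_simps)
  then have "1 + t = 2 * (t\<^sup>2 * P)" using t by simp
  also have "\<dots> \<le> 2 * (t\<^sup>2 * 1)" using P by (intro mult_left_mono) auto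
  also have "\<dots> < 2 * t" using t by (simp add: power2_eq_square)
  finally show False using t by simp
qed

lemma cayley_ray_unique:
  assumes p: "on_cayley_pillow a b c" and q: "on_cayley_pillow (t * a) (t * b) (t * c)" and t: "0 < t"
  shows "t = 1"
proof (rule ccontr)
  assume "t \<noteq> 1"
  then consider "t < 1" | "t > 1" by linarith
  then show False
  proof cases
    case 1
    then show False by (rule cayley_ray_unique_aux[OF p q t])
  next
    case 2
    then have "0 < 1 / t" "1 / t < 1" by simp_all
    moreover have "on_cayley_pillow (1 / t * (t * a)) (1 / t * (t * b)) (1 / t * (t * c))" using p t by simp
    ultimately show False using cayley_ray_unique_aux[OF q] by blast
  qed
qed

text \<open>Intermediate values along the ray: the difference of the two sides of the equation is 1
  at the origin and nonpositive where the ray leaves the cube, because on a face with x = 1 or x =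
  -1 it equals -(x * y - z)^2.\<close>

lemma cayley_ray_exists:
  assumes "(a, b, c) \<noteq> (0, 0, 0::real)"
  obtains t where "t > 0" "on_cayley_pillow (t * a) (t * b) (t * c)"
proof -
  define M where "M = max \<bar>a\<bar> (max \<bar>b\<bar> \<bar>c\<bar>)"
  have M: "M > 0" "\<bar>a\<bar> \<le> M" "\<bar>b\<bar> \<le> M" "\<bar>c\<bar> \<le> M" using assms by (auto simp: M_def)
  have M_in: "M = \<bar>a\<bar> \<or> M = \<bar>b\<bar> \<or> M = \<bar>c\<bar>" by (auto simp: M_def max_def)
  define g where "g t = 1 + 2 * ((t * a) * (t * b) * (t * c)) - (t * a)\<^sup>2 - (t * b)\<^sup>2 - (t * c)\<^sup>2" for t
  have key: "1 + 2 * (x * y * z) - x\<^sup>2 - y\<^sup>2 - z\<^sup>2 \<le> 0" if "\<bar>x\<bar> = 1" for x y z :: real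
  proof -
    have "x\<^sup>2 = 1" using that by (metis power2_abs one_power2)
    then have "1 + 2 * (x * y * z) - x\<^sup>2 - y\<^sup>2 - z\<^sup>2 = - ((x * y - z)\<^sup>2) + (x\<^sup>2 - 1) * y\<^sup>2 + (1 - x\<^sup>2)"
      by (simp add: power2_eq_square algebra_simps)
    also have "\<dots> = - ((x * y - z)\<^sup>2)" using \<open>x\<^sup>2 = 1\<close> by simp
    finally show ?thesis by simp
  qed
  define u where "u = 1 / M"
  have u: "u > 0" "u * M = 1" using M by (simp_all add: u_def)
  have abs1: "\<bar>u * x\<bar> = 1" if "M = \<bar>x\<bar>" for x using u that by (simp add: abs_mult)
  have "g u \<le> 0"
    using M_in
  proof (elim disjE)
    assume "M = \<bar>a\<bar>"
    then show ?thesis using key[where x = "u * a" and y = "u * b" and z = "u * c"] abs1 by (simp add: g_def)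
  next
    assume "M = \<bar>b\<bar>"
    then have "1 + 2 * ((u * b) * (u * a) * (u * c)) - (u * b)\<^sup>2 - (u * a)\<^sup>2 - (u * c)\<^sup>2 \<le> 0"
      by (intro key abs1)
    then show ?thesis unfolding g_def by (simp add: mult.commute[of "u * b" "u * a"])
  next
    assume "M = \<bar>c\<bar>"
    then have "1 + 2 * ((u * c) * (u * a) * (u * b)) - (u * c)\<^sup>2 - (u * a)\<^sup>2 - (u * b)\<^sup>2 \<le> 0"
      by (intro key abs1)
    moreover have "(u * c) * (u * a) * (u * b) = (u * a) * (u * b) * (u * c)" by (simp only: ac_simps)
    ultimately show ?thesis unfolding g_def by simp
  qed
  moreover have "g 0 = 1" by (simp add: g_def)
  moreover have "continuous_on {0..u} g" unfolding g_def by (intro continuous_intros)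
  ultimately obtain t where t: "0 \<le> t" "t \<le> u" "g t = 0" using IVT2'[of g u 0 0] u by auto
  have "t \<noteq> 0" using t(3) \<open>g 0 = 1\<close> by auto
  have "\<bar>t * x\<bar> \<le> 1" if "\<bar>x\<bar> \<le> M" for x
  proof -
    have "\<bar>t * x\<bar> \<le> u * M" unfolding abs_mult using t that M by (intro mult_mono) auto
    then show ?thesis using u by simp
  qed
  then have "on_cayley_pillow (t * a) (t * b) (t * c)" using M t(3) by (simp add: on_cayley_pillow_def g_def)
  moreover have "t > 0" using t(1) \<open>t \<noteq> 0\<close> by simp
  ultimately show thesis using that by blast
qed

text \<open>The equation determines c - a * b up to sign as sin x * sin y, and the sign is adjusted
  by replacing y with - y.\<close>

lemma cayley_parametrization:
  assumes "on_cayley_pillow a b c"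
  obtains x y where "a = cos x" "b = cos y" "c = cos (x - y)"
proof -
  have ab: "-1 \<le> a" "a \<le> 1" "-1 \<le> b" "b \<le> 1" using assms by (auto simp: on_cayley_pillow_def)
  define x y where "x = arccos a" and "y = arccos b"
  have c: "cos x = a" "cos y = b" using ab by (auto simp: x_def y_def)
  have "(c - a * b)\<^sup>2 = (1 - a\<^sup>2) * (1 - b\<^sup>2)"
    using assms by (simp add: on_cayley_pillow_def power2_eq_square algebra_simps)
  also have "\<dots> = (sin x * sin y)\<^sup>2" by (simp add: power_mult_distrib sin_squared_eq c)
  finally have "c - a * b = sin x * sin y \<or> c - a * b = - (sin x * sin y)" by (simp add: power2_eq_iff)
  then show thesis
  proof
    assume "c - a * b = sin x * sin y"
    then show thesis using c by (intro that[of x y]) (auto simp: cos_diff)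
  next
    assume "c - a * b = - (sin x * sin y)"
    then show thesis using c by (intro that[of x "- y"]) (auto simp: cos_add)
  qed
qed

section \<open>Separating points by three cosines\<close>

lemma cos_2pi_eq_iff:
  "cos (2 * pi * s) = cos (2 * pi * t) \<longleftrightarrow> s - t \<in> \<int> \<or> s + t \<in> (\<int> :: real set)"
proof -
  have "cos (2 * pi * s) = cos (2 * pi * t) \<longleftrightarrow>
     (\<exists>n\<in>\<int>. 2 * pi * s = 2 * pi * t + 2 * n * pi \<or> 2 * pi * s = - (2 * pi * t) + 2 * n * pi)"
    by (rule cos_eq)
  also have "\<dots> \<longleftrightarrow> (\<exists>n\<in>\<int>. s = t + n \<or> s = - t + n)"
  proof (rule bex_cong[OF refl])
    fix n :: real
    have "2 * pi * s = 2 * pi * t + 2 * n * pi \<longleftrightarrow> 2 * pi * s = 2 * pi * (t + n)" by (simp add: algebra_simps)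
    moreover have "2 * pi * s = - (2 * pi * t) + 2 * n * pi \<longleftrightarrow> 2 * pi * s = 2 * pi * (- t + n)"
      by (simp add: algebra_simps)
    ultimately show "(2 * pi * s = 2 * pi * t + 2 * n * pi \<or> 2 * pi * s = - (2 * pi * t) + 2 * n * pi) \<longleftrightarrow>
        (s = t + n \<or> s = - t + n)" by simp
  qed
  also have "\<dots> \<longleftrightarrow> s - t \<in> \<int> \<or> s + t \<in> \<int>"
    by (metis add.commute add_diff_cancel_left' diff_add_cancel diff_minus_eq_add uminus_add_conv_diff)
  finally show ?thesis .
qed

text \<open>Lying in one orbit of the group generated by integer translations and the point
  reflection in the origin: one sign has to serve both coordinates.\<close>

definition sign_eq :: "real \<Rightarrow> real \<Rightarrow> real \<Rightarrow> real \<Rightarrow> bool" where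
  "sign_eq s t s' t' \<longleftrightarrow> s' - s \<in> \<int> \<and> t' - t \<in> \<int> \<or> s' + s \<in> \<int> \<and> t' + t \<in> \<int>"

lemma Ints_half_sum:
  assumes "u - v \<in> \<int>" "u + v \<in> (\<int>::real set)" shows "2 * u \<in> \<int>" "2 * v \<in> \<int>"
  using Ints_add[OF assms] Ints_diff[OF assms(2,1)] by simp_all

text \<open>The first two cosines determine s and t modulo integers up to independent signs. If the
  signs differ, the third cosine forces 2 * s or 2 * t to be an integer, and then the sign of that
  coordinate is immaterial.\<close>

lemma cayley_eq_iff:
  "cos (2 * pi * s) = cos (2 * pi * s') \<and> cos (2 * pi * t) = cos (2 * pi * t') \<and> cos (2 * pi * (s - t)) = cos (2 * pi * (s' - t'))
    \<longleftrightarrow> sign_eq s t s' t'"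
proof
  assume "sign_eq s t s' t'"
  then consider "s' - s \<in> \<int>" "t' - t \<in> \<int>" | "s' + s \<in> \<int>" "t' + t \<in> \<int>" by (auto simp: sign_eq_def)
  then show "cos (2 * pi * s) = cos (2 * pi * s') \<and> cos (2 * pi * t) = cos (2 * pi * t') \<and> cos (2 * pi * (s - t)) = cos (2 * pi * (s' - t'))"
  proof cases
    case 1
    have "(s - t) - (s' - t') = (t' - t) - (s' - s)" by simp
    also have "\<dots> \<in> \<int>" by (rule Ints_diff[OF 1(2,1)])
    finally show ?thesis unfolding cos_2pi_eq_iff using 1 by (metis Ints_minus minus_diff_eq)
  next
    case 2
    have "(s - t) + (s' - t') = (s' + s) - (t' + t)" by simp
    also have "\<dots> \<in> \<int>" by (rule Ints_diff[OF 2])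
    finally show ?thesis unfolding cos_2pi_eq_iff using 2 by (metis add.commute)
  qed
next
  assume A: "cos (2 * pi * s) = cos (2 * pi * s') \<and> cos (2 * pi * t) = cos (2 * pi * t') \<and> cos (2 * pi * (s - t)) = cos (2 * pi * (s' - t'))"
  then have e: "s - s' \<in> \<int> \<or> s + s' \<in> \<int>" "t - t' \<in> \<int> \<or> t + t' \<in> \<int>"
    "(s - t) - (s' - t') \<in> \<int> \<or> (s - t) + (s' - t') \<in> \<int>"
    unfolding cos_2pi_eq_iff by auto
  have sw: "u - v \<in> \<int> \<longleftrightarrow> v - u \<in> \<int>" "u + v \<in> \<int> \<longleftrightarrow> v + u \<in> \<int>" for u v :: real
    using Ints_minus[of "u - v"] Ints_minus[of "v - u"] by (auto simp: add.commute[of u v])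
  have int2: "v - u \<in> \<int> \<longleftrightarrow> v + u \<in> \<int>" if "2 * u \<in> \<int>" for u v :: real
  proof
    assume "v - u \<in> \<int>" from Ints_add[OF this that] show "v + u \<in> \<int>" by (simp add: algebra_simps)
  next
    assume "v + u \<in> \<int>" from Ints_diff[OF this that] show "v - u \<in> \<int>" by (simp add: algebra_simps)
  qed
  have mixed: "2 * u \<in> \<int> \<or> 2 * v \<in> \<int>"
    if m: "u - u' \<in> \<int>" "v + v' \<in> \<int>" "(u - v) - (u' - v') \<in> \<int> \<or> (u - v) + (u' - v') \<in> \<int>" for u u' v v' :: real
    using m(3)
  proof
    assume "(u - v) - (u' - v') \<in> \<int>"
    from Ints_diff[OF m(1) this] have "v - v' \<in> \<int>" by (simp add: algebra_simps)
    then show ?thesis using Ints_half_sum[of v v'] m(2) by blast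
  next
    assume "(u - v) + (u' - v') \<in> \<int>"
    from Ints_add[OF this m(2)] have "u + u' \<in> \<int>" by (simp add: algebra_simps)
    then show ?thesis using Ints_half_sum[of u u'] m(1) by blast
  qed
  consider "s - s' \<in> \<int>" "t - t' \<in> \<int>" | "s + s' \<in> \<int>" "t + t' \<in> \<int>"
    | "s - s' \<in> \<int>" "t + t' \<in> \<int>" | "s + s' \<in> \<int>" "t - t' \<in> \<int>" using e by blast
  then show "sign_eq s t s' t'"
  proof cases
    case 1
    then show ?thesis unfolding sign_eq_def using sw by blast
  next
    case 2
    then show ?thesis unfolding sign_eq_def using sw by blast
  next
    case 3
    from mixed[OF 3 e(3)] show ?thesis
    proof
      assume "2 * s \<in> \<int>"
      then have "s' + s \<in> \<int>" using int2[of s s'] 3 sw by blast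
      then show ?thesis unfolding sign_eq_def using 3 sw by blast
    next
      assume "2 * t \<in> \<int>"
      then have "t' - t \<in> \<int>" using int2[of t t'] 3 sw by blast
      then show ?thesis unfolding sign_eq_def using 3 sw by blast
    qed
  next
    case 4
    \<comment> \<open>The other mixed case is reduced to \<open>mixed\<close> by exchanging s and
      t.\<close>
    have "(t - s) - (t' - s') \<in> \<int> \<or> (t - s) + (t' - s') \<in> \<int>"
      using e(3)
    proof
      assume "(s - t) - (s' - t') \<in> \<int>"
      from Ints_minus[OF this] show ?thesis by (simp add: algebra_simps)
    next
      assume "(s - t) + (s' - t') \<in> \<int>"
      from Ints_minus[OF this] show ?thesis by (simp add: algebra_simps)
    qed
    from mixed[OF 4(2,1) this] show ?thesis
    proof
      assume "2 * t \<in> \<int>"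
      then have "t' + t \<in> \<int>" using int2[of t t'] 4 sw by blast
      then show ?thesis unfolding sign_eq_def using 4 sw by blast
    next
      assume "2 * s \<in> \<int>"
      then have "s' - s \<in> \<int>" using int2[of s s'] 4 sw by blast
      then show ?thesis unfolding sign_eq_def using 4 sw by blast
    qed
  qed
qed

text \<open>The basis is chosen so that a cyclic shift of the coordinates becomes a rotation about the vertical axis.\<close>

definition cyclic_coords :: "real \<Rightarrow> real \<Rightarrow> real \<Rightarrow> complex \<times> real" where
  "cyclic_coords a b c = (Complex (a - b / 2 - c / 2) ((b - c) * (sqrt 3 / 2)), a + b + c)"

lemma cyclic_coords_inj: "cyclic_coords a b c = cyclic_coords a' b' c' \<longleftrightarrow> a = a' \<and> b = b' \<and> c = c'"
proof
  assume "cyclic_coords a b c = cyclic_coords a' b' c'"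
  then have e: "a - b / 2 - c / 2 = a' - b' / 2 - c' / 2" "(b - c) * (sqrt 3 / 2) = (b' - c') * (sqrt 3 / 2)"
    "a + b + c = a' + b' + c'" by (simp_all add: cyclic_coords_def)
  from e(2) have "b - c = b' - c'" by simp
  with e(1,3) show "a = a' \<and> b = b' \<and> c = c'" by (auto simp: field_simps)
qed simp

lemma cyclic_coords_scale: "t *\<^sub>R cyclic_coords a b c = cyclic_coords (t * a) (t * b) (t * c)"
  by (simp add: cyclic_coords_def complex_eq_iff algebra_simps)

lemma cyclic_coords_surj: "\<exists>a b c. v = cyclic_coords a b c"
proof -
  obtain p q h where v: "v = (Complex p q, h)" by (metis complex.exhaust prod.exhaust)
  \<comment> \<open>Solution of the linear system: h + 2 * p is 3 * a, and \<open>u\<close> is b -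
    c.\<close>
  define a where "a = (h + 2 * p) / 3"
  define u where "u = q * 2 / sqrt 3"
  have "v = cyclic_coords a ((h - a + u) / 2) ((h - a - u) / 2)"
    unfolding v cyclic_coords_def by (auto simp: a_def u_def complex_eq_iff field_simps)
  then show ?thesis by blast
qed

lemma cyclic_coords_zero: "cyclic_coords a b c = 0 \<longleftrightarrow> (a, b, c) = (0, 0, 0)"
  using cyclic_coords_inj[of a b c 0 0 0] by (simp add: cyclic_coords_def zero_prod_def complex_eq_iff)

section \<open>The pillowcase map onto the round sphere\<close>

definition cayley :: "real \<Rightarrow> real \<Rightarrow> complex \<times> real" where
  "cayley s t = cyclic_coords (cos (2 * pi * s)) (cos (2 * pi * t)) (cos (2 * pi * (s - t)))"

definition pillow :: "real \<Rightarrow> real \<Rightarrow> complex \<times> real" where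
  "pillow s t = (1 / norm (cayley s t)) *\<^sub>R cayley s t"

lemma cayley_cos': "on_cayley_pillow (cos (2 * pi * s)) (cos (2 * pi * t)) (cos (2 * pi * (s - t)))"
  using cayley_cos[of "2 * pi * s" "2 * pi * t"] by (simp add: right_diff_distrib)

lemma cayley_nonzero: "cayley s t \<noteq> 0"
  using cayley_cos'[of s t] by (auto simp: cayley_def cyclic_coords_zero on_cayley_pillow_def)

lemma pillow_sphere: "pillow s t \<in> R3_sphere"
  using cayley_nonzero[of s t] by (simp add: pillow_def)

text \<open>Points with the same normalization lie on one ray, and a ray meets the Cayley surface
  only once.\<close>

lemma pillow_eq_iff: "pillow s t = pillow s' t' \<longleftrightarrow> sign_eq s t s' t'"
proof -
  have "cayley s t = cayley s' t'" if eq: "pillow s t = pillow s' t'"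
  proof -
    define r where "r = norm (cayley s' t') / norm (cayley s t)"
    have nz: "norm (cayley s t) > 0" "norm (cayley s' t') > 0" using cayley_nonzero by auto
    then have r: "r > 0" by (simp add: r_def)
    have "norm (cayley s' t') *\<^sub>R pillow s t = norm (cayley s' t') *\<^sub>R pillow s' t'" using eq by simp
    then have "r *\<^sub>R cayley s t = cayley s' t'" using nz by (simp add: pillow_def r_def)
    then have e: "r * cos (2 * pi * s) = cos (2 * pi * s')" "r * cos (2 * pi * t) = cos (2 * pi * t')"
      "r * cos (2 * pi * (s - t)) = cos (2 * pi * (s' - t'))"
      unfolding cayley_def cyclic_coords_scale cyclic_coords_inj by auto
    have "on_cayley_pillow (r * cos (2 * pi * s)) (r * cos (2 * pi * t)) (r * cos (2 * pi * (s - t)))"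
      unfolding e by (rule cayley_cos')
    from cayley_ray_unique[OF cayley_cos' this r] have "r = 1" .
    then show ?thesis using \<open>r *\<^sub>R cayley s t = cayley s' t'\<close> by simp
  qed
  then have "pillow s t = pillow s' t' \<longleftrightarrow> cayley s t = cayley s' t'" by (auto simp: pillow_def)
  also have "\<dots> \<longleftrightarrow> sign_eq s t s' t'"
    unfolding cayley_def cyclic_coords_inj by (rule cayley_eq_iff)
  finally show ?thesis .
qed

lemma pillow_surj:
  assumes "v \<in> R3_sphere"
  shows "\<exists>s t. pillow s t = v"
proof -
  obtain a b c where v: "v = cyclic_coords a b c" using cyclic_coords_surj by blast
  have nv: "norm v = 1" using assms by simp
  then have "(a, b, c) \<noteq> (0, 0, 0)" using v cyclic_coords_zero[of a b c] by auto
  then obtain r where r: "r > 0" "on_cayley_pillow (r * a) (r * b) (r * c)" by (rule cayley_ray_exists)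
  obtain x y where xy: "r * a = cos x" "r * b = cos y" "r * c = cos (x - y)"
    by (rule cayley_parametrization[OF r(2)])
  have "2 * pi * (x / (2 * pi) - y / (2 * pi)) = x - y" by (simp add: right_diff_distrib)
  then have "cayley (x / (2 * pi)) (y / (2 * pi)) = r *\<^sub>R v"
    unfolding cayley_def v cyclic_coords_scale xy by simp
  then have "pillow (x / (2 * pi)) (y / (2 * pi)) = v"
    using r nv by (simp add: pillow_def)
  then show ?thesis by blast
qed

lemma continuous_on_pillow:
  fixes S :: "'a::t2_space set"
  assumes "continuous_on S f" "continuous_on S g"
  shows "continuous_on S (\<lambda>x. pillow (f x) (g x))"
proof -
  have "continuous_on S (\<lambda>x. cayley (f x) (g x))"
  proof -
    have c: "continuous_on S (\<lambda>x. cos (2 * pi * k x))" if "continuous_on S k" for k :: "'a \<Rightarrow> real"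
      by (rule continuous_on_cos[OF continuous_on_mult_left[OF that]])
    show ?thesis
      unfolding cayley_def cyclic_coords_def Complex_eq
      by (intro continuous_intros c assms ballI) simp_all
  qed
  then show ?thesis unfolding pillow_def using cayley_nonzero by (intro continuous_intros) auto
qed

section \<open>The rotation of order three and angle tripling\<close>

abbreviation eomega :: complex where "eomega \<equiv> Complex (- 1 / 2) (sqrt 3 / 2)"

text \<open>The rotation of order three permutes the three cosines cyclically.\<close>

lemma pillow_rotate: "pillow (- t) (s - t) = (eomega\<^sup>2 * fst (pillow s t), snd (pillow s t))"
proof -
  have "2 * pi * (- t - (s - t)) = - (2 * pi * s)" by (simp add: algebra_simps)
  then have c: "cos (2 * pi * (- t - (s - t))) = cos (2 * pi * s)" "cos (2 * pi * - t) = cos (2 * pi * t)"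
    by simp_all
  have r: "sqrt 3 * (sqrt 3 * x) = 3 * x" for x by (simp flip: mult.assoc)
  have eq: "cayley (- t) (s - t) = (eomega\<^sup>2 * fst (cayley s t), snd (cayley s t))"
    unfolding cayley_def cyclic_coords_def c
    by (simp add: complex_eq_iff power2_eq_square algebra_simps r)
  have "norm (eomega\<^sup>2) = 1"
    by (simp add: norm_power cmod_def power2_eq_square)
  then have "norm (cayley (- t) (s - t)) = norm (cayley s t)"
    unfolding eq by (simp add: norm_prod_def norm_mult)
  then show ?thesis unfolding pillow_def eq by simp
qed

text \<open>Triples the angle about the vertical axis and keeps the distance from it, so that the
  unit sphere goes to itself. On the axis the quotient 0 / 0 is 0, which is the right value.\<close>

definition cube_fold :: "complex \<times> real \<Rightarrow> complex \<times> real" where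
  "cube_fold v = (fst v ^ 3 / of_real ((norm (fst v))\<^sup>2), snd v)"

lemma norm_cube_fold_fst: "norm (x ^ 3 / of_real ((norm x)\<^sup>2)) = norm (x :: complex)"
  by (cases "x = 0") (simp_all add: norm_divide norm_mult power3_eq_cube power2_eq_square)

lemma cube_fold_eq_iff:
  "cube_fold v = cube_fold v' \<longleftrightarrow> snd v = snd v' \<and> fst v ^ 3 = fst v' ^ 3"
proof
  assume e: "cube_fold v = cube_fold v'"
  then have f: "fst v ^ 3 / of_real ((norm (fst v))\<^sup>2) = fst v' ^ 3 / of_real ((norm (fst v'))\<^sup>2)"
    and s: "snd v = snd v'" by (simp_all add: cube_fold_def)
  from f have n: "norm (fst v) = norm (fst v')" using norm_cube_fold_fst by metis
  show "snd v = snd v' \<and> fst v ^ 3 = fst v' ^ 3"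
  proof (cases "fst v = 0")
    case True
    then have "fst v' = 0" using n by simp
    then show ?thesis using True s by simp
  next
    case False
    then have "fst v' \<noteq> 0" using n by auto
    then show ?thesis using f s n False by simp
  qed
next
  assume e: "snd v = snd v' \<and> fst v ^ 3 = fst v' ^ 3"
  then have "norm (fst v) ^ 3 = norm (fst v') ^ 3" by (simp flip: norm_power)
  then have "norm (fst v) = norm (fst v')" by (simp add: power_eq_iff_eq_base)
  then show "cube_fold v = cube_fold v'" using e by (simp add: cube_fold_def)
qed

lemma norm_cube_fold: "norm (cube_fold v) = norm v"
  by (simp add: cube_fold_def norm_prod_def norm_cube_fold_fst del: of_real_power)

lemma cube_fold_surj: "\<exists>v'. cube_fold v' = v"
proof -
  have "\<exists>z. z ^ 3 = c" for c :: complex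
  proof (cases "c = 0")
    case False
    then have "card {z. z ^ 3 = c} = 3" by (intro card_nth_roots) auto
    then have "{z. z ^ 3 = c} \<noteq> {}" by (metis card.empty zero_neq_numeral)
    then show ?thesis by blast
  qed (auto intro: exI[of _ 0])
  \<comment> \<open>A cube root of x * |x|^2 has the norm of x, so folding it gives x.\<close>
  then obtain z where z: "z ^ 3 = fst v * of_real ((norm (fst v))\<^sup>2)" by blast
  have "norm z ^ 3 = norm (fst v) ^ 3"
    unfolding norm_power[symmetric] z by (simp add: norm_mult power3_eq_cube power2_eq_square norm_power)
  then have "norm z = norm (fst v)" by (simp add: power_eq_iff_eq_base)
  then have "cube_fold (z, snd v) = v"
    by (cases "fst v = 0") (simp_all add: cube_fold_def z prod_eq_iff)
  then show ?thesis by blast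
qed

lemma continuous_on_cube_fold: "continuous_on UNIV cube_fold"
proof -
  have "isCont (\<lambda>x::complex. x ^ 3 / of_real ((norm x)\<^sup>2)) x" for x
  proof (cases "x = 0")
    case True
    have "((\<lambda>x::complex. x ^ 3 / of_real ((norm x)\<^sup>2)) \<longlongrightarrow> 0) (at 0)"
    proof (rule Lim_null_comparison)
      show "\<forall>\<^sub>F x in at 0. norm (x ^ 3 / of_real ((norm x)\<^sup>2)) \<le> norm (x::complex)"
        by (intro always_eventually allI) (simp only: norm_cube_fold_fst order_refl)
      show "(norm \<longlongrightarrow> 0) (at (0::complex))" using tendsto_norm_zero[OF tendsto_ident_at[of 0 UNIV]] by simp
    qed
    then show ?thesis using True by (simp add: isCont_def)
  next
    case False
    then show ?thesis by (intro continuous_intros) auto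
  qed
  then have "continuous_on UNIV (\<lambda>x::complex. x ^ 3 / of_real ((norm x)\<^sup>2))"
    by (simp add: continuous_at_imp_continuous_on)
  then have "continuous_on UNIV (\<lambda>v::complex \<times> real. fst v ^ 3 / of_real ((norm (fst v))\<^sup>2))"
    by (rule continuous_on_compose2[where f = fst]) (auto intro: continuous_intros)
  then have "continuous_on UNIV (\<lambda>v::complex \<times> real. (fst v ^ 3 / of_real ((norm (fst v))\<^sup>2), snd v))"
    by (intro continuous_on_Pair) (auto intro: continuous_intros)
  moreover have "cube_fold = (\<lambda>v. (fst v ^ 3 / of_real ((norm (fst v))\<^sup>2), snd v))"
    by (rule ext) (simp add: cube_fold_def)
  ultimately show ?thesis by (simp only:)
qed

section \<open>Cone points of orbit maps\<close>

lemma cube_eq_iff: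
  fixes x y :: complex
  shows "x ^ 3 = y ^ 3 \<longleftrightarrow> x = y \<or> x = eomega * y \<or> x = eomega\<^sup>2 * y"
proof -
  have e: "eomega\<^sup>2 + eomega + 1 = 0" and e3: "eomega ^ 3 = 1"
    by (simp_all add: complex_eq_iff power2_eq_square power3_eq_cube)
  \<comment> \<open>The added terms are multiples of the two relations that \<open>eomega\<close>
    satisfies; with them the identity holds for any number in the place of
    \<open>eomega\<close>.\<close>
  have "x ^ 3 - y ^ 3 = (x - y) * ((x - eomega * y) * (x - eomega\<^sup>2 * y)) + (eomega\<^sup>2 + eomega + 1) * (x * x * y - eomega * x * y * y) + (eomega ^ 3 - 1) * (y ^ 3)"
    by (simp add: power2_eq_square power3_eq_cube algebra_simps)
  also have "\<dots> = (x - y) * ((x - eomega * y) * (x - eomega\<^sup>2 * y))" using e e3 by simp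
  finally show ?thesis by (metis (no_types, lifting) eq_iff_diff_eq_0 mult_eq_0_iff)
qed


section \<open>Open orbit maps and charts at cone points\<close>

lemma open_power_image:
  fixes W :: "complex set"
  assumes W: "open W" and b: "b \<ge> 1"
  shows "open ((\<lambda>z. z ^ b) ` W)"
proof (rule openI)
  fix y assume "y \<in> (\<lambda>z. z ^ b) ` W"
  then obtain u where u: "u \<in> W" "y = u ^ b" by blast
  \<comment> \<open>At 0 a disc is mapped onto a disc because b-th roots exist; elsewhere invariance
    of domain applies.\<close>
  have "\<exists>T. open T \<and> y \<in> T \<and> T \<subseteq> (\<lambda>z. z ^ b) ` W"
  proof (cases "u = 0")
    case True
    then obtain e where e: "e > 0" "ball 0 e \<subseteq> W" using W u by (metis openE)
    have "ball 0 (e ^ b) \<subseteq> (\<lambda>z. z ^ b) ` W"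
    proof
      fix v :: complex assume v: "v \<in> ball 0 (e ^ b)"
      have "\<exists>z. z ^ b = v"
      proof (cases "v = 0")
        case False
        then have "card {z. z ^ b = v} = b" using b by (intro card_nth_roots) auto
        then have "{z. z ^ b = v} \<noteq> {}" using b by (metis card.empty not_one_le_zero)
        then show ?thesis by blast
      next
        case True
        then show ?thesis using b by (intro exI[of _ 0]) (cases b, auto)
      qed
      then obtain z where z: "z ^ b = v" by blast
      then have "norm z ^ b < e ^ b" using v by (simp flip: norm_power)
      then have "norm z < e" using e by (meson less_imp_le power_less_imp_less_base)
      then show "v \<in> (\<lambda>z. z ^ b) ` W" using e z by auto
    qed
    moreover have "y \<in> ball 0 (e ^ b)" using u True b e by (cases b) auto
    ultimately show ?thesis by (intro exI[of _ "ball 0 (e ^ b)"]) auto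
  next
    case False
    then obtain e where e: "e > 0" "inj_on (\<lambda>z. z ^ b) (ball u e)"
      using power_locally_injective b by metis
    have "open ((\<lambda>z. z ^ b) ` (W \<inter> ball u e))"
    proof (rule invariance_of_domain)
      show "inj_on (\<lambda>z. z ^ b) (W \<inter> ball u e)" by (rule inj_on_subset[OF e(2)]) simp
    qed (use W in \<open>auto intro!: continuous_intros\<close>)
    moreover have "y \<in> (\<lambda>z. z ^ b) ` (W \<inter> ball u e)" using u e by auto
    ultimately show ?thesis by blast
  qed
  then show "\<exists>e>0. ball y e \<subseteq> (\<lambda>z. z ^ b) ` W" by (meson openE order_trans)
qed

text \<open>\<open>sat\<close> speaks of the quotient topology, whereas \<open>Y\<close> carries its
  own. The compact set \<open>K\<close> meeting all orbits connects them: the complement of the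
  image of \<open>U\<close> is the image of a compact set, hence closed.\<close>

lemma orbit_map_open:
  assumes cont: "continuous_map euclidean Y \<pi>" and H: "Hausdorff_space Y"
    and surj: "\<pi> ` UNIV = topspace Y" and K: "compact K" "\<And>z. \<exists>k\<in>K. \<pi> k = \<pi> z"
    and sat: "\<And>U. open U \<Longrightarrow> open {z :: 'c::t2_space. \<exists>u\<in>U. \<pi> u = \<pi> z}" and U: "open U"
  shows "openin Y (\<pi> ` U)"
proof -
  let ?C = "- {z. \<exists>u\<in>U. \<pi> u = \<pi> z}"
  have "closed ?C" using sat[OF U] by (simp add: closed_Compl)
  then have "compact (K \<inter> ?C)" by (rule compact_Int_closed[OF K(1)])
  then have "compactin euclidean (K \<inter> ?C)" by simp
  then have "compactin Y (\<pi> ` (K \<inter> ?C))" by (rule image_compactin[OF _ cont])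
  then have cl: "closedin Y (\<pi> ` (K \<inter> ?C))" by (rule compactin_imp_closedin[OF H])
  have "\<pi> ` U = topspace Y - \<pi> ` (K \<inter> ?C)"
  proof (intro equalityI subsetI)
    fix y assume "y \<in> \<pi> ` U"
    then obtain u where u: "u \<in> U" "y = \<pi> u" by blast
    then have "y \<in> topspace Y" using surj by blast
    moreover have "y \<notin> \<pi> ` (K \<inter> ?C)"
    proof
      assume "y \<in> \<pi> ` (K \<inter> ?C)"
      then obtain z where "y = \<pi> z" "z \<in> ?C" by blast
      then show False using u by auto
    qed
    ultimately show "y \<in> topspace Y - \<pi> ` (K \<inter> ?C)" by simp
  next
    fix y assume y: "y \<in> topspace Y - \<pi> ` (K \<inter> ?C)"
    then obtain z where z: "y = \<pi> z" using surj by blast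
    obtain k where k: "k \<in> K" "\<pi> k = \<pi> z" using K(2) by blast
    have "k \<notin> ?C"
    proof
      assume "k \<in> ?C"
      then have "\<pi> k \<in> \<pi> ` (K \<inter> ?C)" using k(1) by (intro imageI IntI)
      then show False using y z k(2) by simp
    qed
    then obtain u where "u \<in> U" "\<pi> u = \<pi> k" by auto
    then have "y = \<pi> u" using k(2) z by simp
    then show "y \<in> \<pi> ` U" using \<open>u \<in> U\<close> by (rule image_eqI)
  qed
  then show ?thesis using cl by (simp add: openin_diff)
qed

text \<open>Near \<open>z0\<close>, \<pi> is the quotient by the rotations about \<open>z0\<close>
  through b-th roots of unity.\<close>

definition cone_chart :: "(complex \<Rightarrow> 'b) \<Rightarrow> complex \<Rightarrow> nat \<Rightarrow> real \<Rightarrow> bool" where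
  "cone_chart \<pi> z0 b r \<longleftrightarrow> r > 0 \<and>
     (\<forall>z\<in>ball z0 r. \<forall>z'\<in>ball z0 r. \<pi> z = \<pi> z' \<longleftrightarrow> (z - z0) ^ b = (z' - z0) ^ b)"

lemma cone_chart_mono: "cone_chart \<pi> z0 b r \<Longrightarrow> 0 < r' \<Longrightarrow> r' \<le> r \<Longrightarrow> cone_chart \<pi> z0 b r'"
  by (auto simp: cone_chart_def)

text \<open>The invariant function (z - z0) ^ b descends to the quotient; it is continuous there
  because \<pi> is open, and open because powers are.\<close>

lemma quotient_chart:
  assumes cont: "continuous_map euclidean Y \<pi>" and op: "\<And>U. open U \<Longrightarrow> openin Y (\<pi> ` U)"
    and b: "b \<ge> 1" and cc: "cone_chart \<pi> z0 b r"
  obtains \<psi> where "chart Y (\<pi> ` ball z0 r) \<psi>" "\<And>z. z \<in> ball z0 r \<Longrightarrow> \<psi> (\<pi> z) = (z - z0) ^ b"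
proof -
  let ?B = "ball z0 r"
  have eq: "\<pi> z = \<pi> z' \<longleftrightarrow> (z - z0) ^ b = (z' - z0) ^ b" if "z \<in> ?B" "z' \<in> ?B" for z z'
    using cc that by (simp add: cone_chart_def)
  define \<psi> where "\<psi> y = (inv_into ?B \<pi> y - z0) ^ b" for y
  have \<psi>: "\<psi> (\<pi> z) = (z - z0) ^ b" if "z \<in> ?B" for z
  proof -
    have i: "\<pi> z \<in> \<pi> ` ?B" using that by (rule imageI)
    have "inv_into ?B \<pi> (\<pi> z) \<in> ?B" "\<pi> (inv_into ?B \<pi> (\<pi> z)) = \<pi> z"
      by (rule inv_into_into[OF i], rule f_inv_into_f[OF i])
    then show ?thesis unfolding \<psi>_def using eq that by blast
  qed
  have oV: "openin Y (\<pi> ` ?B)" by (rule op) simp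
  have VY: "\<pi> ` ?B \<subseteq> topspace Y" by (rule openin_subset[OF oV])
  have "chart Y (\<pi> ` ?B) \<psi>"
  proof (rule chartI[OF oV])
    show "inj_on \<psi> (\<pi> ` ?B)"
    proof (rule inj_onI)
      fix x y assume "x \<in> \<pi> ` ?B" "y \<in> \<pi> ` ?B" and e: "\<psi> x = \<psi> y"
      then obtain z z' where z: "z \<in> ?B" "x = \<pi> z" "z' \<in> ?B" "y = \<pi> z'" by blast
      then show "x = y" using e \<psi> eq by simp
    qed
    have top: "topspace (subtopology Y (\<pi> ` ?B)) = \<pi> ` ?B" using VY by (simp add: Int_absorb1)
    show "continuous_map (subtopology Y (\<pi> ` ?B)) euclidean \<psi>"
      unfolding continuous_map_def top
    proof (intro conjI allI impI)
      fix S :: "complex set" assume "openin euclidean S"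
      then have S: "open S" by simp
      have "{y \<in> \<pi> ` ?B. \<psi> y \<in> S} = \<pi> ` {z \<in> ?B. (z - z0) ^ b \<in> S}" using \<psi> by auto
      moreover have "open {z \<in> ?B. (z - z0) ^ b \<in> S}"
      proof -
        have "open ((\<lambda>z. (z - z0) ^ b) -` S)" using S by (intro open_vimage) (auto intro!: continuous_intros)
        then have "open (?B \<inter> (\<lambda>z. (z - z0) ^ b) -` S)" by (intro open_Int open_ball)
        moreover have "?B \<inter> (\<lambda>z. (z - z0) ^ b) -` S = {z \<in> ?B. (z - z0) ^ b \<in> S}" by auto
        ultimately show ?thesis by simp
      qed
      ultimately have "openin Y {y \<in> \<pi> ` ?B. \<psi> y \<in> S}" using op by simp
      then show "openin (subtopology Y (\<pi> ` ?B)) {y \<in> \<pi> ` ?B. \<psi> y \<in> S}"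
        using oV by (simp add: openin_open_subtopology)
    qed simp
    show "open (\<psi> ` W)" if W: "openin Y W" "W \<subseteq> \<pi> ` ?B" for W
    proof -
      have pre: "open {z. \<pi> z \<in> W}"
        using openin_continuous_map_preimage[OF cont W(1)] by simp
      let ?W = "?B \<inter> {z. \<pi> z \<in> W}"
      have "\<psi> ` W = (\<lambda>z. z ^ b) ` ((\<lambda>z. z - z0) ` ?W)"
      proof (intro equalityI subsetI)
        fix v assume "v \<in> \<psi> ` W"
        then obtain y where y: "y \<in> W" "v = \<psi> y" by blast
        then obtain z where "z \<in> ?B" "y = \<pi> z" using W(2) by blast
        then show "v \<in> (\<lambda>z. z ^ b) ` ((\<lambda>z. z - z0) ` ?W)" using y \<psi> by auto
      next
        fix v assume "v \<in> (\<lambda>z. z ^ b) ` ((\<lambda>z. z - z0) ` ?W)"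
        then obtain z where "z \<in> ?W" "v = (z - z0) ^ b" by blast
        then show "v \<in> \<psi> ` W" using \<psi>[of z] by (intro image_eqI[of _ _ "\<pi> z"]) auto
      qed
      moreover have "open ((\<lambda>z. z - z0) ` ?W)"
        using open_translation_subtract[of ?W z0] pre by (simp add: open_Int)
      ultimately show ?thesis using open_power_image[OF _ b] by simp
    qed
  qed
  with \<psi> show thesis by (intro that) auto
qed

text \<open>Both charts come from one point of the plane, and (z - z0) ^ b is the power of (z - z0)
  ^ a with exponent b div a.\<close>

lemma locally_power_quotient:
  assumes X: "continuous_map euclidean X \<pi>'" "\<And>U. open U \<Longrightarrow> openin X (\<pi>' ` U)"
    and Y: "continuous_map euclidean Y \<pi>" "\<And>U. open U \<Longrightarrow> openin Y (\<pi> ` U)"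
    and f: "\<And>z. f (\<pi>' z) = \<pi> z" and a: "a \<ge> 1" "cone_chart \<pi>' z0 a r'" and b: "b \<ge> 1" "cone_chart \<pi> z0 b r"
    and ab: "a dvd b"
  shows "locally_power X Y f (\<pi>' z0) (b div a)"
proof -
  define s where "s = min r r'"
  have s: "s > 0" using a(2) b(2) by (auto simp: s_def cone_chart_def)
  have ca: "cone_chart \<pi>' z0 a s" by (rule cone_chart_mono[OF a(2) s]) (simp add: s_def)
  have cb: "cone_chart \<pi> z0 b s" by (rule cone_chart_mono[OF b(2) s]) (simp add: s_def)
  obtain \<phi> where \<phi>: "chart X (\<pi>' ` ball z0 s) \<phi>" "\<And>z. z \<in> ball z0 s \<Longrightarrow> \<phi> (\<pi>' z) = (z - z0) ^ a"
  proof (rule quotient_chart[OF X(1) _ a(1) ca])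
    show "openin X (\<pi>' ` U)" if "open U" for U by (rule X(2)[OF that])
  qed (rule that)
  obtain \<psi> where \<psi>: "chart Y (\<pi> ` ball z0 s) \<psi>" "\<And>z. z \<in> ball z0 s \<Longrightarrow> \<psi> (\<pi> z) = (z - z0) ^ b"
  proof (rule quotient_chart[OF Y(1) _ b(1) cb])
    show "openin Y (\<pi> ` U)" if "open U" for U by (rule Y(2)[OF that])
  qed (rule that)
  have z0: "z0 \<in> ball z0 s" using s by simp
  obtain q where q: "b = a * q" using ab by (auto simp: dvd_def)
  have q1: "q \<ge> 1" "b div a = q" using a(1) b(1) q by (auto simp: Suc_le_eq intro: gr0I)
  show ?thesis
    unfolding locally_power_def
  proof (intro conjI exI)
    show "chart X (\<pi>' ` ball z0 s) \<phi>" "chart Y (\<pi> ` ball z0 s) \<psi>" by fact+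
    show "\<phi> (\<pi>' z0) = 0" using \<phi>(2)[OF z0] a(1) by (cases a) auto
    show "\<psi> (f (\<pi>' z0)) = 0" using \<psi>(2)[OF z0] b(1) f by (cases b) auto
    show "\<forall>x\<in>\<pi>' ` ball z0 s. \<psi> (f x) = \<phi> x ^ (b div a)"
    proof
      fix x assume "x \<in> \<pi>' ` ball z0 s"
      then obtain z where z: "z \<in> ball z0 s" "x = \<pi>' z" by (rule imageE)
      show "\<psi> (f x) = \<phi> x ^ (b div a)"
        unfolding z(2) f \<phi>(2)[OF z(1)] \<psi>(2)[OF z(1)] q1(2) unfolding q by (rule power_mult)
    qed
    show "f ` \<pi>' ` ball z0 s \<subseteq> \<pi> ` ball z0 s" using f by auto
    show "f (\<pi>' z0) \<in> \<pi> ` ball z0 s" unfolding f using z0 by blast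
    show "\<pi>' z0 \<in> \<pi>' ` ball z0 s" using z0 by blast
    show "1 \<le> b div a" using q1 by simp
  qed
qed

text \<open>Coordinates with respect to the basis \<open>1, eomega\<close> of the plane; \<open>eisl m n\<close> is the lattice
spanned by \<open>m\<close> and \<open>n * eomega\<close>.\<close>

definition scoord :: "complex \<Rightarrow> real" where "scoord z = Re z + Im z / sqrt 3"
definition tcoord :: "complex \<Rightarrow> real" where "tcoord z = 2 * Im z / sqrt 3"

definition eisl :: "nat \<Rightarrow> nat \<Rightarrow> complex set" where
  "eisl m n = {z. scoord z / m \<in> \<int> \<and> tcoord z / n \<in> \<int>}"

abbreviation "eis \<equiv> eisl 1 1"

lemma coord_add: "scoord (z + w) = scoord z + scoord w" "tcoord (z + w) = tcoord z + tcoord w"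
  by (simp_all add: scoord_def tcoord_def add_divide_distrib distrib_left)

lemma coord_diff: "scoord (z - w) = scoord z - scoord w" "tcoord (z - w) = tcoord z - tcoord w"
  by (simp_all add: scoord_def tcoord_def diff_divide_distrib right_diff_distrib)

lemma coord_minus: "scoord (- z) = - scoord z" "tcoord (- z) = - tcoord z"
  by (simp_all add: scoord_def tcoord_def)

lemma coord_of_real: "scoord (of_real r) = r" "tcoord (of_real r) = 0"
  by (simp_all add: scoord_def tcoord_def)

lemma coord_0 [simp]: "scoord 0 = 0" "tcoord 0 = 0"
  by (simp_all add: scoord_def tcoord_def)

text \<open>On coordinates this is the substitution (s, t) -> (- t, s - t) of
  \<open>pillow_rotate\<close>.\<close>

lemma coord_eomega: "scoord (eomega * z) = - tcoord z" "tcoord (eomega * z) = scoord z - tcoord z"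
proof -
  have 3: "sqrt 3 * sqrt 3 = (3::real)" by simp
  have r: "sqrt 3 * (sqrt 3 * x) = 3 * x" for x by (simp flip: mult.assoc)
  have d: "x / sqrt 3 = x * sqrt 3 / 3" for x
  proof -
    have "x / sqrt 3 * (sqrt 3 * sqrt 3) = (x / sqrt 3 * sqrt 3) * sqrt 3" by (simp only: mult.assoc)
    also have "x / sqrt 3 * sqrt 3 = x" by simp
    finally have "x / sqrt 3 * 3 = x * sqrt 3" unfolding 3 .
    then show ?thesis
      using nonzero_eq_divide_eq[of "3::real" "x / sqrt 3" "x * sqrt 3"] by (metis zero_neq_numeral)
  qed
  show "scoord (eomega * z) = - tcoord z" "tcoord (eomega * z) = scoord z - tcoord z"
    unfolding scoord_def tcoord_def d by (simp_all add: algebra_simps r diff_divide_distrib)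
qed

lemma coord_inverse: "of_real (scoord z) + of_real (tcoord z) * eomega = z"
proof -
  have "Im z * 2 / sqrt 3 * (sqrt 3 / 2) = Im z" by simp
  then show ?thesis by (simp add: scoord_def tcoord_def complex_eq_iff mult.commute)
qed

lemma coord_ext: "scoord z = scoord w \<Longrightarrow> tcoord z = tcoord w \<Longrightarrow> z = w"
  using coord_inverse[of z] coord_inverse[of w] by simp

lemma coord_bound: "\<bar>scoord z\<bar> \<le> 2 * norm z" "\<bar>tcoord z\<bar> \<le> 2 * norm z"
proof -
  have s3: "sqrt 3 \<ge> 1" by simp
  have "\<bar>Im z\<bar> / sqrt 3 \<le> \<bar>Im z\<bar> / 1" using s3 by (intro divide_left_mono) auto
  then have i: "\<bar>Im z / sqrt 3\<bar> \<le> norm z" using abs_Im_le_cmod[of z] by simp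
  show "\<bar>scoord z\<bar> \<le> 2 * norm z"
    using i abs_Re_le_cmod[of z] abs_triangle_ineq[of "Re z" "Im z / sqrt 3"] unfolding scoord_def by linarith
  show "\<bar>tcoord z\<bar> \<le> 2 * norm z"
    using i unfolding tcoord_def by (simp add: abs_mult)
qed

lemma continuous_on_coord: "continuous_on S scoord" "continuous_on S tcoord"
  unfolding scoord_def tcoord_def by (intro continuous_intros; simp)+

lemma eisl_zero [simp]: "0 \<in> eisl m n" by (simp add: eisl_def)

lemma eisl_add: "z \<in> eisl m n \<Longrightarrow> w \<in> eisl m n \<Longrightarrow> z + w \<in> eisl m n"
  by (simp add: eisl_def coord_add add_divide_distrib)

lemma eisl_minus: "z \<in> eisl m n \<Longrightarrow> - z \<in> eisl m n"
  by (simp add: eisl_def coord_minus)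

lemma eisl_minus_iff: "- z \<in> eisl m n \<longleftrightarrow> z \<in> eisl m n"
  using eisl_minus[of z m n] eisl_minus[of "- z" m n] by auto

lemma eisl_diff: "z \<in> eisl m n \<Longrightarrow> w \<in> eisl m n \<Longrightarrow> z - w \<in> eisl m n"
  using eisl_add[of z m n "- w"] eisl_minus by simp

lemma eis_iff: "z \<in> eis \<longleftrightarrow> scoord z \<in> \<int> \<and> tcoord z \<in> \<int>"
  by (simp add: eisl_def)

lemma eisl_subset_eis:
  assumes "m > 0" "n > 0" "z \<in> eisl m n"
  shows "z \<in> eis"
proof -
  have "scoord z / m * m \<in> \<int>" "tcoord z / n * n \<in> \<int>"
    using assms(3) by (auto simp: eisl_def simp del: times_divide_eq_left intro!: Ints_mult)
  then show ?thesis unfolding eis_iff using assms(1,2) by simp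
qed

lemma eomega_power: "eomega\<^sup>2 = - 1 - eomega" "eomega ^ 3 = 1" "eomega * eomega = - 1 - eomega"
  by (simp_all add: complex_eq_iff power2_eq_square power3_eq_cube)

lemma eis_eomega: "z \<in> eis \<Longrightarrow> eomega * z \<in> eis"
  by (simp only: eis_iff coord_eomega) (auto intro: Ints_minus Ints_diff)

lemma eis_eomega2: "z \<in> eis \<Longrightarrow> eomega\<^sup>2 * z \<in> eis"
  using eis_eomega[OF eis_eomega] by (simp only: power2_eq_square mult.assoc)

lemma eis_eomega_iff: "eomega * z \<in> eis \<longleftrightarrow> z \<in> eis" "eomega\<^sup>2 * z \<in> eis \<longleftrightarrow> z \<in> eis"
proof -
  have e: "eomega\<^sup>2 * (eomega * z) = z" "eomega * (eomega\<^sup>2 * z) = z"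
    using eomega_power(2) by (simp_all only: power2_eq_square power3_eq_cube mult.assoc[symmetric] mult_1_left)
  show "eomega * z \<in> eis \<longleftrightarrow> z \<in> eis" using eis_eomega[of z] eis_eomega2[of "eomega * z"] e by metis
  show "eomega\<^sup>2 * z \<in> eis \<longleftrightarrow> z \<in> eis" using eis_eomega2[of z] eis_eomega[of "eomega\<^sup>2 * z"] e by metis
qed

section \<open>Discreteness and stabilizers\<close>

lemma Ints_discrete:
  obtains d where "d > 0" "\<And>n. n \<in> \<int> \<Longrightarrow> n \<noteq> x \<Longrightarrow> d \<le> \<bar>n - x :: real\<bar>"
proof (cases "x \<in> \<int>")
  case True
  show thesis
  proof (rule that[of 1])
    fix n :: real assume "n \<in> \<int>" "n \<noteq> x"
    then obtain a b :: int where "n = of_int a" "x = of_int b" "a \<noteq> b" using True by (metis Ints_cases)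
    then show "1 \<le> \<bar>n - x\<bar>" by linarith
  qed simp
next
  case False
  have f: "of_int \<lfloor>x\<rfloor> < x" using False by (metis Ints_of_int of_int_floor_le order_le_imp_less_or_eq)
  show thesis
  proof (rule that[of "min (x - of_int \<lfloor>x\<rfloor>) (of_int \<lfloor>x\<rfloor> + 1 - x)"])
    show "min (x - of_int \<lfloor>x\<rfloor>) (of_int \<lfloor>x\<rfloor> + 1 - x) > 0" using f by (simp; linarith)
    fix n :: real assume "n \<in> \<int>"
    then obtain a :: int where a: "n = of_int a" by (metis Ints_cases)
    show "min (x - of_int \<lfloor>x\<rfloor>) (of_int \<lfloor>x\<rfloor> + 1 - x) \<le> \<bar>n - x\<bar>"
    proof (cases "a \<le> \<lfloor>x\<rfloor>")
      case True
      then have "n \<le> of_int \<lfloor>x\<rfloor>" using a by simp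
      then show ?thesis by (simp add: min_le_iff_disj; linarith)
    next
      case False
      then have "\<lfloor>x\<rfloor> + 1 \<le> a" by simp
      then have "of_int (\<lfloor>x\<rfloor> + 1) \<le> n" unfolding a by (simp only: of_int_le_iff)
      then show ?thesis by (simp add: min_le_iff_disj; linarith)
    qed
  qed
qed

text \<open>The distance is required at points outside \<open>L\<close> too: \<open>p\<close> will
  be the displacement of a point under a rotation, whether or not that rotation fixes the point
  modulo \<open>L\<close>.\<close>

definition discrete_at_distance :: "complex set \<Rightarrow> bool" where
  "discrete_at_distance L \<longleftrightarrow> (\<forall>p. \<exists>d>0. \<forall>l\<in>L. l \<noteq> p \<longrightarrow> d \<le> norm (l - p))"

lemma eisl_discrete:
  assumes mn: "m > 0" "n > 0"
  shows "discrete_at_distance (eisl m n)"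
  unfolding discrete_at_distance_def
proof
  fix p
  obtain d1 where d1: "d1 > 0" "\<And>k. k \<in> \<int> \<Longrightarrow> k \<noteq> scoord p / m \<Longrightarrow> d1 \<le> \<bar>k - scoord p / m\<bar>"
    by (rule Ints_discrete[of "scoord p / m"]) (rule that)
  obtain d2 where d2: "d2 > 0" "\<And>k. k \<in> \<int> \<Longrightarrow> k \<noteq> tcoord p / n \<Longrightarrow> d2 \<le> \<bar>k - tcoord p / n\<bar>"
    by (rule Ints_discrete[of "tcoord p / n"]) (rule that)
  define d where "d = min (d1 * m) (d2 * n) / 2"
  have "d > 0" using d1 d2 mn by (simp add: d_def)
  moreover have "d \<le> norm (l - p)" if l: "l \<in> eisl m n" "l \<noteq> p" for l
  proof (cases "scoord l = scoord p")
    case False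
    then have "d1 \<le> \<bar>scoord l / m - scoord p / m\<bar>" using l mn by (intro d1) (auto simp: eisl_def)
    also have "\<dots> = \<bar>scoord (l - p)\<bar> / m" by (simp add: coord_diff diff_divide_distrib[symmetric] abs_divide)
    finally have "d1 * m \<le> \<bar>scoord (l - p)\<bar>" using mn by (simp add: le_divide_eq)
    moreover have "d \<le> d1 * m / 2" unfolding d_def by (intro divide_right_mono) auto
    ultimately show ?thesis using coord_bound(1)[of "l - p"] by linarith
  next
    case True
    then have "tcoord l \<noteq> tcoord p" using coord_ext l by blast
    then have "d2 \<le> \<bar>tcoord l / n - tcoord p / n\<bar>" using l mn by (intro d2) (auto simp: eisl_def)
    also have "\<dots> = \<bar>tcoord (l - p)\<bar> / n" by (simp add: coord_diff diff_divide_distrib[symmetric] abs_divide)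
    finally have "d2 * n \<le> \<bar>tcoord (l - p)\<bar>" using mn by (simp add: le_divide_eq)
    moreover have "d \<le> d2 * n / 2" unfolding d_def by (intro divide_right_mono) auto
    ultimately show ?thesis using coord_bound(2)[of "l - p"] by linarith
  qed
  ultimately show "\<exists>d>0. \<forall>l\<in>eisl m n. l \<noteq> p \<longrightarrow> d \<le> norm (l - p)" by blast
qed

text \<open>For z and z' within d / 2 of z0, the displacement (z' - c) - \<zeta> * (z - c) differs
  by less than d from that of z0. If it lies in \<open>L\<close>, it therefore equals the latter, so
  \<zeta> stabilizes z0 and z' - z0 = \<zeta> * (z - z0).\<close>

lemma cone_chart_of_stabilizer:
  assumes M: "finite M" "\<And>\<zeta>. \<zeta> \<in> M \<Longrightarrow> norm \<zeta> = 1" and L: "discrete_at_distance L" and b: "b \<ge> 1"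
    and \<pi>: "\<And>z z'. \<pi> z = \<pi> z' \<longleftrightarrow> (\<exists>\<zeta>\<in>M. (z' - c) - \<zeta> * (z - c) \<in> L)"
    and stab: "{\<zeta> \<in> M. (z0 - c) - \<zeta> * (z0 - c) \<in> L} = {\<zeta>. \<zeta> ^ b = 1}"
  shows "\<exists>r. cone_chart \<pi> z0 b r"
proof -
  let ?p = "\<lambda>\<zeta>. (z0 - c) - \<zeta> * (z0 - c)"
  have "\<forall>p. \<exists>d>0. \<forall>l\<in>L. l \<noteq> p \<longrightarrow> d \<le> norm (l - p)" using L by (simp add: discrete_at_distance_def)
  then obtain dd where dd: "\<And>p. dd p > 0" "\<And>p l. l \<in> L \<Longrightarrow> l \<noteq> p \<Longrightarrow> dd p \<le> norm (l - p)" by metis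
  define d where "d = Min (insert 1 ((\<lambda>\<zeta>. dd (?p \<zeta>)) ` M))"
  have d: "d > 0" using M(1) dd(1) by (simp add: d_def)
  have d': "d \<le> norm (l - ?p \<zeta>)" if "\<zeta> \<in> M" "l \<in> L" "l \<noteq> ?p \<zeta>" for \<zeta> l
  proof -
    have "d \<le> dd (?p \<zeta>)" unfolding d_def using M(1) that(1) by (intro Min_le) auto
    then show ?thesis using dd(2)[OF that(2,3)] by linarith
  qed
  define r where "r = d / 2"
  have "\<pi> z = \<pi> z' \<longleftrightarrow> (z - z0) ^ b = (z' - z0) ^ b" if z: "z \<in> ball z0 r" "z' \<in> ball z0 r" for z z'
  proof
    assume "\<pi> z = \<pi> z'"
    then obtain \<zeta> where \<zeta>: "\<zeta> \<in> M" "(z' - c) - \<zeta> * (z - c) \<in> L" using \<pi> by blast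
    let ?l = "(z' - c) - \<zeta> * (z - c)"
    have diff: "?l - ?p \<zeta> = (z' - z0) - \<zeta> * (z - z0)" by (simp add: algebra_simps)
    have "norm (?l - ?p \<zeta>) \<le> norm (z' - z0) + norm (\<zeta> * (z - z0))"
      unfolding diff by (rule norm_triangle_ineq4)
    also have "\<dots> < d" using z M(2)[OF \<zeta>(1)] by (simp add: norm_mult dist_norm norm_minus_commute r_def)
    finally have l: "?l = ?p \<zeta>" using d'[OF \<zeta>] by (metis not_le)
    have "\<zeta> \<in> {\<zeta>. \<zeta> ^ b = 1}"
      unfolding stab[symmetric] using \<zeta>(1) \<zeta>(2)[unfolded l] by blast
    then have "\<zeta> ^ b = 1" by simp
    moreover have "?l - ?p \<zeta> = 0" using l by (simp only: right_minus_eq)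
    then have "z' - z0 = \<zeta> * (z - z0)" unfolding diff by simp
    ultimately show "(z - z0) ^ b = (z' - z0) ^ b" by (simp add: power_mult_distrib)
  next
    assume e: "(z - z0) ^ b = (z' - z0) ^ b"
    have "\<exists>\<zeta>. \<zeta> ^ b = 1 \<and> z' - z0 = \<zeta> * (z - z0)"
    proof (cases "z = z0")
      case True
      then have "(z' - z0) ^ b = 0" using e b by (cases b) auto
      then have "z' - z0 = 0" by (rule power_eq_0_iff[THEN iffD1, THEN conjunct1])
      then show ?thesis using True by (intro exI[of _ 1]) simp
    next
      case False
      then have "z - z0 \<noteq> 0" by simp
      then have "((z' - z0) / (z - z0)) ^ b = 1" using e by (metis power_divide divide_self power_not_zero)
      then show ?thesis using \<open>z - z0 \<noteq> 0\<close> by (intro exI[of _ "(z' - z0) / (z - z0)"]) simp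
    qed
    then obtain \<zeta> where \<zeta>: "\<zeta> ^ b = 1" "z' - z0 = \<zeta> * (z - z0)" by blast
    have "\<zeta> \<in> {\<zeta> \<in> M. ?p \<zeta> \<in> L}" unfolding stab using \<zeta>(1) by simp
    then have M: "\<zeta> \<in> M" "?p \<zeta> \<in> L" by simp_all
    have "(z' - c) - \<zeta> * (z - c) = (z' - z0) - \<zeta> * (z - z0) + ?p \<zeta>" by (simp add: algebra_simps)
    then have "(z' - c) - \<zeta> * (z - c) = ?p \<zeta>" using \<zeta>(2) by simp
    then have "(z' - c) - \<zeta> * (z - c) \<in> L" using M(2) by (rule ssubst)
    then show "\<pi> z = \<pi> z'" using \<pi> M(1) by blast
  qed
  then show ?thesis using d by (intro exI[of _ r]) (auto simp: cone_chart_def r_def)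
qed

text \<open>\<open>tri\<close> and \<open>pill m n c\<close> realize the quotients of the plane by the groups generated by
\<open>eis\<close> and the sixth roots of unity, and by \<open>eisl m n\<close> and the point reflection in \<open>c\<close>.\<close>

definition tri :: "complex \<Rightarrow> complex \<times> real" where
  "tri z = cube_fold (pillow (scoord z) (tcoord z))"

definition pill :: "nat \<Rightarrow> nat \<Rightarrow> real \<Rightarrow> complex \<Rightarrow> complex \<times> real" where
  "pill m n c z = pillow ((scoord z - c) / m) (tcoord z / n)"

lemma pill_eq_iff:
  "pill m n c z = pill m n c z' \<longleftrightarrow>
     (\<exists>\<zeta>\<in>{1, - 1}. (z' - of_real c) - \<zeta> * (z - of_real c) \<in> eisl m n)"
proof -
  have "pill m n c z = pill m n c z' \<longleftrightarrow>
    (z' - of_real c) - (z - of_real c) \<in> eisl m n \<or> (z' - of_real c) + (z - of_real c) \<in> eisl m n"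
    unfolding pill_def pillow_eq_iff sign_eq_def eisl_def mem_Collect_eq coord_diff coord_add coord_of_real
      diff_divide_distrib[symmetric] add_divide_distrib[symmetric] by simp
  then show ?thesis by simp
qed

lemma sixth_roots: "\<zeta> ^ 6 = (1::complex) \<longleftrightarrow>
    \<zeta> = 1 \<or> \<zeta> = - 1 \<or> \<zeta> = eomega \<or> \<zeta> = - eomega \<or> \<zeta> = eomega\<^sup>2 \<or> \<zeta> = - eomega\<^sup>2"
proof -
  have e: "\<zeta> ^ 6 = (\<zeta> ^ 3)\<^sup>2" by (simp flip: power_mult)
  have "\<zeta> ^ 6 = 1 \<longleftrightarrow> \<zeta> ^ 3 = 1 ^ 3 \<or> \<zeta> ^ 3 = (- 1) ^ 3" unfolding e power2_eq_1_iff by simp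
  then show ?thesis unfolding cube_eq_iff by auto
qed

lemma bex_six_units:
  fixes w w2 :: complex
  shows "(\<exists>\<zeta>. (\<zeta> = 1 \<or> \<zeta> = - 1 \<or> \<zeta> = w \<or> \<zeta> = - w \<or> \<zeta> = w2 \<or> \<zeta> = - w2) \<and> z' - \<zeta> * z \<in> E) \<longleftrightarrow>
    (z' - z \<in> E \<or> z' + z \<in> E) \<or> (z' - w * z \<in> E \<or> z' + w * z \<in> E) \<or> (z' - w2 * z \<in> E \<or> z' + w2 * z \<in> E)"
  by auto

text \<open>\<open>pillow\<close> accounts for the units 1 and -1, and \<open>cube_fold\<close> for
  the powers of \<open>eomega\<close> by \<open>pillow_rotate\<close>; products of these are the six
  units.\<close>

lemma tri_eq_iff:
  "tri z = tri z' \<longleftrightarrow> (\<exists>\<zeta>\<in>{\<zeta>. \<zeta> ^ 6 = 1}. z' - \<zeta> * z \<in> eis)"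
proof -
  let ?p = "\<lambda>z. pillow (scoord z) (tcoord z)"
  have r: "?p (eomega * z) = (eomega\<^sup>2 * fst (?p z), snd (?p z))" for z
    unfolding coord_eomega by (rule pillow_rotate)
  have r2: "?p (eomega\<^sup>2 * z) = (eomega * fst (?p z), snd (?p z))"
  proof -
    have "?p (eomega\<^sup>2 * z) = ?p (eomega * (eomega * z))" by (simp only: power2_eq_square mult.assoc)
    also have "\<dots> = (eomega\<^sup>2 * (eomega\<^sup>2 * fst (?p z)), snd (?p z))" unfolding r by simp
    also have "eomega\<^sup>2 * (eomega\<^sup>2 * fst (?p z)) = eomega ^ 3 * (eomega * fst (?p z))"
      by (simp only: power2_eq_square power3_eq_cube mult.assoc)
    finally show ?thesis using eomega_power(2) by simp
  qed
  have s: "?p z = ?p z' \<longleftrightarrow> z' - z \<in> eis \<or> z' + z \<in> eis" for z z'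
    unfolding pillow_eq_iff sign_eq_def eis_iff coord_add coord_diff by simp
  have "tri z = tri z' \<longleftrightarrow> tri z' = tri z" by auto
  also have "\<dots> \<longleftrightarrow> snd (?p z') = snd (?p z) \<and>
      (fst (?p z') = fst (?p z) \<or> fst (?p z') = eomega * fst (?p z) \<or> fst (?p z') = eomega\<^sup>2 * fst (?p z))"
    unfolding tri_def cube_fold_eq_iff cube_eq_iff by simp
  also have "\<dots> \<longleftrightarrow> ?p z = ?p z' \<or> ?p (eomega * z) = ?p z' \<or> ?p (eomega\<^sup>2 * z) = ?p z'"
    unfolding r r2 by (auto simp: prod_eq_iff)
  also have "\<dots> \<longleftrightarrow> (\<exists>\<zeta>\<in>{\<zeta>. \<zeta> ^ 6 = 1}. z' - \<zeta> * z \<in> eis)"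
    unfolding s sixth_roots Bex_def mem_Collect_eq bex_six_units ..
  finally show ?thesis .
qed

text \<open>The order of the stabilizer of z in the group generated by \<open>eis\<close> and the
  sixth roots of unity: modulo \<open>eis\<close>, -1 fixes z if 2 * z is a lattice point, and
  \<open>eomega\<close> does if (1 - eomega) * z is. Lattice points pass all the tests and are
  therefore tested first.\<close>

definition cone_order :: "complex \<Rightarrow> nat" where
  "cone_order z = (if z \<in> eis then 6 else if 2 * z \<in> eis then 2 else if (1 - eomega) * z \<in> eis then 3 else 1)"

text \<open>3 is the product of 1 - eomega and 1 - eomega^2, so 3 * z is a lattice point, and z = 3
  * z - 2 * z.\<close>

lemma eis_2_3: "2 * z \<in> eis \<Longrightarrow> (1 - eomega) * z \<in> eis \<Longrightarrow> z \<in> eis"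
proof -
  assume 2: "2 * z \<in> eis" and 3: "(1 - eomega) * z \<in> eis"
  have "(1 - eomega) * z - eomega\<^sup>2 * ((1 - eomega) * z) \<in> eis"
    by (rule eisl_diff[OF 3 eis_eomega2[OF 3]])
  also have "(1 - eomega) * z - eomega\<^sup>2 * ((1 - eomega) * z) = 3 * z"
    by (simp add: complex_eq_iff power2_eq_square algebra_simps)
  finally have "3 * z - 2 * z \<in> eis" using 2 by (rule eisl_diff)
  then show "z \<in> eis" by simp
qed

lemma eis_mult: "z \<in> eis \<Longrightarrow> 2 * z \<in> eis" "z \<in> eis \<Longrightarrow> (1 - eomega) * z \<in> eis"
proof -
  assume z: "z \<in> eis"
  show "2 * z \<in> eis" unfolding mult_2 by (rule eisl_add[OF z z])
  have "z - eomega * z \<in> eis" by (rule eisl_diff[OF z eis_eomega[OF z]])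
  then show "(1 - eomega) * z \<in> eis" by (simp only: left_diff_distrib mult_1_left)
qed

text \<open>Up to units of the lattice, the factor 1 - \<zeta> is 2 for -1, 1 - eomega for both
  primitive cube roots of unity, and 1 for both primitive sixth roots.\<close>

lemma tri_stabilizer:
  "{\<zeta> \<in> {\<zeta>. \<zeta> ^ 6 = 1}. (z - 0) - \<zeta> * (z - 0) \<in> eis} = {\<zeta>. \<zeta> ^ cone_order z = 1}"
proof -
  have e1: "z - (- 1) * z = 2 * z" by simp
  have e2: "z - eomega * z = (1 - eomega) * z" by (simp add: algebra_simps)
  have e3: "z - (- eomega) * z = - (eomega\<^sup>2 * z)" unfolding eomega_power(1) by (simp add: algebra_simps)
  have e4: "z - eomega\<^sup>2 * z = - (eomega\<^sup>2 * ((1 - eomega) * z))"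
    by (simp add: complex_eq_iff power2_eq_square algebra_simps)
  have e5: "z - (- eomega\<^sup>2) * z = - (eomega * z)" unfolding eomega_power(1) by (simp add: algebra_simps)
  have m: "z - (- 1) * z \<in> eis \<longleftrightarrow> 2 * z \<in> eis" "z - eomega * z \<in> eis \<longleftrightarrow> (1 - eomega) * z \<in> eis"
    "z - (- eomega) * z \<in> eis \<longleftrightarrow> z \<in> eis" "z - eomega\<^sup>2 * z \<in> eis \<longleftrightarrow> (1 - eomega) * z \<in> eis"
    "z - (- eomega\<^sup>2) * z \<in> eis \<longleftrightarrow> z \<in> eis" "z - 1 * z \<in> eis"
    unfolding e1 e2 e3 e4 e5 eisl_minus_iff eis_eomega_iff by simp_all
  have "{\<zeta> \<in> {\<zeta>. \<zeta> ^ 6 = 1}. (z - 0) - \<zeta> * (z - 0) \<in> eis} =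
    {\<zeta>. \<zeta> = 1 \<or> \<zeta> = - 1 \<and> 2 * z \<in> eis \<or> \<zeta> = eomega \<and> (1 - eomega) * z \<in> eis \<or> \<zeta> = - eomega \<and> z \<in> eis
       \<or> \<zeta> = eomega\<^sup>2 \<and> (1 - eomega) * z \<in> eis \<or> \<zeta> = - eomega\<^sup>2 \<and> z \<in> eis}"
    unfolding sixth_roots diff_zero mem_Collect_eq using m by blast
  also have "\<dots> = {\<zeta>. \<zeta> ^ cone_order z = 1}"
  proof (cases "z \<in> eis")
    case True
    then have "cone_order z = 6" by (simp add: cone_order_def)
    then show ?thesis using True eis_mult[OF True] by (simp only: sixth_roots simp_thms)
  next
    case False
    show ?thesis
    proof (cases "2 * z \<in> eis")
      case True
      then have "(1 - eomega) * z \<notin> eis" using eis_2_3 False by blast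
      moreover have "cone_order z = 2" using True False by (simp add: cone_order_def)
      ultimately show ?thesis using True False by (simp only: power2_eq_1_iff simp_thms)
    next
      case no2: False
      show ?thesis
      proof (cases "(1 - eomega) * z \<in> eis")
        case True
        have "cone_order z = 3" using True False no2 by (simp add: cone_order_def)
        moreover have "\<zeta> ^ 3 = 1 \<longleftrightarrow> \<zeta> = 1 \<or> \<zeta> = eomega \<or> \<zeta> = eomega\<^sup>2" for \<zeta> :: complex
          using cube_eq_iff[of \<zeta> 1] by simp
        ultimately show ?thesis using True False no2 by (simp only: simp_thms)
      next
        case no3: False
        have "cone_order z = 1" using no3 False no2 by (simp add: cone_order_def)
        then show ?thesis using no3 False no2 by (simp only: power_one_right simp_thms)
      qed
    qed
  qed
  finally show ?thesis .
qed

lemma norm_root_of_unity: "\<zeta> ^ n = 1 \<Longrightarrow> n \<ge> 1 \<Longrightarrow> norm (\<zeta>::complex) = 1"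
proof -
  assume "\<zeta> ^ n = 1" "n \<ge> 1"
  then have "norm \<zeta> ^ n = 1 ^ n" by (simp flip: norm_power)
  then show ?thesis by (rule power_eq_imp_eq_base) (use \<open>n \<ge> 1\<close> in auto)
qed

lemma cone_order_ge_1: "cone_order z \<ge> 1" by (simp add: cone_order_def)

lemma tri_cone_chart: "\<exists>r. cone_chart tri z (cone_order z) r"
proof (rule cone_chart_of_stabilizer[where M = "{\<zeta>. \<zeta> ^ 6 = 1}" and L = eis and c = 0])
  show "finite {\<zeta>::complex. \<zeta> ^ 6 = 1}" by (rule finite_nth_roots) simp
  show "norm \<zeta> = 1" if "\<zeta> \<in> {\<zeta>::complex. \<zeta> ^ 6 = 1}" for \<zeta>
    by (rule norm_root_of_unity[of \<zeta> 6]) (use that in auto)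
  show "discrete_at_distance eis" by (rule eisl_discrete) auto
  show "tri z = tri z' \<longleftrightarrow> (\<exists>\<zeta>\<in>{\<zeta>. \<zeta> ^ 6 = 1}. (z' - 0) - \<zeta> * (z - 0) \<in> eis)" for z z'
    unfolding diff_zero by (rule tri_eq_iff)
qed (rule cone_order_ge_1, rule tri_stabilizer)

definition pill_order :: "nat \<Rightarrow> nat \<Rightarrow> real \<Rightarrow> complex \<Rightarrow> nat" where
  "pill_order m n c z = (if 2 * (z - of_real c) \<in> eisl m n then 2 else 1)"

lemma pill_cone_chart:
  assumes "m > 0" "n > 0"
  shows "\<exists>r. cone_chart (pill m n c) z (pill_order m n c z) r"
proof (rule cone_chart_of_stabilizer[where M = "{1, - 1}" and L = "eisl m n" and c = "of_real c"])
  show "discrete_at_distance (eisl m n)" by (rule eisl_discrete[OF assms])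
  have e: "(z - of_real c) - (- 1) * (z - of_real c) = 2 * (z - of_real c)" by simp
  show "{\<zeta> \<in> {1, - 1}. (z - of_real c) - \<zeta> * (z - of_real c) \<in> eisl m n} = {\<zeta>. \<zeta> ^ pill_order m n c z = 1}"
    using e by (auto simp: pill_order_def power2_eq_1_iff)
qed (auto simp: pill_order_def pill_eq_iff)

section \<open>Continuity and surjectivity of the orbit maps, compact sets meeting all
  orbits\<close>

lemma continuous_on_pill: "m > 0 \<Longrightarrow> n > 0 \<Longrightarrow> continuous_on UNIV (pill m n c)"
  unfolding pill_def by (intro continuous_on_pillow continuous_intros continuous_on_coord) auto

lemma continuous_on_tri: "continuous_on UNIV tri"
  unfolding tri_def
  by (rule continuous_on_compose2[OF continuous_on_cube_fold]) (auto intro: continuous_on_pillow continuous_on_coord)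

lemma coord_exists: "\<exists>z. scoord z = s \<and> tcoord z = t"
proof (intro exI conjI)
  show "scoord (of_real s + of_real t * eomega) = s" "tcoord (of_real s + of_real t * eomega) = t"
    using coord_eomega[of "of_real t"] by (simp_all only: coord_add mult.commute[of "of_real t" eomega] coord_of_real)
qed

lemma pill_range:
  assumes "m > 0" "n > 0"
  shows "range (pill m n c) = R3_sphere"
proof
  show "range (pill m n c) \<subseteq> R3_sphere" using pillow_sphere by (auto simp: pill_def)
  show "R3_sphere \<subseteq> range (pill m n c)"
  proof
    fix v assume "v \<in> R3_sphere"
    then obtain s t where st: "pillow s t = v" using pillow_surj by blast
    obtain z where "scoord z = m * s + c" "tcoord z = n * t" using coord_exists by blast
    then have "pill m n c z = v" using assms st by (simp add: pill_def)
    then show "v \<in> range (pill m n c)" by blast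
  qed
qed

lemma tri_range: "range tri = R3_sphere"
proof
  show "range tri \<subseteq> R3_sphere" using pillow_sphere by (auto simp: tri_def norm_cube_fold)
  show "R3_sphere \<subseteq> range tri"
  proof
    fix v assume v: "v \<in> R3_sphere"
    obtain v' where v': "cube_fold v' = v" using cube_fold_surj by blast
    then have "v' \<in> R3_sphere" using v norm_cube_fold[of v'] by simp
    then obtain s t where st: "pillow s t = v'" using pillow_surj by blast
    obtain z where "scoord z = s" "tcoord z = t" using coord_exists by blast
    then have "tri z = v" using v' st by (simp add: tri_def)
    then show "v \<in> range tri" by blast
  qed
qed

text \<open>A disc about 0 that contains the period parallelogram, since |eomega| = 1.\<close>

definition lattice_cell :: "nat \<Rightarrow> nat \<Rightarrow> complex set" where
  "lattice_cell m n = cball 0 (m + n)"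

lemma lattice_cell:
  assumes "m > 0" "n > 0"
  shows "\<exists>k\<in>lattice_cell m n. k - z \<in> eisl m n"
proof -
  obtain k where k: "scoord k = m * frac (scoord z / m)" "tcoord k = n * frac (tcoord z / n)"
    using coord_exists by blast
  have "k - z \<in> eisl m n"
  proof -
    have "scoord (k - z) / m = - of_int \<lfloor>scoord z / m\<rfloor>" "tcoord (k - z) / n = - of_int \<lfloor>tcoord z / n\<rfloor>"
      unfolding coord_diff k using assms by (simp_all add: frac_def field_simps)
    then show ?thesis by (simp add: eisl_def)
  qed
  moreover have "norm k \<le> m + n"
  proof -
    have f1: "frac x \<le> 1" for x :: real using frac_lt_1[of x] by simp
    have f: "m * frac (scoord z / m) \<le> m" "n * frac (tcoord z / n) \<le> n"
      using f1 by (simp_all add: mult_left_le)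
    have "k = of_real (scoord k) + of_real (tcoord k) * eomega" by (rule coord_inverse[symmetric])
    then have "norm k \<le> norm (of_real (scoord k) :: complex) + norm (of_real (tcoord k) * eomega)"
      using norm_triangle_ineq by metis
    also have "norm eomega = 1" by (simp add: cmod_def power2_eq_square)
    then have "norm (of_real (tcoord k) * eomega) = \<bar>tcoord k\<bar>" by (simp only: norm_mult norm_of_real mult_1_right)
    finally have "norm k \<le> \<bar>scoord k\<bar> + \<bar>tcoord k\<bar>" by simp
    also have "\<dots> \<le> m + n" unfolding k using f by (simp add: abs_mult)
    finally show ?thesis .
  qed
  ultimately show ?thesis by (intro bexI[of _ k]) (auto simp: lattice_cell_def)
qed

text \<open>The saturation is the union of the preimages of \<open>U\<close> under the affine maps
  of the group.\<close>

lemma rotation_saturation_open: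
  assumes \<pi>: "\<And>z z'. \<pi> z = \<pi> z' \<longleftrightarrow> (\<exists>\<zeta>\<in>M. (z' - c) - \<zeta> * (z - c) \<in> (L :: complex set))"
    and U: "open U"
  shows "open {z. \<exists>u\<in>U. \<pi> u = \<pi> z}"
proof -
  have eq: "{z. \<exists>u\<in>U. \<pi> u = \<pi> z} = (\<Union>\<zeta>\<in>M. \<Union>l\<in>L. {z. \<zeta> * (z - c) + l + c \<in> U})"
  proof (intro equalityI subsetI)
    fix z assume "z \<in> {z. \<exists>u\<in>U. \<pi> u = \<pi> z}"
    then obtain u where u: "u \<in> U" "\<pi> z = \<pi> u" by auto
    then obtain \<zeta> where \<zeta>: "\<zeta> \<in> M" "(u - c) - \<zeta> * (z - c) \<in> L" using \<pi> by blast
    have "\<zeta> * (z - c) + ((u - c) - \<zeta> * (z - c)) + c \<in> U" using u by simp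
    then show "z \<in> (\<Union>\<zeta>\<in>M. \<Union>l\<in>L. {z. \<zeta> * (z - c) + l + c \<in> U})" using \<zeta> by blast
  next
    fix z assume "z \<in> (\<Union>\<zeta>\<in>M. \<Union>l\<in>L. {z. \<zeta> * (z - c) + l + c \<in> U})"
    then obtain \<zeta> l where h: "\<zeta> \<in> M" "l \<in> L" "\<zeta> * (z - c) + l + c \<in> U" by blast
    let ?u = "\<zeta> * (z - c) + l + c"
    have "(?u - c) - \<zeta> * (z - c) \<in> L" using h by simp
    then have "\<pi> z = \<pi> ?u" using \<pi> h(1) by blast
    then show "z \<in> {z. \<exists>u\<in>U. \<pi> u = \<pi> z}" using h(3) by force
  qed
  have "open {z. \<zeta> * (z - c) + l + c \<in> U}" for \<zeta> l
  proof -
    have "open ((\<lambda>z. \<zeta> * (z - c) + l + c) -` U)" by (rule open_vimage[OF U]) (intro continuous_intros)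
    then show ?thesis by (simp add: vimage_def)
  qed
  then show ?thesis unfolding eq by (intro open_UN ballI)
qed


section \<open>The three special fibres of \<open>tri\<close>\<close>

abbreviation cone3 :: complex where "cone3 \<equiv> (2 + eomega) / 3"

lemma tri_eqI: "\<zeta> ^ 6 = 1 \<Longrightarrow> z' - \<zeta> * z \<in> eis \<Longrightarrow> tri z = tri z'"
  unfolding tri_eq_iff by blast

lemma coord_half: "scoord (1 / 2) = 1 / 2" "tcoord (1 / 2) = 0"
  using coord_of_real[of "1 / 2"] by simp_all

lemma half_notin_Ints: "(1 / 2 :: real) \<notin> \<int>"
proof
  assume "(1 / 2 :: real) \<in> \<int>"
  then obtain k :: int where "1 / 2 = (of_int k :: real)" by (metis Ints_cases)
  then have "of_int (2 * k) = (of_int 1 :: real)" by simp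
  then have "2 * k = 1" by (simp only: of_int_eq_iff)
  then show False by presburger
qed

lemma cone_order_6: "cone_order z = 6 \<longleftrightarrow> z \<in> eis"
  by (simp add: cone_order_def)

lemma cone_order_2: "cone_order z = 2 \<longleftrightarrow> z \<notin> eis \<and> 2 * z \<in> eis"
  by (simp add: cone_order_def)

lemma cone_order_3: "cone_order z = 3 \<longleftrightarrow> z \<notin> eis \<and> (1 - eomega) * z \<in> eis"
  using eis_2_3[of z] by (auto simp: cone_order_def)

lemma cone_order_tri: "tri z = tri z' \<Longrightarrow> cone_order z = cone_order z'"
proof -
  assume "tri z = tri z'"
  then obtain \<zeta> where "\<zeta> ^ 6 = 1" and d: "z' - \<zeta> * z \<in> eis" unfolding tri_eq_iff by blast
  have unit: "\<zeta> * w \<in> eis \<longleftrightarrow> w \<in> eis" for w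
    using \<open>\<zeta> ^ 6 = 1\<close> unfolding sixth_roots
    by (elim disjE; simp only: mult_1_left mult_minus_left eisl_minus_iff eis_eomega_iff)
  have shift: "a \<in> eis \<longleftrightarrow> b \<in> eis" if "a - b \<in> eis" for a b
    using eisl_add[OF that, of b] eisl_diff[OF _ that, of a] by auto
  have "z' \<in> eis \<longleftrightarrow> z \<in> eis" using shift[OF d] unit by blast
  moreover have "2 * z' \<in> eis \<longleftrightarrow> 2 * z \<in> eis"
  proof -
    have "2 * z' - \<zeta> * (2 * z) = 2 * (z' - \<zeta> * z)" by (simp add: algebra_simps)
    then have "2 * z' - \<zeta> * (2 * z) \<in> eis" using eis_mult(1)[OF d] by (simp only:)
    from shift[OF this] unit show ?thesis by blast
  qed
  moreover have "(1 - eomega) * z' \<in> eis \<longleftrightarrow> (1 - eomega) * z \<in> eis"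
  proof -
    have "(1 - w) * z' - \<zeta> * ((1 - w) * z) = (1 - w) * (z' - \<zeta> * z)" for w :: complex
      by (simp add: algebra_simps)
    then have "(1 - eomega) * z' - \<zeta> * ((1 - eomega) * z) \<in> eis" using eis_mult(2)[OF d] by (simp only:)
    from shift[OF this] unit show ?thesis by blast
  qed
  ultimately show ?thesis by (simp only: cone_order_def)
qed

lemma tri_of_cone_order_6: "cone_order z = 6 \<Longrightarrow> tri 0 = tri z"
  unfolding cone_order_6 by (rule tri_eqI[of 1]) simp_all

lemma coord_two: "scoord (2 * z) = 2 * scoord z" "tcoord (2 * z) = 2 * tcoord z"
  using coord_add[of z z] by (simp_all only: mult_2)

lemma Ints_two_cases:
  assumes "2 * x \<in> (\<int> :: real set)"
  shows "x \<in> \<int> \<or> x - 1 / 2 \<in> \<int>"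
proof -
  obtain k :: int where k: "2 * x = of_int k" using assms by (metis Ints_cases)
  show ?thesis
  proof (cases "even k")
    case True
    then obtain l where "k = 2 * l" by blast
    then have "x = of_int l" using k by simp
    then show ?thesis by simp
  next
    case False
    then obtain l where "k = 2 * l + 1" by (blast elim: oddE)
    then have "x - 1 / 2 = of_int l" using k by simp
    then show ?thesis by (metis Ints_of_int)
  qed
qed

text \<open>Modulo \<open>eis\<close> there are three classes of halves of lattice points outside
  the lattice. They are represented by 1 / 2 and its multiples by \<open>eomega\<close> and
  \<open>- eomega\<^sup>2\<close>, so the units permute them transitively.\<close>

lemma tri_of_cone_order_2:
  assumes "cone_order z = 2"
  shows "tri (1 / 2) = tri z"
proof -
  have z: "\<not> (scoord z \<in> \<int> \<and> tcoord z \<in> \<int>)" "2 * scoord z \<in> \<int>" "2 * tcoord z \<in> \<int>"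
    using assms unfolding cone_order_2 eis_iff coord_two by auto
  have e: "scoord (eomega * (1 / 2)) = 0" "tcoord (eomega * (1 / 2)) = 1 / 2"
    unfolding coord_eomega coord_half by simp_all
  have e2: "scoord (eomega\<^sup>2 * (1 / 2)) = - 1 / 2" "tcoord (eomega\<^sup>2 * (1 / 2)) = - 1 / 2"
    unfolding power2_eq_square mult.assoc coord_eomega e using coord_half by simp_all
  have r: "(1::complex) ^ 6 = 1" "eomega ^ 6 = 1" "(- eomega\<^sup>2) ^ 6 = 1" unfolding sixth_roots by simp_all
  consider "scoord z - 1 / 2 \<in> \<int>" "tcoord z \<in> \<int>" | "scoord z \<in> \<int>" "tcoord z - 1 / 2 \<in> \<int>"
    | "scoord z - 1 / 2 \<in> \<int>" "tcoord z - 1 / 2 \<in> \<int>"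
    using Ints_two_cases[OF z(2)] Ints_two_cases[OF z(3)] z(1) by blast
  then show ?thesis
  proof cases
    case 1
    then show ?thesis
      by (intro tri_eqI[OF r(1)]) (simp only: eis_iff coord_diff mult_1_left coord_half, simp)
  next
    case 2
    then show ?thesis by (intro tri_eqI[OF r(2)]) (simp only: eis_iff coord_diff e, simp)
  next
    case 3
    then show ?thesis
      by (intro tri_eqI[OF r(3)]) (simp only: eis_iff coord_diff coord_minus mult_minus_left e2, simp)
  qed
qed

text \<open>\<open>cone3\<close> is the centroid of the triangle 0, 1, 1 + eomega; its product with
  1 - eomega is 1.\<close>

lemma coord_cone3: "scoord cone3 = 2 / 3" "tcoord cone3 = 1 / 3"
proof -
  have "cone3 = of_real (2 / 3) + eomega * of_real (1 / 3)" by (simp add: field_simps)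
  then have "scoord cone3 = scoord (of_real (2 / 3) + eomega * of_real (1 / 3))"
    "tcoord cone3 = tcoord (of_real (2 / 3) + eomega * of_real (1 / 3))" by (simp_all only:)
  then show "scoord cone3 = 2 / 3" "tcoord cone3 = 1 / 3"
    by (simp_all only: coord_add coord_eomega coord_of_real)
qed

lemma coord_one_minus_eomega:
  "scoord ((1 - eomega) * z) = scoord z + tcoord z" "tcoord ((1 - eomega) * z) = 2 * tcoord z - scoord z"
  unfolding left_diff_distrib mult_1_left coord_diff coord_eomega by simp_all

text \<open>The coordinates of z are thirds of integers, and modulo \<open>eis\<close> only 0,
  \<open>cone3\<close> and \<open>- cone3\<close> are possible; 3 * tcoord z modulo 3 tells them
  apart.\<close>

lemma tri_of_cone_order_3:
  assumes "cone_order z = 3"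
  shows "tri cone3 = tri z"
proof -
  have z: "\<not> (scoord z \<in> \<int> \<and> tcoord z \<in> \<int>)" "scoord z + tcoord z \<in> \<int>" "2 * tcoord z - scoord z \<in> \<int>"
    using assms unfolding cone_order_3 eis_iff coord_one_minus_eomega by auto
  obtain k :: int where k: "scoord z + tcoord z = of_int k" using z(2) by (metis Ints_cases)
  obtain l :: int where "2 * tcoord z - scoord z = of_int l" using z(3) by (metis Ints_cases)
  then have t: "3 * tcoord z = of_int (k + l)" and s: "3 * scoord z = of_int (2 * k - l)" using k by simp_all
  have r: "(1::complex) ^ 6 = 1" "(- 1 :: complex) ^ 6 = 1" by simp_all
  define q where "q = (k + l) div 3"
  have "(k + l) mod 3 = 0 \<or> (k + l) mod 3 = 1 \<or> (k + l) mod 3 = 2" by presburger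
  moreover have "k + l = 3 * q + (k + l) mod 3" by (simp add: q_def)
  ultimately consider "k + l = 3 * q" | "k + l = 3 * q + 1" | "k + l = 3 * q + 2" by fastforce
  then show ?thesis
  proof cases
    case 1
    then have "tcoord z = of_int q" using t by simp
    moreover from this have "scoord z = of_int (k - q)" using k by simp
    ultimately show ?thesis using z(1) by (metis Ints_of_int)
  next
    case 2
    then have "tcoord z - 1 / 3 = of_int q" using t by simp
    moreover from this have "scoord z - 2 / 3 = of_int (k - q - 1)" using k by simp
    ultimately show ?thesis
      by (intro tri_eqI[OF r(1)]) (simp only: eis_iff coord_diff mult_1_left coord_cone3 Ints_of_int simp_thms)
  next
    case 3
    then have "tcoord z - (- (1 / 3)) = of_int (q + 1)" using t by simp
    moreover from this have "scoord z - (- (2 / 3)) = of_int (k - q)" using k by simp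
    ultimately show ?thesis
      by (intro tri_eqI[OF r(2)])
        (simp only: eis_iff coord_diff coord_minus mult_minus_left mult_1_left coord_cone3 Ints_of_int simp_thms)
  qed
qed

lemma cone_order_special: "cone_order 0 = 6" "cone_order (1 / 2) = 2" "cone_order cone3 = 3"
proof -
  show "cone_order 0 = 6" unfolding cone_order_6 by simp
  show "cone_order (1 / 2) = 2"
    unfolding cone_order_2 eis_iff coord_two coord_half using half_notin_Ints by simp
  have "(1 / 3 :: real) \<notin> \<int>"
  proof
    assume "(1 / 3 :: real) \<in> \<int>"
    then obtain k :: int where "1 / 3 = (of_int k :: real)" by (metis Ints_cases)
    then have "of_int (3 * k) = (of_int 1 :: real)" by simp
    then have "3 * k = 1" by (simp only: of_int_eq_iff)
    then show False by presburger
  qed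
  then show "cone_order cone3 = 3"
    unfolding cone_order_3 eis_iff coord_one_minus_eomega coord_cone3 by simp
qed

text \<open>Each stabilizer order above 1 belongs to a single orbit, so the quotient has exactly one
  cone point of each of the orders 2, 3, 6.\<close>

lemma tri_special_iff:
  "tri z = tri 0 \<longleftrightarrow> cone_order z = 6" "tri z = tri (1 / 2) \<longleftrightarrow> cone_order z = 2"
  "tri z = tri cone3 \<longleftrightarrow> cone_order z = 3"
  using cone_order_tri[of z] tri_of_cone_order_6[of z] tri_of_cone_order_2[of z] tri_of_cone_order_3[of z]
    cone_order_special by metis+

lemma cone_order_cases: "cone_order z = 1 \<or> cone_order z = 2 \<or> cone_order z = 3 \<or> cone_order z = 6"
  by (simp add: cone_order_def)

lemma sphere_homeomorphism:
  assumes "X homeomorphic_space S2"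
  obtains k where "homeomorphic_map (top_of_set R3_sphere) X k"
  using homeomorphic_R3_sphere[OF assms] homeomorphic_space_sym by (metis homeomorphic_space)

lemma image_mset_two_values:
  assumes "finite F" "A \<subseteq> F" "\<And>x. x \<in> A \<Longrightarrow> D x = u" "\<And>x. x \<in> F - A \<Longrightarrow> D x = v"
  shows "image_mset D (mset_set F) = replicate_mset (card A) u + replicate_mset (card (F - A)) v"
proof -
  have fin: "finite A" "finite (F - A)" using assms finite_subset by auto
  have const: "image_mset D (mset_set S) = replicate_mset (card S) w" if "finite S" "\<And>x. x \<in> S \<Longrightarrow> D x = w" for S w
  proof -
    have "image_mset D (mset_set S) = image_mset (\<lambda>_. w) (mset_set S)"
      using that by (intro image_mset_cong) simp
    then show ?thesis by (simp add: image_mset_const_eq)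
  qed
  have "mset_set F = mset_set A + mset_set (F - A)"
    using mset_set_Union[OF fin] assms(2) by (simp add: Un_absorb1)
  then show ?thesis using const[OF fin(1) assms(3)] const[OF fin(2) assms(4)] by simp
qed

section \<open>Covers induced by sublattices\<close>

text \<open>The reflection in \<open>c\<close> is z -> 2 * c - z. It belongs to the group of
  \<open>tri\<close> because 2 * c is an integer; the parity of 2 * c decides how its fixed points
  lie relative to \<open>eis\<close>.\<close>

locale lattice_cover =
  fixes X :: "'a topology" and Y :: "'b topology" and kX kY and m n :: nat and c :: real
  assumes X: "X homeomorphic_space S2" and Y: "Y homeomorphic_space S2"
    and kX: "homeomorphic_map (top_of_set R3_sphere) X kX" and kY: "homeomorphic_map (top_of_set R3_sphere) Y kY"
    and m: "m > 0" and n: "n > 0" and c: "2 * c \<in> \<int>"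
begin

definition "P z = kX (pill m n c z)"
definition "Q z = kY (tri z)"
definition "f x = Q (SOME z. P z = x)"

lemma in_sphere: "pill m n c z \<in> R3_sphere" "tri z \<in> R3_sphere"
  using pill_range[OF m n, of c] tri_range by blast+

lemma P_eq: "P z = P z' \<longleftrightarrow> pill m n c z = pill m n c z'"
  using inj_on_eq_iff[of kX R3_sphere] homeomorphic_imp_injective_map[OF kX] in_sphere unfolding P_def by simp

lemma Q_eq: "Q z = Q z' \<longleftrightarrow> tri z = tri z'"
  using inj_on_eq_iff[of kY R3_sphere] homeomorphic_imp_injective_map[OF kY] in_sphere unfolding Q_def by simp

lemma P_range: "range P = topspace X"
proof -
  have "range P = kX ` range (pill m n c)" by (auto simp: P_def)
  then show ?thesis using pill_range[OF m n] homeomorphic_imp_surjective_map[OF kX] by simp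
qed

lemma Q_range: "range Q = topspace Y"
proof -
  have "range Q = kY ` range tri" by (auto simp: Q_def)
  then show ?thesis using tri_range homeomorphic_imp_surjective_map[OF kY] by simp
qed

lemma P_cont: "continuous_map euclidean X P"
proof -
  have "continuous_map euclidean (top_of_set R3_sphere) (pill m n c)"
    using continuous_on_pill[OF m n] in_sphere by (intro continuous_map_into_subtopology) auto
  then have "continuous_map euclidean X (kX \<circ> pill m n c)"
    by (rule continuous_map_compose[OF _ homeomorphic_imp_continuous_map[OF kX]])
  then show ?thesis by (simp add: P_def[abs_def] o_def)
qed

lemma Q_cont: "continuous_map euclidean Y Q"
proof -
  have "continuous_map euclidean (top_of_set R3_sphere) tri"
    using continuous_on_tri in_sphere by (intro continuous_map_into_subtopology) auto
  then have "continuous_map euclidean Y (kY \<circ> tri)"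
    by (rule continuous_map_compose[OF _ homeomorphic_imp_continuous_map[OF kY]])
  then show ?thesis by (simp add: Q_def[abs_def] o_def)
qed

lemma P_eq_iff: "P z = P z' \<longleftrightarrow> (\<exists>\<zeta>\<in>{1, - 1}. (z' - of_real c) - \<zeta> * (z - of_real c) \<in> eisl m n)"
  unfolding P_eq by (rule pill_eq_iff)

lemma P_eqI: "z' - z \<in> eisl m n \<Longrightarrow> P z = P z'"
  unfolding P_eq_iff by simp

lemma Q_eq_iff: "Q z = Q z' \<longleftrightarrow> (\<exists>\<zeta>\<in>{\<zeta>. \<zeta> ^ 6 = 1}. (z' - 0) - \<zeta> * (z - 0) \<in> eis)"
  unfolding Q_eq diff_zero by (rule tri_eq_iff)

lemma P_open:
  assumes "open U"
  shows "openin X (P ` U)"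
proof (rule orbit_map_open[OF P_cont sphere_Hausdorff[OF X] P_range _ _ _ assms])
  show "compact (lattice_cell m n)" by (simp add: lattice_cell_def)
  show "\<exists>k\<in>lattice_cell m n. P k = P z" for z
  proof -
    obtain k where k: "k \<in> lattice_cell m n" "k - z \<in> eisl m n" using lattice_cell[OF m n] by blast
    then show ?thesis using P_eqI[OF k(2)] by auto
  qed
  show "open {z. \<exists>u\<in>U. P u = P z}" if "open U" for U
    by (rule rotation_saturation_open[OF P_eq_iff that])
qed

lemma Q_open:
  assumes "open U"
  shows "openin Y (Q ` U)"
proof (rule orbit_map_open[OF Q_cont sphere_Hausdorff[OF Y] Q_range _ _ _ assms])
  show "compact (lattice_cell 1 1)" by (simp add: lattice_cell_def)
  show "\<exists>k\<in>lattice_cell 1 1. Q k = Q z" for z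
  proof -
    obtain k where k: "k \<in> lattice_cell 1 1" "k - z \<in> eis" using lattice_cell[of 1 1 z] by auto
    have "Q z = Q k" unfolding Q_eq by (rule tri_eqI[of 1]) (use k in auto)
    then show ?thesis using k by auto
  qed
  show "open {z. \<exists>u\<in>U. Q u = Q z}" if "open U" for U
    by (rule rotation_saturation_open[OF Q_eq_iff that])
qed

lemma two_c: "of_real (2 * c) \<in> eis"
  unfolding eis_iff coord_of_real using c by simp

text \<open>The group of \<open>pill\<close> is contained in that of \<open>tri\<close>, so the
  choice made in \<open>f\<close> is immaterial.\<close>

lemma P_imp_Q:
  assumes "P z = P z'"
  shows "Q z = Q z'"
proof -
  consider "z' - of_real c - 1 * (z - of_real c) \<in> eisl m n" | "z' - of_real c - (- 1) * (z - of_real c) \<in> eisl m n"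
    using assms unfolding P_eq_iff by blast
  then show ?thesis
  proof cases
    case 1
    have "z' - of_real c - 1 * (z - of_real c) \<in> eis" by (rule eisl_subset_eis[OF m n 1])
    also have "z' - of_real c - 1 * (z - of_real c) = z' - 1 * z" by simp
    finally show ?thesis unfolding Q_eq by (rule tri_eqI[rotated]) simp
  next
    case 2
    have "z' - of_real c - (- 1) * (z - of_real c) + of_real (2 * c) \<in> eis"
      by (rule eisl_add[OF eisl_subset_eis[OF m n 2] two_c])
    also have "z' - of_real c - (- 1) * (z - of_real c) + of_real (2 * c) = z' - (- 1) * z" by simp
    finally show ?thesis unfolding Q_eq by (rule tri_eqI[rotated]) simp
  qed
qed

lemma f_P: "f (P z) = Q z"
proof -
  have "P (SOME w. P w = P z) = P z" by (rule someI) (rule refl)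
  then show ?thesis unfolding f_def by (rule P_imp_Q)
qed

abbreviation "po \<equiv> pill_order m n c"

lemma special_two:
  assumes "2 * (z - of_real c) \<in> eisl m n"
  shows "2 * z \<in> eis"
proof -
  have "2 * (z - of_real c) + of_real (2 * c) \<in> eis" by (rule eisl_add[OF eisl_subset_eis[OF m n assms] two_c])
  also have "2 * (z - of_real c) + of_real (2 * c) = 2 * z" by simp
  finally show ?thesis .
qed

lemma po_dvd: "po z dvd cone_order z"
  using special_two[of z] by (auto simp: pill_order_def cone_order_def)

lemma lp: "locally_power X Y f (P z) (cone_order z div po z)"
proof -
  obtain r where r: "cone_chart tri z (cone_order z) r" using tri_cone_chart by blast
  obtain r' where r': "cone_chart (pill m n c) z (po z) r'" using pill_cone_chart[OF m n] by blast
  have 1: "cone_chart Q z (cone_order z) r" using r by (simp add: cone_chart_def Q_eq)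
  have 2: "cone_chart P z (po z) r'" using r' by (simp add: cone_chart_def P_eq)
  have "po z \<ge> 1" by (simp add: pill_order_def)
  then show ?thesis
    using locally_power_quotient[OF P_cont P_open Q_cont Q_open f_P _ 2 cone_order_ge_1 1 po_dvd] by blast
qed

lemma f_cont: "continuous_map X Y f"
  unfolding continuous_map_def
proof (intro conjI allI impI)
  show "f \<in> topspace X \<rightarrow> topspace Y" unfolding P_range[symmetric] Q_range[symmetric] by (auto simp: f_P)
  fix V assume V: "openin Y V"
  have "open {z. Q z \<in> V}" using openin_continuous_map_preimage[OF Q_cont V] by simp
  then have "openin X (P ` {z. Q z \<in> V})" by (rule P_open)
  also have "P ` {z. Q z \<in> V} = {x \<in> topspace X. f x \<in> V}"
    unfolding P_range[symmetric] by (auto simp: f_P)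
  finally show "openin X {x \<in> topspace X. f x \<in> V}" .
qed

lemma bc: "branched_cover X Y f"
  unfolding branched_cover_def P_range[symmetric] using f_cont lp by blast

abbreviation "D \<equiv> local_degree X Y f"

lemma D_P: "D (P z) = cone_order z div po z"
  by (rule local_degree_eqI[OF lp]) (use P_range in blast)

lemma pc: "power_cover X Y f D"
  by (rule power_cover_branched_cover[OF bc sphere_compact[OF X] sphere_Hausdorff[OF X] sphere_Hausdorff[OF Y]])

lemma fibre_Q: "fibre X f (Q w) = P ` {z. Q z = Q w}"
  unfolding fibre_def P_range[symmetric] by (auto simp: f_P)

lemma fibre_special:
  "fibre X f (Q 0) = P ` {z. cone_order z = 6}" "fibre X f (Q (1 / 2)) = P ` {z. cone_order z = 2}"
  "fibre X f (Q cone3) = P ` {z. cone_order z = 3}"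
  unfolding fibre_Q Q_eq tri_special_iff by (rule refl)+

lemma fibre_finite: "finite (fibre X f (Q w))"
  using power_cover_weight_constant(2)[OF pc sphere_connected[OF Y], of "Q w" "Q w"] Q_range by blast

section \<open>The degree, counted on lattice points\<close>

definition "node p = of_real (real (fst p)) + of_real (real (snd p)) * eomega"
definition "grid = {..<m} \<times> {..<n}"

lemma coord_node: "scoord (node p) = real (fst p)" "tcoord (node p) = real (snd p)"
  unfolding node_def mult.commute[of _ eomega] coord_add coord_eomega coord_of_real by simp_all

text \<open>Together with \<open>node_exists\<close>: the nodes of the grid represent every coset of
  \<open>eisl m n\<close> in \<open>eis\<close> once, so the index is m * n.\<close>

lemma node_unique:
  assumes "p \<in> grid" "q \<in> grid" "node p - w \<in> eisl m n" "node q - w \<in> eisl m n"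
  shows "p = q"
proof -
  have "node p - w - (node q - w) \<in> eisl m n" by (rule eisl_diff[OF assms(3,4)])
  then have "node p - node q \<in> eisl m n" by simp
  then have i: "(real (fst p) - real (fst q)) / m \<in> \<int>" "(real (snd p) - real (snd q)) / n \<in> \<int>"
    unfolding eisl_def mem_Collect_eq coord_diff coord_node by auto
  have eq: "a = b" if ab: "(real a - real b) / real k \<in> \<int>" "a < k" "b < k" for a b k
  proof -
    obtain l :: int where "(real a - real b) / real k = of_int l" using ab(1) by (metis Ints_cases)
    then have "real a - real b = of_int l * real k" using ab by (simp add: field_simps)
    then have "real_of_int (int a - int b) = of_int (l * int k)" by simp
    then have e: "int a - int b = l * int k" by (simp only: of_int_eq_iff)
    have "\<bar>l * int k\<bar> < int k" using e ab by linarith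
    then have "\<bar>l\<bar> * int k < 1 * int k" by (simp add: abs_mult)
    then have "\<bar>l\<bar> < 1" by (rule mult_right_less_imp_less) simp
    then show ?thesis using e by simp
  qed
  show ?thesis
    using eq[OF i(1)] eq[OF i(2)] assms(1,2) by (auto simp: grid_def mem_Times_iff prod_eq_iff)
qed

lemma node_exists:
  assumes "w \<in> eis"
  shows "\<exists>p\<in>grid. node p - w \<in> eisl m n"
proof -
  obtain s t :: int where st: "scoord w = of_int s" "tcoord w = of_int t"
    using assms unfolding eis_iff by (metis Ints_cases)
  have ex: "\<exists>i<k. (real i - of_int s) / real k \<in> \<int>" if k: "k > 0" for s :: int and k :: nat
  proof (intro exI conjI)
    show "nat (s mod int k) < k" using k by (simp add: nat_less_iff)
    have "int (nat (s mod int k)) = s - int k * (s div int k)"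
      using k by (simp add: minus_mult_div_eq_mod)
    then have "real_of_int (int (nat (s mod int k))) = of_int (s - int k * (s div int k))"
      by (rule arg_cong[where f = real_of_int])
    then have "real (nat (s mod int k)) = of_int s - real k * of_int (s div int k)"
      by (simp only: of_int_of_nat_eq of_int_diff of_int_mult)
    then have "real (nat (s mod int k)) - of_int s = real k * of_int (- (s div int k))"
      by (simp only: of_int_minus) algebra
    then have "(real (nat (s mod int k)) - of_int s) / real k = of_int (- (s div int k))" using k by simp
    then show "(real (nat (s mod int k)) - of_int s) / real k \<in> \<int>" by (simp only: Ints_of_int)
  qed
  obtain i j where "i < m" "(real i - of_int s) / real m \<in> \<int>" "j < n" "(real j - of_int t) / real n \<in> \<int>"
    using ex[OF m] ex[OF n] by metis
  then show ?thesis
    by (intro bexI[of _ "(i, j)"]) (simp_all add: grid_def eisl_def coord_diff coord_node st)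
qed

text \<open>The points over P z are the cosets of z and of its reflection w = 2 * c - z, with one
  node each; the two cosets coincide exactly if z is a cone point of the source.\<close>

lemma card_node_fibre:
  assumes z: "z \<in> eis"
  shows "card {p \<in> grid. P (node p) = P z} = (if po z = 2 then 1 else 2)"
proof -
  define w where "w = of_real (2 * c) - z"
  have w: "w \<in> eis" unfolding w_def by (rule eisl_diff[OF two_c z])
  obtain p where p: "p \<in> grid" "node p - z \<in> eisl m n" using node_exists[OF z] by blast
  obtain q where q: "q \<in> grid" "node q - w \<in> eisl m n" using node_exists[OF w] by blast
  have e: "x - of_real c - (- 1) * (z - of_real c) = x - w" "x - of_real c - 1 * (z - of_real c) = x - z" for x
    by (simp_all add: w_def)
  have "P (node r) = P z \<longleftrightarrow> node r - z \<in> eisl m n \<or> node r - w \<in> eisl m n" for r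
  proof -
    have "P (node r) = P z \<longleftrightarrow> P z = P (node r)" by auto
    also have "\<dots> \<longleftrightarrow> node r - z \<in> eisl m n \<or> node r - w \<in> eisl m n"
      unfolding P_eq_iff bex_simps e by (auto simp: e[simplified])
    finally show ?thesis .
  qed
  note iff = this
  have eq: "{r \<in> grid. P (node r) = P z} = {p, q}"
  proof (intro equalityI subsetI)
    fix r assume "r \<in> {r \<in> grid. P (node r) = P z}"
    then have r: "r \<in> grid" "node r - z \<in> eisl m n \<or> node r - w \<in> eisl m n" using iff by blast+
    from r(2) show "r \<in> {p, q}"
    proof
      assume "node r - z \<in> eisl m n"
      then have "r = p" using node_unique[OF r(1) p(1) _ p(2)] by blast
      then show ?thesis by simp
    next
      assume "node r - w \<in> eisl m n"
      then have "r = q" using node_unique[OF r(1) q(1) _ q(2)] by blast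
      then show ?thesis by simp
    qed
  next
    fix r assume "r \<in> {p, q}"
    then show "r \<in> {r \<in> grid. P (node r) = P z}" using iff p q by blast
  qed
  have "p = q \<longleftrightarrow> po z = 2"
  proof -
    have d: "2 * (z - of_real c) = z - w" by (simp add: w_def)
    have "p = q \<longleftrightarrow> z - w \<in> eisl m n"
    proof
      assume pq: "p = q"
      have "(node p - w) - (node p - z) \<in> eisl m n"
        by (rule eisl_diff) (use p(2) q(2) pq in simp_all)
      then show "z - w \<in> eisl m n" by simp
    next
      assume zw: "z - w \<in> eisl m n"
      have "(node p - z) + (z - w) \<in> eisl m n" by (rule eisl_add[OF p(2) zw])
      then have "node p - w \<in> eisl m n" by simp
      then show "p = q" by (rule node_unique[OF p(1) q(1) _ q(2)])
    qed
    then show ?thesis unfolding pill_order_def d by simp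
  qed
  then show ?thesis unfolding eq by (cases "p = q") auto
qed

text \<open>Counted over Q 0, where all preimages come from lattice points: the local degree is 6 if
  two nodes lie over the point of \<open>X\<close> and 3 if one does, in either case three times
  their number. Constancy of weights carries the sum to the other fibres.\<close>

lemma total_weight: "sum D (fibre X f (Q w)) = 3 * (m * n)"
proof -
  let ?F = "fibre X f (Q 0)"
  have "sum D ?F = (\<Sum>x\<in>?F. 3 * card {p \<in> grid. P (node p) = x})"
  proof (rule sum.cong[OF refl])
    fix x assume "x \<in> ?F"
    then obtain z where z: "x = P z" "cone_order z = 6" unfolding fibre_special by blast
    have "z \<in> eis" using z(2) by (simp only: cone_order_6)
    from card_node_fibre[OF this] show "D x = 3 * card {p \<in> grid. P (node p) = x}"
      unfolding z(1) D_P z(2) by (simp add: pill_order_def)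
  qed
  also have "\<dots> = 3 * (\<Sum>x\<in>?F. \<Sum>p\<in>{p \<in> grid. P (node p) = x}. 1)" by (simp add: sum_distrib_left)
  also have "(\<Sum>x\<in>?F. \<Sum>p\<in>{p \<in> grid. P (node p) = x}. 1) = (\<Sum>p\<in>grid. 1::nat)"
  proof (rule sum.group)
    show "(\<lambda>p. P (node p)) ` grid \<subseteq> ?F"
      unfolding fibre_special cone_order_6 eis_iff coord_node[abs_def]
      by (auto simp: eis_iff coord_node)
  qed (auto simp: grid_def fibre_finite)
  also have "\<dots> = m * n" by (simp add: grid_def)
  finally have "sum D ?F = 3 * (m * n)" .
  moreover have "sum D (fibre X f (Q w)) = sum D ?F"
    using power_cover_weight_constant(1)[OF pc sphere_connected[OF Y]] Q_range by blast
  ultimately show ?thesis by simp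
qed

section \<open>The four cone points of the source\<close>

definition "half_node p = of_real (c + real (fst p) * m / 2) + of_real (real (snd p) * n / 2) * eomega"
definition "corners = {0, 1::nat} \<times> {0, 1::nat}"

lemma coord_half_node:
  "scoord (half_node p) = c + real (fst p) * m / 2" "tcoord (half_node p) = real (snd p) * n / 2"
  unfolding half_node_def mult.commute[of _ eomega] coord_add coord_eomega coord_of_real by simp_all

text \<open>The half nodes are \<open>c\<close> plus halves of points of \<open>eisl m n\<close>,
  hence fixed by the reflection modulo that lattice.\<close>

lemma po_half_node: "po (half_node p) = 2"
proof -
  have "2 * (half_node p - of_real c) \<in> eisl m n"
    unfolding eisl_def mem_Collect_eq coord_two coord_diff coord_half_node coord_of_real using m n by simp
  then show ?thesis by (simp add: pill_order_def)
qed

lemma half_node_inj: "inj_on (\<lambda>p. P (half_node p)) corners"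
proof (rule inj_onI)
  fix p q assume pq: "p \<in> corners" "q \<in> corners" and e: "P (half_node p) = P (half_node q)"
  let ?a = "half_node q - of_real c" and ?b = "half_node p - of_real c"
  have s: "scoord ?a = real (fst q) * m / 2" "tcoord ?a = real (snd q) * n / 2"
    "scoord ?b = real (fst p) * m / 2" "tcoord ?b = real (snd p) * n / 2"
    unfolding coord_diff coord_half_node coord_of_real by simp_all
  \<comment> \<open>Different bits would make 1 / 2 an integer, whichever sign relates the two
    points.\<close>
  have bits: "a = b" if h: "(real b * k / 2 - real a * k / 2) / k \<in> \<int> \<or> (real b * k / 2 + real a * k / 2) / k \<in> \<int>"
    "a \<in> {0, 1}" "b \<in> {0, 1}" "k > 0" for a b k :: nat
  proof (rule ccontr)
    assume "a \<noteq> b"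
    then consider "a = 0" "b = 1" | "a = 1" "b = 0" using h(2,3) by auto
    then have "(1 / 2 :: real) \<in> \<int> \<or> - (1 / 2 :: real) \<in> \<int>"
      by cases (use h(1,4) in auto)
    then show False using half_notin_Ints Ints_minus[of "- (1 / 2 :: real)"] by auto
  qed
  from e consider "?a - 1 * ?b \<in> eisl m n" | "?a - (- 1) * ?b \<in> eisl m n" unfolding P_eq_iff by blast
  then have "((real (fst q) * m / 2 - real (fst p) * m / 2) / m \<in> \<int> \<or> (real (fst q) * m / 2 + real (fst p) * m / 2) / m \<in> \<int>)
    \<and> ((real (snd q) * n / 2 - real (snd p) * n / 2) / n \<in> \<int> \<or> (real (snd q) * n / 2 + real (snd p) * n / 2) / n \<in> \<int>)"
  proof cases
    case 1
    then have "?a - ?b \<in> eisl m n" by simp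
    then show ?thesis unfolding eisl_def mem_Collect_eq coord_diff[of ?a] s by blast
  next
    case 2
    then have "?a + ?b \<in> eisl m n" by simp
    then show ?thesis unfolding eisl_def mem_Collect_eq coord_add[of ?a] s by blast
  qed
  then show "p = q"
    using bits[of "fst q" m "fst p"] bits[of "snd q" n "snd p"] pq m n
    unfolding corners_def by (simp only: mem_Times_iff prod_eq_iff simp_thms)
qed

lemma special_point:
  assumes "po z = 2"
  shows "\<exists>p\<in>corners. P z = P (half_node p)"
proof -
  have "2 * (z - of_real c) \<in> eisl m n" using assms by (simp add: pill_order_def split: if_splits)
  then have "2 * (scoord z - c) / m \<in> \<int>" "2 * tcoord z / n \<in> \<int>"
    unfolding eisl_def mem_Collect_eq coord_two coord_diff coord_of_real by simp_all
  then obtain k l :: int where kl: "2 * (scoord z - c) / m = of_int k" "2 * tcoord z / n = of_int l"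
    by (metis Ints_cases)
  have sz: "scoord z = c + of_int k * m / 2" "tcoord z = of_int l * n / 2"
    using kl m n by (simp_all add: field_simps)
  have par: "(real (nat (k mod 2)) - of_int k) / 2 \<in> \<int>" for k :: int
  proof -
    have "int (nat (k mod 2)) = k - 2 * (k div 2)" by (simp add: minus_mult_div_eq_mod)
    then have "real_of_int (int (nat (k mod 2))) = of_int (k - 2 * (k div 2))"
      by (rule arg_cong[where f = real_of_int])
    then have A: "real (nat (k mod 2)) = of_int k - 2 * of_int (k div 2)"
      by (simp only: of_int_of_nat_eq of_int_diff of_int_mult of_int_numeral)
    have "(real (nat (k mod 2)) - of_int k) / 2 = of_int (- (k div 2))" unfolding A by simp
    then show ?thesis by (simp only: Ints_of_int)
  qed
  \<comment> \<open>Reducing the half-indices modulo 2 moves z by a vector of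
    \<open>eisl m n\<close>.\<close>
  let ?p = "(nat (k mod 2), nat (l mod 2))"
  have "k mod 2 = 0 \<or> k mod 2 = 1" "l mod 2 = 0 \<or> l mod 2 = 1" by presburger+
  then have "?p \<in> corners" by (auto simp: corners_def)
  moreover have "half_node ?p - z \<in> eisl m n"
  proof -
    have "scoord (half_node ?p - z) / m = (real (nat (k mod 2)) - of_int k) / 2"
      unfolding coord_diff coord_half_node sz using m by (simp add: field_simps)
    moreover have "tcoord (half_node ?p - z) / n = (real (nat (l mod 2)) - of_int l) / 2"
      unfolding coord_diff coord_half_node sz using n by (simp add: field_simps)
    ultimately show ?thesis unfolding eisl_def mem_Collect_eq using par by (simp only: simp_thms)
  qed
  ultimately show ?thesis using P_eqI by blast
qed

lemma cone_order_half_node: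
  "cone_order (half_node p) = (if half_node p \<in> eis then 6 else 2)"
proof -
  have "2 * half_node p \<in> eis"
    by (rule special_two) (use po_half_node[of p] in \<open>simp add: pill_order_def split: if_splits\<close>)
  then show ?thesis by (simp add: cone_order_def)
qed

section \<open>Local degrees over the three branching points\<close>

definition "special_count b = card {p \<in> corners. cone_order (half_node p) = b}"

lemma special_count_values:
  "special_count 6 = card {p \<in> corners. half_node p \<in> eis}"
  "special_count 2 = 4 - special_count 6" "special_count 6 \<le> 4" "special_count 3 = 0"
proof -
  have e6: "{p \<in> corners. cone_order (half_node p) = 6} = {p \<in> corners. half_node p \<in> eis}"
    and e2: "{p \<in> corners. cone_order (half_node p) = 2} = corners - {p \<in> corners. half_node p \<in> eis}"
    and e3: "{p \<in> corners. cone_order (half_node p) = 3} = {}"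
    unfolding cone_order_half_node by auto
  have c4: "card corners = 4" "finite corners" by (simp_all add: corners_def)
  show "special_count 6 = card {p \<in> corners. half_node p \<in> eis}" unfolding special_count_def e6 ..
  show "special_count 6 \<le> 4" unfolding special_count_def e6 c4(1)[symmetric] by (rule card_mono) (auto simp: c4)
  show "special_count 2 = 4 - special_count 6"
    unfolding special_count_def e6 e2 c4(1)[symmetric] by (rule card_Diff_subset) (auto simp: c4(2))
  show "special_count 3 = 0" unfolding special_count_def e3 by simp
qed

text \<open>Corners of cone order \<open>b\<close> have local degree b div 2, the other points of
  the fibre have \<open>b\<close>, and the number of the latter follows from the total weight. For b
  = 3 there are no corners, so the rounded value of b div 2 never occurs.\<close>

lemma local_degrees_special:
  assumes F: "fibre X f (Q w) = P ` {z. cone_order z = b}"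
  shows "\<exists>B. local_degrees X Y f (Q w) = replicate_mset (special_count b) (b div 2) + replicate_mset B b \<and>
     special_count b * (b div 2) + B * b = 3 * (m * n)"
proof -
  let ?F = "fibre X f (Q w)"
  let ?A = "(\<lambda>p. P (half_node p)) ` {p \<in> corners. cone_order (half_node p) = b}"
  have A: "?A \<subseteq> ?F" unfolding F by auto
  have cardA: "card ?A = special_count b"
    unfolding special_count_def by (intro card_image inj_on_subset[OF half_node_inj]) auto
  have DA: "D x = b div 2" if "x \<in> ?A" for x
    using that by (auto simp: D_P po_half_node)
  have DB: "D x = b" if x: "x \<in> ?F - ?A" for x
  proof -
    obtain z where z: "x = P z" "cone_order z = b" using x unfolding F by blast
    have "po z \<noteq> 2"
    proof
      assume "po z = 2"
      then obtain p where p: "p \<in> corners" "P z = P (half_node p)" using special_point by blast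
      have "cone_order (half_node p) = b" using cone_order_tri[of z "half_node p"] P_imp_Q[OF p(2)] z(2) by (simp add: Q_eq)
      then have "x \<in> ?A" using p z(1) by auto
      then show False using x by blast
    qed
    then have "po z = 1" by (simp add: pill_order_def split: if_splits)
    then show ?thesis unfolding z(1) D_P z(2) by simp
  qed
  have ld: "local_degrees X Y f (Q w) = replicate_mset (special_count b) (b div 2) + replicate_mset (card (?F - ?A)) b"
    unfolding local_degrees_def cardA[symmetric] by (rule image_mset_two_values[OF fibre_finite A DA DB])
  have "sum D ?F = sum_mset (local_degrees X Y f (Q w))"
    unfolding local_degrees_def by (rule sum_unfold_sum_mset)
  then have "special_count b * (b div 2) + card (?F - ?A) * b = 3 * (m * n)"
    unfolding total_weight ld by simp
  with ld show ?thesis by blast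
qed

lemma D_one:
  assumes "y \<in> topspace Y" "y \<noteq> Q 0" "y \<noteq> Q (1 / 2)" "y \<noteq> Q cone3" "x \<in> fibre X f y"
  shows "D x = 1"
proof -
  obtain w where w: "y = Q w" using assms(1) Q_range by blast
  obtain z where z: "x = P z" "Q z = Q w" using assms(5) unfolding w fibre_Q by blast
  have "cone_order w = 1"
    using cone_order_cases[of w] assms(2-4) unfolding w Q_eq tri_special_iff by blast
  then have "cone_order z = 1" using cone_order_tri[of z w] z(2) by (simp add: Q_eq)
  then show ?thesis unfolding z(1) D_P using po_dvd[of z] by (simp add: pill_order_def split: if_splits)
qed

text \<open>The total weight fixes the number of points of each local degree, so the multiplicities
  found must be \<open>B6\<close>, \<open>B2\<close> and m * n. B2 \<ge> 1 provides a point of local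
  degree 2 over Q (1 / 2).\<close>

lemma realizable_lattice:
  assumes j: "j = card {p \<in> corners. half_node p \<in> eis}"
    and B6: "j * 3 + B6 * 6 = 3 * (m * n)" and B2: "(4 - j) + B2 * 2 = 3 * (m * n)" and B2': "B2 \<ge> 1"
  shows "realizable X Y (3 * (m * n))
    {# replicate_mset B2 2 + replicate_mset (4 - j) 1, replicate_mset (m * n) 3, replicate_mset B6 6 + replicate_mset j 3 #}"
proof -
  have j6: "special_count 6 = j" "special_count 2 = 4 - j" "special_count 3 = 0"
    using special_count_values j by simp_all
  obtain b6 where b6: "local_degrees X Y f (Q 0) = replicate_mset j 3 + replicate_mset b6 6" "j * 3 + b6 * 6 = 3 * (m * n)"
    using local_degrees_special[OF fibre_special(1)] unfolding j6 by auto
  obtain b2 where b2: "local_degrees X Y f (Q (1 / 2)) = replicate_mset (4 - j) 1 + replicate_mset b2 2" "(4 - j) + b2 * 2 = 3 * (m * n)"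
    using local_degrees_special[OF fibre_special(2)] unfolding j6 by auto
  obtain b3 where b3: "local_degrees X Y f (Q cone3) = replicate_mset b3 3" "b3 * 3 = 3 * (m * n)"
    using local_degrees_special[OF fibre_special(3)] unfolding j6 by auto
  have eqs: "b6 = B6" "b2 = B2" "b3 = m * n" using b6(2) B6 b2(2) B2 b3(2) by simp_all
  have ne: "Q 0 \<noteq> Q (1 / 2)" "Q 0 \<noteq> Q cone3" "Q (1 / 2) \<noteq> Q cone3"
    unfolding Q_eq tri_special_iff using cone_order_special by simp_all
  have mn: "m * n \<ge> 1" using m n by simp
  have br: "y \<in> branching_points X Y f" if "y \<in> topspace Y" "a \<in># local_degrees X Y f y" "a > 1" for y a
  proof -
    have "y \<in> range Q" using that(1) Q_range by simp
    then obtain w where w: "y = Q w" by blast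
    have "finite (fibre X f y)" unfolding w by (rule fibre_finite)
    then have "\<exists>x\<in>fibre X f y. local_degree X Y f x = a" using that(2) by (auto simp: local_degrees_def)
    then show ?thesis using that(1,3) by (auto simp: branching_points_def)
  qed
  have QY: "Q w \<in> topspace Y" for w using Q_range by blast
  have "j * 3 + B6 * 6 \<ge> 1" using B6 mn by simp
  then have "j \<ge> 1 \<or> B6 \<ge> 1" by linarith
  then have "Q 0 \<in> branching_points X Y f"
  proof
    assume "j \<ge> 1" then show ?thesis by (intro br[OF QY, where a = 3]) (auto simp: b6)
  next
    assume "B6 \<ge> 1" then show ?thesis by (intro br[OF QY, where a = 6]) (auto simp: b6 eqs)
  qed
  moreover have "Q (1 / 2) \<in> branching_points X Y f"
    using B2' by (intro br[OF QY, where a = 2]) (auto simp: b2(1) eqs)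
  moreover have "Q cone3 \<in> branching_points X Y f"
  proof -
    have "3 \<in># local_degrees X Y f (Q cone3)" unfolding b3(1) eqs using mn by simp
    then show ?thesis by (rule br[OF QY]) simp
  qed
  moreover have "y \<in> {Q (1 / 2), Q cone3, Q 0}" if "y \<in> branching_points X Y f" for y
    using that D_one[of y] by (fastforce simp: branching_points_def)
  ultimately have bp: "branching_points X Y f = {Q (1 / 2), Q cone3, Q 0}" by blast
  have deg: "has_degree X Y f (3 * (m * n))"
    unfolding has_degree_def
  proof
    fix y assume y: "y \<in> topspace Y - branching_points X Y f"
    then obtain w where w: "y = Q w" using Q_range by blast
    have "D x = 1" if "x \<in> fibre X f y" for x using D_one[of y x] y that unfolding bp by blast
    then have "sum D (fibre X f y) = card (fibre X f y)" by simp
    then show "finite (fibre X f y) \<and> card (fibre X f y) = 3 * (m * n)"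
      using total_weight[of w] fibre_finite[of w] w by simp
  qed
  have ms: "mset_set (branching_points X Y f) = {#Q (1 / 2), Q cone3, Q 0#}"
    unfolding bp using ne by simp
  have "image_mset (local_degrees X Y f) (mset_set (branching_points X Y f)) =
    {# replicate_mset B2 2 + replicate_mset (4 - j) 1, replicate_mset (m * n) 3, replicate_mset B6 6 + replicate_mset j 3 #}"
    unfolding ms image_mset_add_mset image_mset_empty b6(1) b2(1) b3(1) eqs by (simp add: add.commute)
  then show ?thesis unfolding realizable_def using bc deg bp by (intro exI[of _ f]) auto
qed

end

section \<open>Choice of the sublattices\<close>

lemma realizable_by_lattice:
  assumes X: "X homeomorphic_space S2" and Y: "Y homeomorphic_space S2" and mn: "m > 0" "n > 0" and c: "2 * c \<in> \<int>"
    and j: "j = card {p \<in> {0, 1::nat} \<times> {0, 1::nat}. c + real (fst p) * real m / 2 \<in> \<int> \<and> real (snd p) * real n / 2 \<in> \<int>}"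
    and B: "j * 3 + B6 * 6 = 3 * (m * n)" "(4 - j) + B2 * 2 = 3 * (m * n)" "B2 \<ge> 1"
  shows "realizable X Y (3 * (m * n))
    {# replicate_mset B2 2 + replicate_mset (4 - j) 1, replicate_mset (m * n) 3, replicate_mset B6 6 + replicate_mset j 3 #}"
proof -
  obtain kX where kX: "homeomorphic_map (top_of_set R3_sphere) X kX" by (rule sphere_homeomorphism[OF X])
  obtain kY where kY: "homeomorphic_map (top_of_set R3_sphere) Y kY" by (rule sphere_homeomorphism[OF Y])
  interpret lattice_cover X Y kX kY m n c by unfold_locales fact+
  show ?thesis
  proof (rule realizable_lattice[OF _ B])
    show "j = card {p \<in> corners. half_node p \<in> eis}"
      unfolding j corners_def eis_iff coord_half_node ..
  qed
qed

lemma half_odd_notin_Ints: "odd i \<Longrightarrow> real i / 2 \<notin> \<int>"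
proof
  assume i: "odd i" "real i / 2 \<in> \<int>"
  then obtain k :: int where "real i / 2 = of_int k" by (metis Ints_cases)
  then have "real_of_int (int i) = of_int (2 * k)" by simp
  then have "int i = 2 * k" by (simp only: of_int_eq_iff)
  then show False using i(1) by presburger
qed

lemma half_even_in_Ints: "even i \<Longrightarrow> real i / 2 \<in> \<int>"
  by (auto elim!: evenE)

text \<open>With n = 1, corners of second index 1 have \<open>tcoord\<close> 1 / 2 and never lie in
  \<open>eis\<close>, so at most two corners count. For c = 1 / 2 and m = 2 * k none does. For c = 0
  the origin does, and the corner m / 2 joins it if m is even: m = 2 * k + 1 gives one, m = 2 * k +
  2 gives two.\<close>

lemma realizable_types_123:
  assumes X: "X homeomorphic_space S2" and Y: "Y homeomorphic_space S2" and k: "k \<ge> 1"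
  shows "realizable X Y (6 * k) (partitions_1 k)" "realizable X Y (6 * k + 3) (partitions_2 k)"
    "realizable X Y (6 * k + 6) (partitions_3 k)"
proof -
  have rep: "replicate_mset 2 x = {#x, x#}" "replicate_mset 3 x = {#x, x, x#}"
    "replicate_mset 4 x = {#x, x, x, x#}" for x :: nat by (simp_all add: numeral_eq_Suc)
  have h: "(1 / 2 :: real) \<notin> \<int>" by (rule half_notin_Ints)
  have "{p \<in> {0, 1::nat} \<times> {0, 1::nat}. 1 / 2 + real (fst p) * real (2 * k) / 2 \<in> \<int> \<and> real (snd p) * real 1 / 2 \<in> \<int>} = {}"
  proof -
    have "1 / 2 + real u * real (2 * k) / 2 \<notin> \<int>" for u
    proof
      assume "1 / 2 + real u * real (2 * k) / 2 \<in> \<int>"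
      moreover have "real u * real (2 * k) / 2 = of_nat (u * k)" by simp
      ultimately have "1 / 2 + of_nat (u * k) - of_nat (u * k) \<in> (\<int> :: real set)" by (metis Ints_diff Ints_of_nat)
      then show False using h by simp
    qed
    then show ?thesis by blast
  qed
  then have j: "0 = card {p \<in> {0, 1::nat} \<times> {0, 1::nat}. 1 / 2 + real (fst p) * real (2 * k) / 2 \<in> \<int> \<and> real (snd p) * real 1 / 2 \<in> \<int>}"
    by simp
  have "realizable X Y (3 * (2 * k * 1)) {# replicate_mset (3 * k - 2) 2 + replicate_mset (4 - 0) 1,
      replicate_mset (2 * k * 1) 3, replicate_mset k 6 + replicate_mset 0 3 #}"
    by (rule realizable_by_lattice[OF X Y _ _ _ j]) (use k in auto)
  then show "realizable X Y (6 * k) (partitions_1 k)" by (simp add: partitions_1_def rep)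
  have "{p \<in> {0, 1::nat} \<times> {0, 1::nat}. 0 + real (fst p) * real (2 * k + 1) / 2 \<in> \<int> \<and> real (snd p) * real 1 / 2 \<in> \<int>} = {(0, 0)}"
    using half_odd_notin_Ints[of "2 * k + 1"] h by auto
  then have j: "1 = card {p \<in> {0, 1::nat} \<times> {0, 1::nat}. 0 + real (fst p) * real (2 * k + 1) / 2 \<in> \<int> \<and> real (snd p) * real 1 / 2 \<in> \<int>}"
    by simp
  have "realizable X Y (3 * ((2 * k + 1) * 1)) {# replicate_mset (3 * k) 2 + replicate_mset (4 - 1) 1,
      replicate_mset ((2 * k + 1) * 1) 3, replicate_mset k 6 + replicate_mset 1 3 #}"
    by (rule realizable_by_lattice[OF X Y _ _ _ j]) (use k in auto)
  moreover have "3 * ((2 * k + 1) * 1) = 6 * k + 3" "(2 * k + 1) * 1 = 2 * k + 1" by simp_all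
  ultimately show "realizable X Y (6 * k + 3) (partitions_2 k)" by (simp only: partitions_2_def) (simp add: rep)
  have "{p \<in> {0, 1::nat} \<times> {0, 1::nat}. 0 + real (fst p) * real (2 * k + 2) / 2 \<in> \<int> \<and> real (snd p) * real 1 / 2 \<in> \<int>} = {(0, 0), (1, 0)}"
    using half_even_in_Ints[of "2 * k + 2"] h by auto
  then have j: "2 = card {p \<in> {0, 1::nat} \<times> {0, 1::nat}. 0 + real (fst p) * real (2 * k + 2) / 2 \<in> \<int> \<and> real (snd p) * real 1 / 2 \<in> \<int>}"
    by simp
  have "realizable X Y (3 * ((2 * k + 2) * 1)) {# replicate_mset (3 * k + 2) 2 + replicate_mset (4 - 2) 1,
      replicate_mset ((2 * k + 2) * 1) 3, replicate_mset k 6 + replicate_mset 2 3 #}"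
    by (rule realizable_by_lattice[OF X Y _ _ _ j]) (use k in auto)
  moreover have "3 * ((2 * k + 2) * 1) = 6 * k + 6" "(2 * k + 2) * 1 = 2 * k + 2" by simp_all
  ultimately show "realizable X Y (6 * k + 6) (partitions_3 k)" by (simp only: partitions_3_def) (simp add: rep)
qed

text \<open>For c = 0 and even m and n all four corners lie in \<open>eis\<close>. With n = 2 the
  degree requires m = k + 2, and this is even exactly if 12 divides 6 * k + 12.\<close>

lemma realizable_type_5:
  assumes X: "X homeomorphic_space S2" and Y: "Y homeomorphic_space S2" and k: "k \<ge> 1" and d: "12 dvd 6 * k + 12"
  shows "realizable X Y (6 * k + 12) (partitions_5 k)"
proof -
  have rep: "replicate_mset 4 x = {#x, x, x, x#}" for x :: nat by (simp add: numeral_eq_Suc)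
  have ev: "even k" using d by presburger
  have "{p \<in> {0, 1::nat} \<times> {0, 1::nat}. 0 + real (fst p) * real (k + 2) / 2 \<in> \<int> \<and> real (snd p) * real 2 / 2 \<in> \<int>} = {0, 1} \<times> {0, 1}"
    using half_even_in_Ints[of "k + 2"] ev by auto
  then have j: "4 = card {p \<in> {0, 1::nat} \<times> {0, 1::nat}. 0 + real (fst p) * real (k + 2) / 2 \<in> \<int> \<and> real (snd p) * real 2 / 2 \<in> \<int>}"
    by simp
  have "realizable X Y (3 * ((k + 2) * 2)) {# replicate_mset (3 * k + 6) 2 + replicate_mset (4 - 4) 1,
      replicate_mset ((k + 2) * 2) 3, replicate_mset k 6 + replicate_mset 4 3 #}"
    by (rule realizable_by_lattice[OF X Y _ _ _ j]) (use k in auto)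
  moreover have "3 * ((k + 2) * 2) = 6 * k + 12" "(k + 2) * 2 = 2 * k + 4" by simp_all
  ultimately show ?thesis by (simp only: partitions_5_def) (simp add: rep)
qed

theorem theorem3p10:
  fixes X :: "'a topology" and Y :: "'b topology"
  shows
    "(\<forall>d P.
        candidate_cover X Y d P \<and>
        induces_orbifold_cover X Y P (S2, {#2, 2, 2, 2#}) (S2, {#2, 3, 6#})
        \<longleftrightarrow>
        X homeomorphic_space S2 \<and> Y homeomorphic_space S2 \<and>
        (\<exists>k\<ge>1.
           d = 6*k \<and> P = partitions_1 k \<or>
           d = 6*k + 3 \<and> P = partitions_2 k \<or>
           d = 6*k + 6 \<and> P = partitions_3 k \<or>
           d = 6*k + 9 \<and> P = partitions_4 k \<or>
           d = 6*k + 12 \<and> P = partitions_5 k)) \<and>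
     (X homeomorphic_space S2 \<and> Y homeomorphic_space S2 \<longrightarrow>
        (\<forall>k\<ge>1.
           realizable X Y (6*k) (partitions_1 k) \<and>
           realizable X Y (6*k + 3) (partitions_2 k) \<and>
           realizable X Y (6*k + 6) (partitions_3 k) \<and>
           \<not> realizable X Y (6*k + 9) (partitions_4 k) \<and>
           (realizable X Y (6*k + 12) (partitions_5 k) \<longleftrightarrow> 12 dvd (6*k + 12))))"
proof (intro conjI allI impI iffI)
  fix d P
  assume A: "candidate_cover X Y d P \<and>
    induces_orbifold_cover X Y P (S2, {#2, 2, 2, 2#}) (S2, {#2, 3, 6#})"
  show "X homeomorphic_space S2" "Y homeomorphic_space S2"
    using A by (auto simp: induces_orbifold_cover_def orbifold_iso_def induced_source_def induced_target_def)
  show "\<exists>k\<ge>1. d = 6*k \<and> P = partitions_1 k \<or> d = 6*k + 3 \<and> P = partitions_2 k \<or>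
    d = 6*k + 6 \<and> P = partitions_3 k \<or> d = 6*k + 9 \<and> P = partitions_4 k \<or>
    d = 6*k + 12 \<and> P = partitions_5 k"
  proof (rule partitions_if_orbifold_data)
    show "is_partition d \<pi>" if "\<pi> \<in># P" for \<pi> using A that by (auto simp: candidate_cover_def)
    show "image_mset lcm_entries P = {#2, 3, 6#}" "cone_orders P = {#2, 2, 2, 2#}"
      using A by (auto simp: induces_orbifold_cover_def orbifold_iso_def induced_source_def
          induced_target_def cone_orders_def)
  qed
next
  fix d P
  assume A: "X homeomorphic_space S2 \<and> Y homeomorphic_space S2 \<and>
    (\<exists>k\<ge>1. d = 6*k \<and> P = partitions_1 k \<or> d = 6*k + 3 \<and> P = partitions_2 k \<or>
      d = 6*k + 6 \<and> P = partitions_3 k \<or> d = 6*k + 9 \<and> P = partitions_4 k \<or>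
      d = 6*k + 12 \<and> P = partitions_5 k)"
  then have X: "X homeomorphic_space S2" and Y: "Y homeomorphic_space S2" by simp_all
  from A obtain k where k: "k \<ge> 1" "d = 6*k \<and> P = partitions_1 k \<or> d = 6*k + 3 \<and> P = partitions_2 k \<or>
      d = 6*k + 6 \<and> P = partitions_3 k \<or> d = 6*k + 9 \<and> P = partitions_4 k \<or>
      d = 6*k + 12 \<and> P = partitions_5 k" by blast
  note data = orbifold_data_of_partitions[OF k]
  show "candidate_cover X Y d P"
    unfolding candidate_cover_def
    using data closed_surface_sphere[OF X] closed_surface_sphere[OF Y] euler_char_sphere[OF X] euler_char_sphere[OF Y]
    by simp
  show "induces_orbifold_cover X Y P (S2, {#2, 2, 2, 2#}) (S2, {#2, 3, 6#})"
    using data(5,6) X Y by (simp add: induces_orbifold_cover_def orbifold_iso_def induced_source_def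
        induced_target_def cone_orders_def)
next
  fix k :: nat
  assume "X homeomorphic_space S2 \<and> Y homeomorphic_space S2" and k: "k \<ge> 1"
  then have X: "X homeomorphic_space S2" and Y: "Y homeomorphic_space S2" by simp_all
  show "realizable X Y (6*k) (partitions_1 k)" "realizable X Y (6*k + 3) (partitions_2 k)"
    "realizable X Y (6*k + 6) (partitions_3 k)"
    by (rule realizable_types_123[OF X Y k])+
  show "12 dvd 6*k + 12" if "realizable X Y (6*k + 12) (partitions_5 k)"
    by (rule realizable_5_dvd[OF X Y that])
  show "realizable X Y (6*k + 12) (partitions_5 k)" if "12 dvd 6*k + 12"
    by (rule realizable_type_5[OF X Y k that])
  show "\<not> realizable X Y (6*k + 9) (partitions_4 k)"
    by (rule not_realizable_4[OF X Y])
qed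

end
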